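(* Let $\gamma_x:\mathbb{R}^d\to\mathbb{R}^n$ ($x\in\mathbb{R}^n$), with $\gamma_x(0)=x$, be a smoothly varying family of functions whose first and second derivatives in $\mathbb{R}^d$ satisfy Lipschitz conditions (and hence linear growth bounds). In other words, suppose there exists a positive constant $K$ such that for all $x,y\in\mathbb{R}^n$ and $\alpha,\beta\in\{1,\dots,d\}$ $$\left|\frac{\partial\gamma_x}{\partial u^\alpha}\Big|_{u=0}-\frac{\partial\gamma_y}{\partial u^\alpha}\Big|_{u=0}\right|\le K|x-y|,\qquad \left|\frac{\partial^2\gamma_x}{\partial u^\alpha\partial u^\beta}\Big|_{u=0}-\frac{\partial^2\gamma_y}{\partial u^\alpha\partial u^\beta}\Big|_{u=0}\right|\le K|x-y|$$ $$\left(\text{and hence}\quad \left|\frac{\partial\gamma_x}{\partial u^\alpha}\Big|_{u=0}\right|^2\le K^2(1+|x|^2),\qquad \left|\frac{\partial^2\gamma_x}{\partial u^\alpha\partial u^\beta}\Big|_{u=0}\right|^2\le K^2(1+|x|^2)\right).$$ Suppose in addition that there is a uniform bound on the third derivatives: $$\left|\frac{\partial^3\gamma_x}{\partial u^\alpha\partial u^\beta\partial u^\kappa}\Big|_{u=0}\right|\le K$$ for all $x\in\mathbb{R}^n$ and $\alpha,\beta,\kappa\in\{1,\dots,d\}$. Let $W=(W^1,\dots,W^d)$ be a standard $d$-dimensional Brownian motion, let $x_0\in\mathbb{R}^n$ and let $T$ be a fixed time. For $N\ge1$ put $\delta t=T/N$ and let $X^N$ denote the 2-jet scheme defined by $X^N_0=x_0$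 and $$X^N_{t+\epsilon}=\gamma_{X^N_t}\left(\frac{\epsilon}{\delta t}\,(W_{t+\delta t}-W_t)\right),\qquad t\in\{0,\delta t,2\,\delta t,\dots,(N-1)\,\delta t\},\ \epsilon\in[0,\delta t].$$ This converges in $L^2(\mathbb{P})$ to the classical It\^o solution $\tilde X$ of the corresponding SDE, namely $$\tilde X_t=\tilde X_0+\int_0^t a(\tilde X_s)\,ds+\sum_{\alpha=1}^d\int_0^t b_\alpha(\tilde X_s)\,dW^\alpha_s,\qquad t\in[0,T],\qquad \tilde X_0=x_0,$$ where $$a(x):=\frac12\sum_{\alpha=1}^d\frac{\partial^2\gamma_x}{\partial u^\alpha\partial u^\alpha}\Big|_{u=0},\qquad b_\alpha(x):=\frac{\partial\gamma_x}{\partial u^\alpha}\Big|_{u=0}.$$ More precisely, there is a constant $C$ independent of $N$ such that $$\sup_{t\in[0,T]}E\left\{|X^N_t-\tilde X_t|^2\right\}\le C\,\delta t=C\,\frac{T}{N}.$$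
   Context: $u=(u^1,\dots,u^d)$ denotes the standard orthonormal coordinates on $\mathbb{R}^d$. $\mathbb{P}$ is the underlying probability measure and $E$ its expectation. The limit of the scheme depends on $\gamma_x$ only through its 2-jet $j_2(\gamma_x)$ (the equivalence class of maps agreeing with $\gamma_x$ up to second order at $u=0$), and the limiting equation is regarded as a coordinate-free SDE, written symbolically as "$X_t$ is driven by $j_2(\gamma_{X_t})(dW_t)$".
   Formalization: The uniform bound K on the third derivatives of γ_x is assumed at every u, not only at u=0; with the bound at u=0 alone the claim fails, e.g. for γ_x(u)=x+exp(u^8)-1, whose scheme has infinite second moment. *)

theory Defs
  imports "HOL-Probability.Probability"
begin

section \<open>Smooth maps and partial derivatives\<close>

primrec times_cont_diff ::
    "nat \<Rightarrow> ('a::euclidean_space \<Rightarrow> 'b::real_normed_vector) \<Rightarrow> bool" where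
  "times_cont_diff 0 f \<longleftrightarrow> continuous_on UNIV f"
| "times_cont_diff (Suc k) f \<longleftrightarrow>
     (\<forall>x. f differentiable (at x)) \<and>
     (\<forall>v. times_cont_diff k (\<lambda>x. frechet_derivative f (at x) v))"

definition smooth :: "('a::euclidean_space \<Rightarrow> 'b::real_normed_vector) \<Rightarrow> bool" where
  "smooth f \<longleftrightarrow> (\<forall>k. times_cont_diff k f)"

definition partial_deriv ::
    "'d::finite \<Rightarrow> (real ^ 'd \<Rightarrow> 'b::real_normed_vector) \<Rightarrow> real ^ 'd \<Rightarrow> 'b" where
  "partial_deriv \<alpha> f u = vector_derivative (\<lambda>h. f (u + h *\<^sub>R axis \<alpha> 1)) (at 0)"


section \<open>Families of maps and the associated SDE coefficients\<close>

text \<open>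
  Lipschitz conditions are imposed on the first and second derivatives at \<open>u = 0\<close> only; they entail
  linear growth of these derivatives in \<open>x\<close>.  The bound on the third derivatives is imposed
  at every \<open>u\<close>, since it has to control the Taylor remainder of \<open>\<gamma> x\<close> at the Brownian increments.
  A bound at \<open>u = 0\<close> alone would not suffice: for \<open>d = n = 1\<close> the family
  \<open>\<gamma> x u = x + exp (u ^ 8) - 1\<close> has the same derivatives up to order three at \<open>u = 0\<close> as the
  constant map \<open>x\<close>, but its scheme has infinite second moments.
\<close>

definition admissible_family ::
    "(real ^ 'n \<Rightarrow> real ^ 'd::finite \<Rightarrow> real ^ 'n) \<Rightarrow> real \<Rightarrow> bool" where
  "admissible_family \<gamma> K \<longleftrightarrow>
     smooth (\<lambda>(x, u). \<gamma> x u) \<and>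
     (\<forall>x. \<gamma> x 0 = x) \<and>
     (\<forall>x y \<alpha>.
        norm (partial_deriv \<alpha> (\<gamma> x) 0 - partial_deriv \<alpha> (\<gamma> y) 0) \<le> K * norm (x - y)) \<and>
     (\<forall>x y \<alpha> \<beta>.
        norm (partial_deriv \<alpha> (partial_deriv \<beta> (\<gamma> x)) 0
              - partial_deriv \<alpha> (partial_deriv \<beta> (\<gamma> y)) 0) \<le> K * norm (x - y)) \<and>
     (\<forall>x u \<alpha> \<beta> \<kappa>.
        norm (partial_deriv \<alpha> (partial_deriv \<beta> (partial_deriv \<kappa> (\<gamma> x))) u) \<le> K)"

definition jet_drift :: "(real ^ 'n \<Rightarrow> real ^ 'd::finite \<Rightarrow> real ^ 'n) \<Rightarrow> real ^ 'n \<Rightarrow> real ^ 'n" where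
  "jet_drift \<gamma> x = (1 / 2) *\<^sub>R (\<Sum>\<alpha>\<in>UNIV. partial_deriv \<alpha> (partial_deriv \<alpha> (\<gamma> x)) 0)"

definition jet_diffusion ::
    "(real ^ 'n \<Rightarrow> real ^ 'd::finite \<Rightarrow> real ^ 'n) \<Rightarrow> 'd \<Rightarrow> real ^ 'n \<Rightarrow> real ^ 'n" where
  "jet_diffusion \<gamma> \<alpha> x = partial_deriv \<alpha> (\<gamma> x) 0"


section \<open>Brownian motion\<close>

text \<open>
  Processes are indexed by all reals, but only times \<open>t \<ge> 0\<close> matter; a filtration on
  \<open>[0, \<infinity>)\<close> is extended by \<open>F t = F 0\<close> for \<open>t < 0\<close>.  The filtration is any one for which \<open>W\<close> is a
  Brownian motion, for example the natural one, possibly augmented by null sets.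
\<close>

definition standard_brownian_motion ::
    "'w measure \<Rightarrow> (real \<Rightarrow> 'w measure) \<Rightarrow> (real \<Rightarrow> 'w \<Rightarrow> real ^ 'd::finite) \<Rightarrow> bool" where
  "standard_brownian_motion M F W \<longleftrightarrow>
     prob_space M \<and>
     filtration (space M) F \<and> (\<forall>t. subalgebra M (F t)) \<and>
     (\<forall>t\<ge>0. W t \<in> borel_measurable (F t)) \<and>
     (AE \<omega> in M. W 0 \<omega> = 0) \<and>
     (AE \<omega> in M. continuous_on {0..} (\<lambda>t. W t \<omega>)) \<and>
     (\<forall>s t. 0 \<le> s \<and> s < t \<longrightarrow>
        distributed M lborel (\<lambda>\<omega>. W t \<omega> - W s \<omega>)
          (\<lambda>x. ennreal (\<Prod>\<alpha>\<in>UNIV. normal_density 0 (sqrt (t - s)) (x $ \<alpha>))) \<and>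
        prob_space.indep_set M (sets (F s))
          {(\<lambda>\<omega>. W t \<omega> - W s \<omega>) -` A \<inter> space M | A. A \<in> sets borel})"


section \<open>Ito integral\<close>

definition mean_sq_dist :: "'w measure \<Rightarrow> ('w \<Rightarrow> 'b::real_normed_vector) \<Rightarrow> ('w \<Rightarrow> 'b) \<Rightarrow> ennreal" where
  "mean_sq_dist M Y Z = (\<integral>\<^sup>+\<omega>. ennreal ((norm (Y \<omega> - Z \<omega>))\<^sup>2) \<partial>M)"

text \<open>
  The data \<open>(n, \<tau>, \<xi>)\<close> encode the elementary process with value \<open>\<xi> i\<close> on \<open>[\<tau> i, \<tau> (i + 1))\<close>,
  \<open>i < n\<close>, and value \<open>0\<close> elsewhere.
\<close>

definition elementary_data ::
    "'w measure \<Rightarrow> (real \<Rightarrow> 'w measure) \<Rightarrow> real \<Rightarrow> nat \<Rightarrow> (nat \<Rightarrow> real) \<Rightarrow>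
     (nat \<Rightarrow> 'w \<Rightarrow> 'b::euclidean_space) \<Rightarrow> bool" where
  "elementary_data M F t n \<tau> \<xi> \<longleftrightarrow>
     0 \<le> \<tau> 0 \<and> \<tau> n \<le> t \<and>
     (\<forall>i<n. \<tau> i \<le> \<tau> (Suc i) \<and> \<xi> i \<in> borel_measurable (F (\<tau> i)) \<and>
            mean_sq_dist M (\<xi> i) (\<lambda>_. 0) < \<infinity>)"

definition elementary_process ::
    "nat \<Rightarrow> (nat \<Rightarrow> real) \<Rightarrow> (nat \<Rightarrow> 'w \<Rightarrow> 'b::euclidean_space) \<Rightarrow> real \<Rightarrow> 'w \<Rightarrow> 'b" where
  "elementary_process n \<tau> \<xi> s \<omega> = (\<Sum>i<n. indicator {\<tau> i..<\<tau> (Suc i)} s *\<^sub>R \<xi> i \<omega>)"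

definition elementary_integral ::
    "nat \<Rightarrow> (nat \<Rightarrow> real) \<Rightarrow> (nat \<Rightarrow> 'w \<Rightarrow> 'b::euclidean_space) \<Rightarrow> (real \<Rightarrow> 'w \<Rightarrow> real) \<Rightarrow> 'w \<Rightarrow> 'b" where
  "elementary_integral n \<tau> \<xi> B \<omega> = (\<Sum>i<n. (B (\<tau> (Suc i)) \<omega> - B (\<tau> i) \<omega>) *\<^sub>R \<xi> i \<omega>)"

text \<open>
  \<open>ito_integrand M F t f\<close> is the usual class of jointly measurable, adapted integrands on
  \<open>[0, t]\<close> with finite \<open>E \<integral> |f|\<^sup>2 ds\<close>, and \<open>has_ito_integral M F B t f I\<close> says that \<open>I\<close> is (a version
  of) the integral of \<open>f\<close> against \<open>B\<close> over \<open>[0, t]\<close>, i.e. the limit in mean square of the integrals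
  of elementary processes approximating \<open>f\<close>.
\<close>

definition ito_integrand ::
    "'w measure \<Rightarrow> (real \<Rightarrow> 'w measure) \<Rightarrow> real \<Rightarrow> (real \<Rightarrow> 'w \<Rightarrow> 'b::euclidean_space) \<Rightarrow> bool" where
  "ito_integrand M F t f \<longleftrightarrow>
     (\<lambda>(s, \<omega>). f s \<omega>) \<in> borel_measurable (restrict_space lborel {0..t} \<Otimes>\<^sub>M M) \<and>
     (\<forall>s\<in>{0..t}. f s \<in> borel_measurable (F s)) \<and>
     (\<integral>\<^sup>+s\<in>{0..t}. mean_sq_dist M (f s) (\<lambda>_. 0) \<partial>lborel) < \<infinity>"

definition has_ito_integral ::
    "'w measure \<Rightarrow> (real \<Rightarrow> 'w measure) \<Rightarrow> (real \<Rightarrow> 'w \<Rightarrow> real) \<Rightarrow> real \<Rightarrow>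
     (real \<Rightarrow> 'w \<Rightarrow> 'b::euclidean_space) \<Rightarrow> ('w \<Rightarrow> 'b) \<Rightarrow> bool" where
  "has_ito_integral M F B t f I \<longleftrightarrow>
     ito_integrand M F t f \<and> I \<in> borel_measurable M \<and>
     (\<exists>n \<tau> \<xi>.
        (\<forall>k. elementary_data M F t (n k) (\<tau> k) (\<xi> k)) \<and>
        (\<lambda>k. \<integral>\<^sup>+s\<in>{0..t}. mean_sq_dist M (f s) (elementary_process (n k) (\<tau> k) (\<xi> k) s) \<partial>lborel)
          \<longlonglongrightarrow> 0 \<and>
        (\<lambda>k. mean_sq_dist M I (elementary_integral (n k) (\<tau> k) (\<xi> k) B)) \<longlonglongrightarrow> 0)"


section \<open>Ito solutions of SDEs\<close>

definition ito_solution ::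
    "'w measure \<Rightarrow> (real \<Rightarrow> 'w measure) \<Rightarrow> (real \<Rightarrow> 'w \<Rightarrow> real ^ 'd::finite) \<Rightarrow> real \<Rightarrow>
     (real ^ 'n \<Rightarrow> real ^ 'n) \<Rightarrow> ('d \<Rightarrow> real ^ 'n \<Rightarrow> real ^ 'n) \<Rightarrow> real ^ 'n \<Rightarrow>
     (real \<Rightarrow> 'w \<Rightarrow> real ^ 'n) \<Rightarrow> bool" where
  "ito_solution M F W T a b x\<^sub>0 X \<longleftrightarrow>
     (\<forall>t\<in>{0..T}. X t \<in> borel_measurable (F t)) \<and>
     (AE \<omega> in M. continuous_on {0..T} (\<lambda>t. X t \<omega>)) \<and>
     (\<exists>J. \<forall>t\<in>{0..T}.
        (\<forall>\<alpha>. has_ito_integral M F (\<lambda>s \<omega>. W s \<omega> $ \<alpha>) t (\<lambda>s \<omega>. b \<alpha> (X s \<omega>)) (J \<alpha> t)) \<and>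
        (AE \<omega> in M. X t \<omega> = x\<^sub>0 + (LINT s:{0..t}|lborel. a (X s \<omega>)) + (\<Sum>\<alpha>\<in>UNIV. J \<alpha> t \<omega>)))"


section \<open>The 2-jet scheme\<close>

primrec jet_grid ::
    "(real ^ 'n \<Rightarrow> real ^ 'd::finite \<Rightarrow> real ^ 'n) \<Rightarrow> (real \<Rightarrow> 'w \<Rightarrow> real ^ 'd) \<Rightarrow> real ^ 'n \<Rightarrow> real \<Rightarrow>
     nat \<Rightarrow> 'w \<Rightarrow> real ^ 'n" where
  "jet_grid \<gamma> W x\<^sub>0 \<delta> 0 \<omega> = x\<^sub>0"
| "jet_grid \<gamma> W x\<^sub>0 \<delta> (Suc k) \<omega> =
     \<gamma> (jet_grid \<gamma> W x\<^sub>0 \<delta> k \<omega>) (W (real k * \<delta> + \<delta>) \<omega> - W (real k * \<delta>) \<omega>)"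

definition jet_scheme ::
    "(real ^ 'n \<Rightarrow> real ^ 'd::finite \<Rightarrow> real ^ 'n) \<Rightarrow> (real \<Rightarrow> 'w \<Rightarrow> real ^ 'd) \<Rightarrow> real ^ 'n \<Rightarrow> real \<Rightarrow>
     nat \<Rightarrow> real \<Rightarrow> 'w \<Rightarrow> real ^ 'n" where
  "jet_scheme \<gamma> W x\<^sub>0 T N t \<omega> =
     (let \<delta> = T / real N; k = nat \<lfloor>t / \<delta>\<rfloor>
      in \<gamma> (jet_grid \<gamma> W x\<^sub>0 \<delta> k \<omega>)
           (((t - real k * \<delta>) / \<delta>) *\<^sub>R (W (real k * \<delta> + \<delta>) \<omega> - W (real k * \<delta>) \<omega>)))"

text \<open>
  The closed form above satisfies the recursion that characterises the scheme on \<open>[0, T]\<close>.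
\<close>

lemma jet_scheme_grid:
  assumes "T > 0" "N \<ge> 1" "\<And>x. \<gamma> x 0 = x"
  shows "jet_scheme \<gamma> W x\<^sub>0 T N (real k * (T / real N)) \<omega> = jet_grid \<gamma> W x\<^sub>0 (T / real N) k \<omega>"
proof -
  define \<delta> where "\<delta> = T / real N"
  have "\<delta> > 0" using assms by (simp add: \<delta>_def)
  then show ?thesis
    unfolding jet_scheme_def Let_def \<delta>_def[symmetric] by (simp add: assms(3))
qed

lemma jet_scheme_0:
  assumes "T > 0" "N \<ge> 1" "\<And>x. \<gamma> x 0 = x"
  shows "jet_scheme \<gamma> W x\<^sub>0 T N 0 \<omega> = x\<^sub>0"
  using jet_scheme_grid[where \<gamma> = \<gamma> and k = 0, OF assms] by simp

lemma jet_scheme_step: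
  fixes N k :: nat and T \<epsilon> :: real
  defines "\<delta> \<equiv> T / real N"
  assumes "T > 0" "N \<ge> 1" "\<And>x. \<gamma> x 0 = x" and \<epsilon>: "0 \<le> \<epsilon>" "\<epsilon> \<le> \<delta>"
  shows "jet_scheme \<gamma> W x\<^sub>0 T N (real k * \<delta> + \<epsilon>) \<omega> =
         \<gamma> (jet_scheme \<gamma> W x\<^sub>0 T N (real k * \<delta>) \<omega>)
           ((\<epsilon> / \<delta>) *\<^sub>R (W (real k * \<delta> + \<delta>) \<omega> - W (real k * \<delta>) \<omega>))"
proof -
  have pos: "\<delta> > 0" using assms by (simp add: \<delta>_def)
  note grid = jet_scheme_grid[where \<gamma> = \<gamma>, OF assms(2-4), folded \<delta>_def]
  show ?thesis
  proof (cases "\<epsilon> = \<delta>")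
    case True
    have "real k * \<delta> + \<epsilon> = real (Suc k) * \<delta>" using True by (simp add: algebra_simps)
    then show ?thesis using pos True by (simp only: grid) simp
  next
    case False
    have "\<lfloor>(real k * \<delta> + \<epsilon>) / \<delta>\<rfloor> = int k"
      using pos \<epsilon> False by (intro floor_unique) (auto simp: field_simps)
    then show ?thesis
      unfolding grid unfolding jet_scheme_def Let_def \<delta>_def[symmetric] by simp
  qed
qed

end

theory Submission
  imports Defs
begin

text \<open>
  Over a step of length \<open>h = t - s\<close> both the scheme and the solution expand as
  \<open>Y + h a(Y) + \<Sum>\<^sub>\<alpha> b\<^sub>\<alpha>(Y) dW\<^sub>\<alpha>\<close>, \<open>Y\<close> being the value at time \<open>s\<close>, plus a remainder whose mean square is
  \<open>O(h\<^sup>3)\<close> and another one whose mean square is only \<open>O(h\<^sup>2)\<close> but which is orthogonal in \<open>L\<^sup>2\<close> to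
  everything measurable at time \<open>s\<close>.  For the scheme this is Taylor's formula, with the quadratic term
  compensated by its mean \<open>h a(Y)\<close>; for the solution it follows from the Lipschitz conditions and
  \<open>E|X\<^sub>r - X\<^sub>s|\<^sup>2 = O(r - s)\<close>.  The orthogonal remainders do not interact with the error accumulated up to
  time \<open>s\<close>, so the mean square error \<open>e\<close> satisfies \<open>e(t) \<le> (1 + C h) e(s) + C h\<^sup>2\<close>, and the discrete Gronwall
  inequality gives \<open>e = O(h)\<close> at the grid points.  Between them both processes move by \<open>O(h)\<close> in
  mean square.

  Orthogonality and mean square bounds for Ito integrals are inherited from elementary integrals,
  where they reduce to the covariance of two increments \<open>\<xi> (B\<^sub>b - B\<^sub>a)\<close> and \<open>\<eta> (B\<^sub>d - B\<^sub>c)\<close>: it is \<open>E(\<xi> \<bullet> \<eta>)\<close>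
  times the length of \<open>[a, b] \<inter> [c, d]\<close>.
\<close>

section \<open>Square-integrable random variables\<close>

text \<open>Counting orders explains the two kinds of remainder. There are about T / h steps, so
  each may add only O(h^2) to the mean square error. A remainder U correlated with the accumulated
  error e enters through 2 E(e . U), at most h E|e|^2 + E|U|^2 / h, so E|U|^2 has to be O(h^3). A
  remainder orthogonal to e has no such cross term and may have mean square O(h^2). That is the size
  of the compensated products of Brownian increments and of the Ito integral of b(X_r) - b(X_s);
  bounded like U they would add O(h) per step, and no convergence would follow.

  The cancellation is available at grid points only. In between, the scheme depends on the increment
  up to the next grid point, hence on the future, so there only the size of its displacement is
  estimated.

  On the other side X is an arbitrary solution, known only through the definition: its second
  moments and the order of its increments have to be derived from the equation itself.\<close>

definition sq_integrable :: "'w measure \<Rightarrow> ('w \<Rightarrow> 'b::euclidean_space) \<Rightarrow> bool" where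
  "sq_integrable M Y \<longleftrightarrow> Y \<in> borel_measurable M \<and> integrable M (\<lambda>w. (norm (Y w))\<^sup>2)"

text \<open>Real-valued, unlike \<open>mean_sq_dist\<close>, because the error recursion expands
  squares into inner products of either sign. Meaningful only together with
  \<open>sq_integrable\<close>, since the integral of a non-integrable function is 0.\<close>

definition msq :: "'w measure \<Rightarrow> ('w \<Rightarrow> 'b::euclidean_space) \<Rightarrow> real" where
  "msq M Y = (LINT w|M. (norm (Y w))\<^sup>2)"

lemma msq_nonneg [simp]: "0 \<le> msq M Y"
  by (simp add: msq_def)

lemma sq_integrable_measurable: "sq_integrable M Y \<Longrightarrow> Y \<in> borel_measurable M"
  by (simp add: sq_integrable_def)

lemma sq_integrable_dominated:
  assumes Y: "Y \<in> borel_measurable M" and Z: "integrable M Z"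
    and le: "AE w in M. (norm (Y w))\<^sup>2 \<le> Z w"
  shows "sq_integrable M Y" and "msq M Y \<le> (LINT w|M. Z w)"
proof -
  have i: "integrable M (\<lambda>w. (norm (Y w))\<^sup>2)"
    by (rule Bochner_Integration.integrable_bound[OF Z]) (use Y le in auto)
  then show "sq_integrable M Y" using Y by (simp add: sq_integrable_def)
  show "msq M Y \<le> (LINT w|M. Z w)"
    unfolding msq_def by (intro integral_mono_AE i Z le)
qed

lemma sq_integrable_bound:
  assumes "Y \<in> borel_measurable M" "sq_integrable M Z" "AE w in M. norm (Y w) \<le> norm (Z w)"
  shows "sq_integrable M Y" and "msq M Y \<le> msq M Z"
proof -
  have le: "AE w in M. (norm (Y w))\<^sup>2 \<le> (norm (Z w))\<^sup>2"
    using assms(3) by eventually_elim (auto intro: power_mono)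
  have "integrable M (\<lambda>w. (norm (Z w))\<^sup>2)" using assms(2) by (simp add: sq_integrable_def)
  from sq_integrable_dominated[OF assms(1) this le]
  show "sq_integrable M Y" and "msq M Y \<le> msq M Z" by (simp_all add: msq_def)
qed

lemma norm_add_sq_le: "(norm (x + y :: 'b::real_normed_vector))\<^sup>2 \<le> 2 * (norm x)\<^sup>2 + 2 * (norm y)\<^sup>2"
proof -
  have "(norm (x + y))\<^sup>2 \<le> (norm x + norm y)\<^sup>2" by (intro power_mono norm_triangle_ineq) auto
  also have "\<dots> \<le> 2 * (norm x)\<^sup>2 + 2 * (norm y)\<^sup>2" using sum_squares_bound[of "norm x" "norm y"] by (simp add: power2_sum)
  finally show ?thesis .
qed

lemma sq_integrable_add:
  assumes "sq_integrable M Y" "sq_integrable M Z"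
  shows "sq_integrable M (\<lambda>w. Y w + Z w)"
    and msq_add_le: "msq M (\<lambda>w. Y w + Z w) \<le> 2 * msq M Y + 2 * msq M Z"
proof -
  have m: "(\<lambda>w. Y w + Z w) \<in> borel_measurable M"
    using assms by (auto simp: sq_integrable_def)
  have i: "integrable M (\<lambda>w. 2 * (norm (Y w))\<^sup>2 + 2 * (norm (Z w))\<^sup>2)"
    using assms by (auto simp: sq_integrable_def)
  note * = sq_integrable_dominated[OF m i]
  show "sq_integrable M (\<lambda>w. Y w + Z w)" by (rule *) (simp add: norm_add_sq_le)
  have "msq M (\<lambda>w. Y w + Z w) \<le> (LINT w|M. 2 * (norm (Y w))\<^sup>2 + 2 * (norm (Z w))\<^sup>2)"
    by (rule *) (simp add: norm_add_sq_le)
  also have "\<dots> = 2 * msq M Y + 2 * msq M Z"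
    using assms by (simp add: sq_integrable_def msq_def)
  finally show "msq M (\<lambda>w. Y w + Z w) \<le> 2 * msq M Y + 2 * msq M Z" .
qed

lemma sq_integrable_scaleR:
  "sq_integrable M Y \<Longrightarrow> sq_integrable M (\<lambda>w. c *\<^sub>R Y w)"
  by (auto simp: sq_integrable_def power_mult_distrib)

lemma msq_scaleR: "msq M (\<lambda>w. c *\<^sub>R Y w) = c\<^sup>2 * msq M Y"
  by (auto simp: msq_def power_mult_distrib)

lemma sq_integrable_minus: "sq_integrable M (\<lambda>w. - Y w) \<longleftrightarrow> sq_integrable M Y"
  by (simp add: sq_integrable_def)

lemma msq_minus: "msq M (\<lambda>w. - Y w) = msq M Y"
  by (simp add: msq_def)

lemma sq_integrable_diff:
  assumes "sq_integrable M Y" "sq_integrable M Z"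
  shows "sq_integrable M (\<lambda>w. Y w - Z w)"
    and msq_diff_le: "msq M (\<lambda>w. Y w - Z w) \<le> 2 * msq M Y + 2 * msq M Z"
proof -
  have "sq_integrable M (\<lambda>w. - Z w)" using assms by (simp add: sq_integrable_minus)
  note * = sq_integrable_add[OF assms(1) this] msq_add_le[OF assms(1) this]
  then show "sq_integrable M (\<lambda>w. Y w - Z w)" by simp
  show "msq M (\<lambda>w. Y w - Z w) \<le> 2 * msq M Y + 2 * msq M Z"
    using * by (simp add: msq_minus)
qed

lemma sq_integrable_zero: "sq_integrable M (\<lambda>w. 0)"
  by (simp add: sq_integrable_def)

lemma sq_integrable_sum:
  assumes "\<And>i. i \<in> A \<Longrightarrow> sq_integrable M (Y i)"
  shows "sq_integrable M (\<lambda>w. \<Sum>i\<in>A. Y i w)"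
  using assms by (induction A rule: infinite_finite_induct) (auto simp: sq_integrable_zero intro: sq_integrable_add)

lemma norm_sum_sq_le:
  "(norm (\<Sum>i\<in>A. f i :: 'b::real_normed_vector))\<^sup>2 \<le> real (card A) * (\<Sum>i\<in>A. (norm (f i))\<^sup>2)"
proof -
  have "(norm (\<Sum>i\<in>A. f i))\<^sup>2 \<le> (\<Sum>i\<in>A. norm (f i) * 1)\<^sup>2"
    by (intro power_mono) (auto intro: norm_sum)
  also have "\<dots> \<le> (\<Sum>i\<in>A. (norm (f i))\<^sup>2) * (\<Sum>i\<in>A. 1\<^sup>2)" by (rule Cauchy_Schwarz_ineq_sum)
  finally show ?thesis by (simp add: mult.commute)
qed

lemma msq_sum_le:
  assumes "\<And>i. i \<in> A \<Longrightarrow> sq_integrable M (Y i)"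
  shows "msq M (\<lambda>w. \<Sum>i\<in>A. Y i w) \<le> real (card A) * (\<Sum>i\<in>A. msq M (Y i))"
proof -
  have i: "integrable M (\<lambda>w. (norm (Y i w))\<^sup>2)" if "i \<in> A" for i
    using assms[OF that] by (simp add: sq_integrable_def)
  have "msq M (\<lambda>w. \<Sum>i\<in>A. Y i w) \<le> (LINT w|M. real (card A) * (\<Sum>i\<in>A. (norm (Y i w))\<^sup>2))"
    by (rule sq_integrable_dominated)
      (use assms i in \<open>auto simp: norm_sum_sq_le sq_integrable_measurable intro!: borel_measurable_sum\<close>)
  also have "\<dots> = real (card A) * (\<Sum>i\<in>A. msq M (Y i))"
    using i by (simp add: msq_def)
  finally show ?thesis .
qed

lemma sq_integrable_inner:
  assumes "sq_integrable M Y" "sq_integrable M Z"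
  shows "integrable M (\<lambda>w. Y w \<bullet> Z w)"
proof -
  have "norm (Y w \<bullet> Z w) \<le> norm ((norm (Y w))\<^sup>2 + (norm (Z w))\<^sup>2)" for w
  proof -
    have "\<bar>Y w \<bullet> Z w\<bar> \<le> norm (Y w) * norm (Z w)" by (rule Cauchy_Schwarz_ineq2)
    also have "\<dots> \<le> (norm (Y w))\<^sup>2 + (norm (Z w))\<^sup>2"
      using sum_squares_bound[of "norm (Y w)" "norm (Z w)"] mult_nonneg_nonneg[of "norm (Y w)" "norm (Z w)"]
      by (simp del: mult_nonneg_nonneg)
    finally show ?thesis by simp
  qed
  then have "AE w in M. norm (Y w \<bullet> Z w) \<le> norm ((norm (Y w))\<^sup>2 + (norm (Z w))\<^sup>2)" by simp
  moreover have "integrable M (\<lambda>w. (norm (Y w))\<^sup>2 + (norm (Z w))\<^sup>2)"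
    using assms by (simp add: sq_integrable_def)
  moreover have "(\<lambda>w. Y w \<bullet> Z w) \<in> borel_measurable M"
    using assms by (auto simp: sq_integrable_def intro: borel_measurable_inner)
  ultimately show ?thesis
    by (rule Bochner_Integration.integrable_bound[rotated -1])
qed

lemma msq_add:
  assumes "sq_integrable M Y" "sq_integrable M Z"
  shows "msq M (\<lambda>w. Y w + Z w) = msq M Y + msq M Z + 2 * (LINT w|M. Y w \<bullet> Z w)"
proof -
  have "(norm (Y w + Z w))\<^sup>2 = (norm (Y w))\<^sup>2 + (norm (Z w))\<^sup>2 + 2 * (Y w \<bullet> Z w)" for w
    by (simp add: power2_norm_eq_inner inner_add inner_commute)
  then show ?thesis unfolding msq_def
    using assms sq_integrable_inner[OF assms] by (simp add: sq_integrable_def)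
qed

text \<open>Young's inequality with a free weight. The weight is the step length in
  \<open>jet_step\<close> and a parameter sent to 0 in
  \<open>integral_inner_limit_zero\<close>.\<close>

lemma two_inner_le:
  fixes x y :: "'b::real_inner"
  assumes "c > 0"
  shows "2 * \<bar>x \<bullet> y\<bar> \<le> c * (norm x)\<^sup>2 + (norm y)\<^sup>2 / c"
proof -
  have "0 \<le> (sqrt c * norm x - norm y / sqrt c)\<^sup>2" by simp
  also have "\<dots> = c * (norm x)\<^sup>2 + (norm y)\<^sup>2 / c - 2 * (norm x * norm y)"
    using assms by (simp add: power2_diff power_mult_distrib power_divide)
  finally show ?thesis using Cauchy_Schwarz_ineq2[of x y] by linarith
qed

lemma two_integral_inner_le:
  assumes "sq_integrable M Y" "sq_integrable M Z" "c > 0"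
  shows "2 * \<bar>LINT w|M. Y w \<bullet> Z w\<bar> \<le> c * msq M Y + msq M Z / c"
proof -
  note i = sq_integrable_inner[OF assms(1,2)]
  have "2 * \<bar>LINT w|M. Y w \<bullet> Z w\<bar> \<le> (LINT w|M. 2 * \<bar>Y w \<bullet> Z w\<bar>)"
    using integral_norm_bound[of M "\<lambda>w. Y w \<bullet> Z w"] by simp
  also have "\<dots> \<le> (LINT w|M. c * (norm (Y w))\<^sup>2 + (norm (Z w))\<^sup>2 / c)"
    using assms i by (intro integral_mono two_inner_le) (auto simp: sq_integrable_def)
  also have "\<dots> = c * msq M Y + msq M Z / c"
    using assms by (simp add: sq_integrable_def msq_def)
  finally show ?thesis .
qed

text \<open>Carries orthogonality over to mean square limits. The inner product \<open>r\<close> is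
  the same along the whole sequence, so for a fixed weight \<open>c\<close> the second term of
  Young's bound vanishes in the limit, after which \<open>c\<close> may be made small.\<close>

lemma integral_inner_limit_zero:
  assumes Y: "sq_integrable M Y" and Z: "\<And>k. sq_integrable M (Z k)"
    and lim: "(\<lambda>k. msq M (Z k)) \<longlonglongrightarrow> 0" and eq: "\<And>k::nat. (LINT w|M. Y w \<bullet> Z k w) = r"
  shows "r = 0"
proof -
  have *: "2 * \<bar>r\<bar> \<le> c * msq M Y" if "c > 0" for c
  proof (rule LIMSEQ_le_const)
    show "(\<lambda>k. c * msq M Y + msq M (Z k) / c) \<longlonglongrightarrow> c * msq M Y"
      using tendsto_add[OF tendsto_const tendsto_divide[OF lim tendsto_const, of c], of "c * msq M Y"] that by simp
    show "\<exists>N. \<forall>n\<ge>N. 2 * \<bar>r\<bar> \<le> c * msq M Y + msq M (Z n) / c"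
      using two_integral_inner_le[OF Y Z that] eq by simp
  qed
  have "\<bar>r\<bar> \<le> 0"
  proof (rule field_le_epsilon)
    fix e :: real assume "e > 0"
    have "msq M Y < msq M Y + 1" "0 < msq M Y + 1" by (auto simp: add_nonneg_pos)
    \<comment> \<open>The added 1 keeps the denominator of the weight positive when
      \<open>msq M Y\<close> is 0.\<close>
    have "2 * \<bar>r\<bar> \<le> (e / (msq M Y + 1)) * msq M Y" using \<open>e > 0\<close> by (intro *) (simp add: add_nonneg_pos)
    also have "\<dots> \<le> e" using \<open>e > 0\<close> \<open>0 < msq M Y + 1\<close> by (simp add: field_simps)
    finally show "\<bar>r\<bar> \<le> 0 + e" using \<open>e > 0\<close> by simp
  qed
  then show ?thesis by simp
qed

lemma mean_sq_dist_eq_msq: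
  "sq_integrable M (\<lambda>w. Y w - Z w) \<Longrightarrow> mean_sq_dist M Y Z = ennreal (msq M (\<lambda>w. Y w - Z w))"
  unfolding mean_sq_dist_def msq_def sq_integrable_def by (intro nn_integral_eq_integral) auto

lemma sq_integrable_iff_mean_sq:
  assumes "Y \<in> borel_measurable M"
  shows "sq_integrable M Y \<longleftrightarrow> mean_sq_dist M Y (\<lambda>_. 0) < \<infinity>"
  using assms unfolding sq_integrable_def mean_sq_dist_def
  by (simp add: integrable_iff_bounded)

lemma sq_integrable_mean_sq_bound:
  assumes "Y \<in> borel_measurable M" "mean_sq_dist M Y (\<lambda>_. 0) \<le> ennreal c" "0 \<le> c"
  shows "sq_integrable M Y" and "msq M Y \<le> c"
proof -
  show s: "sq_integrable M Y"
    using assms by (subst sq_integrable_iff_mean_sq) (auto intro: le_less_trans)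
  then have "ennreal (msq M Y) \<le> ennreal c"
    using assms mean_sq_dist_eq_msq[of M Y "\<lambda>_. 0"] by simp
  then show "msq M Y \<le> c" using assms by simp
qed

lemma mean_sq_dist_triangle:
  assumes [measurable]: "X \<in> borel_measurable M" "Y \<in> borel_measurable M" "Z \<in> borel_measurable M"
  shows "mean_sq_dist M X (Z :: 'w \<Rightarrow> 'b::euclidean_space) \<le> 2 * mean_sq_dist M X Y + 2 * mean_sq_dist M Y Z"
proof -
  have "mean_sq_dist M X Z \<le> (\<integral>\<^sup>+w. 2 * ennreal ((norm (X w - Y w))\<^sup>2) + 2 * ennreal ((norm (Y w - Z w))\<^sup>2) \<partial>M)"
    unfolding mean_sq_dist_def
  proof (rule nn_integral_mono)
    fix w
    have "(norm (X w - Z w))\<^sup>2 \<le> 2 * (norm (X w - Y w))\<^sup>2 + 2 * (norm (Y w - Z w))\<^sup>2"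
      using norm_add_sq_le[of "X w - Y w" "Y w - Z w"] by simp
    then show "ennreal ((norm (X w - Z w))\<^sup>2) \<le> 2 * ennreal ((norm (X w - Y w))\<^sup>2) + 2 * ennreal ((norm (Y w - Z w))\<^sup>2)"
      by (subst (1 2) ennreal_numeral[symmetric], subst (1 2) ennreal_mult[symmetric], simp_all,
          subst ennreal_plus[symmetric], simp_all del: ennreal_plus)
  qed
  also have "\<dots> = 2 * mean_sq_dist M X Y + 2 * mean_sq_dist M Y Z"
    unfolding mean_sq_dist_def by (subst nn_integral_add) (auto simp: nn_integral_cmult)
  finally show ?thesis .
qed

lemma mean_sq_dist_commute: "mean_sq_dist M Y Z = mean_sq_dist M Z Y"
  by (simp add: mean_sq_dist_def norm_minus_commute)

section \<open>Increments of Brownian motion\<close>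

text \<open>\<open>lborel\<close> on a Euclidean space is the image of a product of one-dimensional
  measures indexed by basis vectors. The factorisation is thus that of product measures, once the
  index \<open>\<alpha>\<close> is traded for the vector \<open>axis \<alpha> 1\<close>;
  \<open>g\<close> is \<open>f\<close> re-indexed in this way.\<close>

lemma integral_lborel_prod_vec:
  fixes f :: "'d::finite \<Rightarrow> real \<Rightarrow> real"
  assumes f: "\<And>\<alpha>. integrable lborel (f \<alpha>)"
  shows "integrable lborel (\<lambda>x::real^'d. \<Prod>\<alpha>\<in>UNIV. f \<alpha> (x $ \<alpha>))"
    and "(LINT x|lborel. (\<Prod>\<alpha>\<in>UNIV. f \<alpha> ((x::real^'d) $ \<alpha>))) = (\<Prod>\<alpha>\<in>UNIV. LINT x|lborel. f \<alpha> x)"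
proof -
  define g :: "real^'d \<Rightarrow> real \<Rightarrow> real" where "g b = f (THE \<alpha>. b = axis \<alpha> 1)" for b
  have g_axis: "g (axis \<alpha> 1) = f \<alpha>" for \<alpha>
    unfolding g_def by (rule arg_cong[where f=f], rule the_equality) (auto simp: axis_eq_axis)
  have Basis: "(Basis :: (real^'d) set) = range (\<lambda>\<alpha>. axis \<alpha> 1)" by (auto simp: Basis_vec_def)
  have inj: "inj (\<lambda>\<alpha>::'d. axis \<alpha> (1::real))" by (auto simp: inj_on_def axis_eq_axis)
  have g: "integrable lborel (g b)" if "b \<in> Basis" for b
    using that f by (auto simp: Basis g_axis)
  have coord: "(\<Sum>b\<in>Basis. y b *\<^sub>R b) $ \<alpha> = y (axis \<alpha> 1)" for y and \<alpha> :: 'd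
  proof -
    have "(\<Sum>b\<in>Basis. y b *\<^sub>R b) $ \<alpha> = (\<Sum>b\<in>Basis. y b *\<^sub>R b) \<bullet> axis \<alpha> 1" by (simp add: inner_axis)
    also have "\<dots> = y (axis \<alpha> 1)"
      by (subst inner_sum_left_Basis) (auto simp: Basis_vec_def)
    finally show ?thesis .
  qed
  have prod: "(\<Prod>\<alpha>\<in>UNIV. f \<alpha> ((\<Sum>b\<in>Basis. y b *\<^sub>R b) $ \<alpha>)) = (\<Prod>b\<in>Basis. g b (y b))" for y
    unfolding Basis coord[unfolded Basis] by (subst prod.reindex[OF inj]) (simp add: g_axis)
  interpret product_sigma_finite "\<lambda>b::real^'d. interval_measure (\<lambda>x. x)"
    unfolding lborel_eq_real[symmetric] by unfold_locales
  have [measurable]: "f \<alpha> \<in> borel_measurable borel" for \<alpha> using f[of \<alpha>] by auto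
  have g': "integrable (interval_measure (\<lambda>x. x)) (g b)" if "b \<in> Basis" for b
    using g[OF that] by (simp add: lborel_eq_real)
  show "integrable lborel (\<lambda>x::real^'d. \<Prod>\<alpha>\<in>UNIV. f \<alpha> (x $ \<alpha>))"
    unfolding lborel_def
    by (subst integrable_distr_eq, measurable, subst prod) (rule product_integrable_prod[OF finite_Basis g'])
  have "(LINT x|lborel. (\<Prod>\<alpha>\<in>UNIV. f \<alpha> ((x::real^'d) $ \<alpha>))) =
    (\<Prod>b\<in>Basis. LINT x|interval_measure (\<lambda>x. x). g b x)"
    unfolding lborel_def
    by (subst integral_distr, measurable, subst prod) (rule product_integral_prod[OF finite_Basis g'])
  also have "\<dots> = (\<Prod>\<alpha>\<in>UNIV. LINT x|lborel. f \<alpha> x)"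
    unfolding Basis by (subst prod.reindex[OF inj]) (simp add: g_axis lborel_eq_real)
  finally show "(LINT x|lborel. (\<Prod>\<alpha>\<in>UNIV. f \<alpha> ((x::real^'d) $ \<alpha>))) = (\<Prod>\<alpha>\<in>UNIV. LINT x|lborel. f \<alpha> x)" .
qed

lemma borel_measurable_vec_nth [measurable (raw)]:
  fixes Y :: "'w \<Rightarrow> real ^ 'd::finite"
  assumes "Y \<in> borel_measurable M"
  shows "(\<lambda>w. Y w $ \<alpha>) \<in> borel_measurable M"
proof -
  have "(\<lambda>x::real^'d. x $ \<alpha>) \<in> borel_measurable borel"
    by (intro borel_measurable_continuous_onI continuous_intros)
  from measurable_compose[OF assms this] show ?thesis .
qed

locale brownian =
  fixes M :: "'w measure" and F :: "real \<Rightarrow> 'w measure" and W :: "real \<Rightarrow> 'w \<Rightarrow> real ^ 'd::finite"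
  assumes brownian: "standard_brownian_motion M F W"

sublocale brownian \<subseteq> prob_space M
  using brownian by (simp add: standard_brownian_motion_def)

context brownian
begin

definition dW :: "real \<Rightarrow> real \<Rightarrow> 'w \<Rightarrow> real ^ 'd" where
  "dW s t = (\<lambda>w. W t w - W s w)"

lemma space_F: "space (F t) = space M" and sets_F: "sets (F t) \<subseteq> sets M"
  using brownian by (auto simp: standard_brownian_motion_def subalgebra_def)

lemma measurable_F_M: "Z \<in> borel_measurable (F t) \<Longrightarrow> Z \<in> borel_measurable M"
  using sets_F[of t] space_F[of t] unfolding measurable_def by auto

lemma measurable_F_mono:
  assumes "Z \<in> borel_measurable (F s)" "s \<le> t"
  shows "Z \<in> borel_measurable (F t)"
proof -
  have "sets (F s) \<subseteq> sets (F t)"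
    using brownian assms(2) by (auto simp: standard_brownian_motion_def filtration_def)
  then show ?thesis using assms(1) space_F unfolding measurable_def by auto
qed

lemma measurable_W: "0 \<le> s \<Longrightarrow> s \<le> t \<Longrightarrow> W s \<in> borel_measurable (F t)"
  using brownian measurable_F_mono[of "W s" s t] by (auto simp: standard_brownian_motion_def)

lemma measurable_dW: "0 \<le> s \<Longrightarrow> s \<le> t \<Longrightarrow> t \<le> u \<Longrightarrow> dW s t \<in> borel_measurable (F u)"
  unfolding dW_def using measurable_W[of s u] measurable_W[of t u] by (intro borel_measurable_diff) auto

lemma dW_same [simp]: "dW s s w = 0"
  by (simp add: dW_def)

text \<open>Independence is given for families of events. Those generated by \<open>Z\<close> and by
  \<open>g (dW s t)\<close> lie inside them, so these two variables are independent and the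
  expectation of their product factorises.\<close>

lemma increment_indep:
  fixes Z :: "'w \<Rightarrow> real"
  assumes st: "0 \<le> s" "s \<le> t" and Z: "Z \<in> borel_measurable (F s)" "integrable M Z"
    and g: "g \<in> borel_measurable borel" "integrable M (\<lambda>w. g (dW s t w))"
  shows "integrable M (\<lambda>w. Z w * g (dW s t w))" (is ?A)
    and "(LINT w|M. Z w * g (dW s t w)) = (LINT w|M. Z w) * (LINT w|M. g (dW s t w))" (is ?B)
proof -
  have "?A \<and> ?B"
  proof (cases "s = t")
    \<comment> \<open>The defining property of the increments covers \<open>s < t\<close> only; for
      \<open>s = t\<close> the increment is the constant 0.\<close>
    case True
    then show ?thesis using Z by (simp add: prob_space)
  next
    case False
    define \<D> where "\<D> = {dW s t -` A \<inter> space M | A. A \<in> sets borel}"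
    have ind: "indep_set (sets (F s)) \<D>"
      using brownian st False by (simp add: standard_brownian_motion_def \<D>_def dW_def)
    have dWM: "dW s t \<in> borel_measurable M" using st by (intro measurable_F_M[OF measurable_dW]) auto
    have gM: "(\<lambda>w. g (dW s t w)) \<in> borel_measurable M" using g by auto
    have "indep_set (sigma_sets (space M) {Z -` A \<inter> space M | A. A \<in> sets borel})
       (sigma_sets (space M) {(\<lambda>w. g (dW s t w)) -` A \<inter> space M | A. A \<in> sets borel})"
      unfolding indep_set_def
    proof (rule indep_sets_mono_sets[OF ind[unfolded indep_set_def]])
      have 1: "sigma_sets (space M) {Z -` A \<inter> space M | A. A \<in> sets borel} \<subseteq> sets (F s)"
        unfolding space_F[of s, symmetric]
        by (rule sets.sigma_sets_subset) (use Z(1) in \<open>auto intro: measurable_sets\<close>)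
      have "{(\<lambda>w. g (dW s t w)) -` A \<inter> space M | A. A \<in> sets borel} \<subseteq> \<D>"
        unfolding \<D>_def
      proof safe
        fix A :: "real set" assume "A \<in> sets borel"
        then have "g -` A \<in> sets borel" using measurable_sets[OF g(1), of A] by simp
        then show "\<exists>Aa. (\<lambda>w. g (dW s t w)) -` A \<inter> space M = dW s t -` Aa \<inter> space M \<and> Aa \<in> sets borel"
          by (intro exI[of _ "g -` A"]) auto
      qed
      \<comment> \<open>The preimages under a single map already form a sigma-algebra, so
        \<open>sigma_sets\<close> adds nothing to them.\<close>
      moreover have "\<D> = sigma_sets (space M) \<D>"
      proof -
        have "\<D> = sets (vimage_algebra (space M) (dW s t) borel)"
          unfolding \<D>_def by (subst sets_vimage_algebra2) (auto)
        then show ?thesis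
          using sets.sigma_sets_eq[of "vimage_algebra (space M) (dW s t) borel"] by simp
      qed
      ultimately have 2: "sigma_sets (space M) {(\<lambda>w. g (dW s t w)) -` A \<inter> space M | A. A \<in> sets borel} \<subseteq> \<D>"
        using sigma_sets_mono'[of "{(\<lambda>w. g (dW s t w)) -` A \<inter> space M | A. A \<in> sets borel}" \<D> "space M"]
        by simp
      show "(case i of True \<Rightarrow> sigma_sets (space M) {Z -` A \<inter> space M |A. A \<in> sets borel}
           | False \<Rightarrow> sigma_sets (space M) {(\<lambda>w. g (dW s t w)) -` A \<inter> space M |A. A \<in> sets borel})
         \<subseteq> (case i of True \<Rightarrow> sets (F s) | False \<Rightarrow> \<D>)" if "i \<in> UNIV" for i :: bool
        using 1 2 by (cases i) auto
    qed
    then have "indep_var borel Z borel (\<lambda>w. g (dW s t w))"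
      unfolding indep_var_eq using measurable_F_M[OF Z(1)] gM by simp
    from indep_var_integrable[OF this Z(2) g(2)] indep_var_lebesgue_integral[OF this Z(2) g(2)]
    show ?thesis by simp
  qed
  then show ?A ?B by auto
qed

text \<open>Common source of all isometries and orthogonality relations: the square factorises as
  |\<xi>|^2 times g^2 and the inner product as (Z . \<xi>) times g, each with one factor known at
  time s and one independent of it. It is applied with \<open>g\<close> a coordinate for the noise,
  and with \<open>g\<close> a compensated product of coordinates for the quadratic Taylor
  term.\<close>

lemma increment_scaleR:
  fixes \<xi> :: "'w \<Rightarrow> 'b::euclidean_space"
  assumes st: "0 \<le> s" "s \<le> t" and \<xi>: "\<xi> \<in> borel_measurable (F s)" "sq_integrable M \<xi>"
    and g: "g \<in> borel_measurable borel" "sq_integrable M (\<lambda>w. g (dW s t w) :: real)"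
  shows "sq_integrable M (\<lambda>w. g (dW s t w) *\<^sub>R \<xi> w)"
    and "msq M (\<lambda>w. g (dW s t w) *\<^sub>R \<xi> w) = msq M (\<lambda>w. g (dW s t w)) * msq M \<xi>"
    and "\<lbrakk>Z \<in> borel_measurable (F s); sq_integrable M Z; (LINT w|M. g (dW s t w)) = 0\<rbrakk>
         \<Longrightarrow> (LINT w|M. Z w \<bullet> (g (dW s t w) *\<^sub>R \<xi> w)) = 0"
proof -
  have eq: "(norm (g (dW s t w) *\<^sub>R \<xi> w))\<^sup>2 = (norm (\<xi> w))\<^sup>2 * (g (dW s t w))\<^sup>2" for w
    by (simp add: power_mult_distrib)
  have \<xi>2: "(\<lambda>w. (norm (\<xi> w))\<^sup>2) \<in> borel_measurable (F s)" "integrable M (\<lambda>w. (norm (\<xi> w))\<^sup>2)"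
    using \<xi> by (auto simp: sq_integrable_def)
  have g2: "(\<lambda>x. (g x)\<^sup>2) \<in> borel_measurable borel" "integrable M (\<lambda>w. (g (dW s t w))\<^sup>2)"
    using g by (auto simp: sq_integrable_def)
  note * = increment_indep[OF st \<xi>2 g2]
  have gM: "(\<lambda>w. g (dW s t w)) \<in> borel_measurable M" using g by (simp add: sq_integrable_def)
  show "sq_integrable M (\<lambda>w. g (dW s t w) *\<^sub>R \<xi> w)"
    unfolding sq_integrable_def eq using *(1) gM \<xi> by (auto simp: sq_integrable_def)
  show "msq M (\<lambda>w. g (dW s t w) *\<^sub>R \<xi> w) = msq M (\<lambda>w. g (dW s t w)) * msq M \<xi>"
    unfolding msq_def eq using *(2) by simp
  assume Z: "Z \<in> borel_measurable (F s)" "sq_integrable M Z" and 0: "(LINT w|M. g (dW s t w)) = 0"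
  have Z\<xi>: "(\<lambda>w. Z w \<bullet> \<xi> w) \<in> borel_measurable (F s)" "integrable M (\<lambda>w. Z w \<bullet> \<xi> w)"
    using Z \<xi> by (auto intro: sq_integrable_inner borel_measurable_inner)
  have gi: "integrable M (\<lambda>w. g (dW s t w))"
    using gM g2(2) by (rule square_integrable_imp_integrable)
  have "(LINT w|M. Z w \<bullet> (g (dW s t w) *\<^sub>R \<xi> w)) = (LINT w|M. (Z w \<bullet> \<xi> w) * g (dW s t w))"
    by (simp add: mult.commute)
  also have "\<dots> = 0" using increment_indep(2)[OF st Z\<xi> g(1) gi] 0 by simp
  finally show "(LINT w|M. Z w \<bullet> (g (dW s t w) *\<^sub>R \<xi> w)) = 0" .
qed

lemma increment_monomial:
  fixes p :: "'d \<Rightarrow> nat"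
  assumes st: "0 \<le> s" "s < t"
  shows "integrable M (\<lambda>w. \<Prod>\<alpha>\<in>UNIV. (dW s t w $ \<alpha>) ^ p \<alpha>)"
    and "(LINT w|M. (\<Prod>\<alpha>\<in>UNIV. (dW s t w $ \<alpha>) ^ p \<alpha>))
         = (\<Prod>\<alpha>\<in>UNIV. LINT x|lborel. normal_density 0 (sqrt (t - s)) x * x ^ p \<alpha>)"
proof -
  let ?f = "\<lambda>x::real^'d. \<Prod>\<alpha>\<in>UNIV. normal_density 0 (sqrt (t - s)) (x $ \<alpha>)"
  have D: "distributed M lborel (dW s t) (\<lambda>x. ennreal (?f x))"
    using brownian st by (simp add: standard_brownian_motion_def dW_def)
  have nn: "0 \<le> ?f x" for x by (intro prod_nonneg) auto
  have \<sigma>: "0 < sqrt (t - s)" using st by simp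
  have i: "integrable lborel (\<lambda>x. normal_density 0 (sqrt (t - s)) x * x ^ k)" for k
    using integrable_normal_moment[OF \<sigma>, of 0 k] by simp
  have m: "(\<lambda>x::real^'d. \<Prod>\<alpha>\<in>UNIV. (x $ \<alpha>) ^ p \<alpha>) \<in> borel_measurable lborel"
    by measurable
  have eq: "?f x * (\<Prod>\<alpha>\<in>UNIV. (x $ \<alpha>) ^ p \<alpha>) =
      (\<Prod>\<alpha>\<in>UNIV. normal_density 0 (sqrt (t - s)) (x $ \<alpha>) * (x $ \<alpha>) ^ p \<alpha>)" for x
    by (simp add: prod.distrib)
  show "integrable M (\<lambda>w. \<Prod>\<alpha>\<in>UNIV. (dW s t w $ \<alpha>) ^ p \<alpha>)"
    using distributed_integrable[OF D m nn] integral_lborel_prod_vec(1)[OF i, of p]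
    unfolding eq by simp
  show "(LINT w|M. (\<Prod>\<alpha>\<in>UNIV. (dW s t w $ \<alpha>) ^ p \<alpha>))
         = (\<Prod>\<alpha>\<in>UNIV. LINT x|lborel. normal_density 0 (sqrt (t - s)) x * x ^ p \<alpha>)"
    using distributed_integral[OF D m nn] integral_lborel_prod_vec(2)[OF i, of p]
    unfolding eq by simp
qed

lemma prod_power_if_eq:
  "(\<Prod>\<beta>\<in>UNIV. (f \<beta> :: real) ^ (if \<beta> = (\<alpha>::'d) then k else 0)) = f \<alpha> ^ k"
proof -
  have "(\<Prod>\<beta>\<in>UNIV. f \<beta> ^ (if \<beta> = \<alpha> then k else 0)) = (\<Prod>\<beta>\<in>UNIV. if \<beta> = \<alpha> then f \<beta> ^ k else 1)"
    by (rule prod.cong) auto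
  then show ?thesis by simp
qed

lemma increment_moment:
  assumes st: "0 \<le> s" "s \<le> t"
  shows "integrable M (\<lambda>w. (dW s t w $ \<alpha>) ^ k)" (is ?A)
    and "(LINT w|M. (dW s t w $ \<alpha>) ^ (2 * k)) = fact (2 * k) / (2 ^ k * fact k) * (t - s) ^ k" (is ?B)
    and "(LINT w|M. dW s t w $ \<alpha>) = 0" (is ?C)
proof -
  have "?A \<and> ?B \<and> ?C"
  proof (cases "s = t")
    case True
    then show ?thesis by (cases k) (auto simp: prob_space)
  next
    case False
    then have lt: "s < t" and \<sigma>: "0 < sqrt (t - s)" using st by auto
    have pr: "(\<Prod>\<beta>\<in>UNIV. LINT x|lborel. normal_density 0 (sqrt (t - s)) x * x ^ (if \<beta> = \<alpha> then k else 0))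
       = (LINT x|lborel. normal_density 0 (sqrt (t - s)) x * x ^ k)" for k
    proof -
      have "(\<Prod>\<beta>\<in>UNIV. LINT x|lborel. normal_density 0 (sqrt (t - s)) x * x ^ (if \<beta> = \<alpha> then k else 0))
        = (\<Prod>\<beta>\<in>UNIV. if \<beta> = \<alpha> then LINT x|lborel. normal_density 0 (sqrt (t - s)) x * x ^ k else 1)"
        \<comment> \<open>A coordinate with exponent 0 contributes the total mass of the density,
          its moment of order 0.\<close>
        using integral_normal_moment_even[OF \<sigma>, of 0 0] by (intro prod.cong) auto
      then show ?thesis by simp
    qed
    \<comment> \<open>The hole leaves the exponent schematic; it becomes k, 2 k and 1 in the three
      claims.\<close>
    note mono = increment_monomial[OF st(1) lt, of "\<lambda>\<beta>. if \<beta> = \<alpha> then _ else 0", unfolded prod_power_if_eq pr]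
    have ?A using mono(1) .
    moreover have ?B
      unfolding mono(2) using integral_normal_moment_even[OF \<sigma>, of 0 k] st
      by (simp add: power_divide)
    moreover have ?C
      using mono(2)[of 1] integral_normal_moment_odd[OF \<sigma>, of 0 0] by simp
    ultimately show ?thesis by simp
  qed
  then show ?A ?B ?C by auto
qed

text \<open>Off the diagonal the expectation factorises and one factor is a vanishing first moment.
  This is why only the pure second derivatives of the family survive in the drift.\<close>

lemma increment_cross:
  assumes st: "0 \<le> s" "s \<le> t"
  shows "(LINT w|M. (dW s t w $ \<alpha>) * (dW s t w $ \<beta>)) = (if \<alpha> = \<beta> then t - s else 0)"
proof (cases "\<alpha> = \<beta> \<or> s = t")
  case True
  then show ?thesis
    using increment_moment(2)[OF st, of \<beta> 1] by (auto simp: power2_eq_square)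
next
  case False
  then have lt: "s < t" and \<sigma>: "0 < sqrt (t - s)" using st by auto
  let ?p = "\<lambda>\<kappa>. if \<kappa> = \<alpha> \<or> \<kappa> = \<beta> then 1 else 0 :: nat"
  have "(\<Prod>\<kappa>\<in>UNIV. (x $ \<kappa>) ^ ?p \<kappa>) = x $ \<alpha> * x $ \<beta>" for x :: "real^'d"
  proof -
    have "(\<Prod>\<kappa>\<in>UNIV. (x $ \<kappa>) ^ ?p \<kappa>) = (\<Prod>\<kappa>\<in>{\<alpha>, \<beta>}. x $ \<kappa>)"
      by (rule prod.mono_neutral_cong_right) auto
    then show ?thesis using False by simp
  qed
  moreover have "(\<Prod>\<kappa>\<in>UNIV. LINT x|lborel. normal_density 0 (sqrt (t - s)) x * x ^ ?p \<kappa>) = 0"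
    using integral_normal_moment_odd[OF \<sigma>, of 0 0] by (intro prod_zero) (auto intro!: bexI[of _ \<alpha>])
  ultimately show ?thesis
    using increment_monomial(2)[OF st(1) lt, of ?p] False by simp
qed

lemma sq_integrable_increment:
  assumes st: "0 \<le> s" "s \<le> t"
  shows "sq_integrable M (\<lambda>w. dW s t w $ \<alpha>)" and "msq M (\<lambda>w. dW s t w $ \<alpha>) = t - s"
proof -
  have m: "dW s t \<in> borel_measurable M" using st by (intro measurable_F_M[OF measurable_dW]) auto
  show "sq_integrable M (\<lambda>w. dW s t w $ \<alpha>)"
    using increment_moment(1)[OF st, of \<alpha> 2] borel_measurable_vec_nth[OF m] by (auto simp: sq_integrable_def)
  show "msq M (\<lambda>w. dW s t w $ \<alpha>) = t - s"
    using increment_moment(2)[OF st, of \<alpha> 1] by (simp add: msq_def)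
qed

text \<open>The sixth power of the sum is at most d^6 times that of the largest coordinate, hence
  d^6 times the sum of all sixth powers. Each of the d sixth moments equals 15 (t - s)^3, which
  gives the seventh power of d.\<close>

lemma sq_integrable_increment_sum_cubed:
  assumes st: "0 \<le> s" "s \<le> t"
  shows "sq_integrable M (\<lambda>w. (\<Sum>\<alpha>\<in>UNIV. \<bar>dW s t w $ \<alpha>\<bar>) ^ 3)" (is ?A)
    and "msq M (\<lambda>w. (\<Sum>\<alpha>\<in>UNIV. \<bar>dW s t w $ \<alpha>\<bar>) ^ 3) \<le> 15 * real CARD('d) ^ 7 * (t - s) ^ 3" (is ?B)
proof -
  have m: "dW s t \<in> borel_measurable M" using st by (intro measurable_F_M[OF measurable_dW]) auto
  have le: "(norm ((\<Sum>\<alpha>\<in>UNIV. \<bar>x $ \<alpha>\<bar>) ^ 3))\<^sup>2 \<le> real CARD('d) ^ 6 * (\<Sum>\<alpha>\<in>UNIV. (x $ \<alpha>) ^ 6)" for x :: "real^'d"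
  proof -
    define m where "m = Max (range (\<lambda>\<alpha>. \<bar>x $ \<alpha>\<bar>))"
    have "m \<in> range (\<lambda>\<alpha>. \<bar>x $ \<alpha>\<bar>)" unfolding m_def by (intro Max_in) auto
    then obtain \<alpha> where \<alpha>: "m = \<bar>x $ \<alpha>\<bar>" by auto
    have "\<bar>x $ \<beta>\<bar> \<le> m" for \<beta> unfolding m_def by (intro Max_ge) auto
    then have "(\<Sum>\<alpha>\<in>UNIV. \<bar>x $ \<alpha>\<bar>) \<le> (\<Sum>\<alpha>\<in>(UNIV::'d set). m)" by (intro sum_mono)
    then have "(\<Sum>\<alpha>\<in>UNIV. \<bar>x $ \<alpha>\<bar>) \<le> real CARD('d) * m" by simp
    then have "(\<Sum>\<alpha>\<in>UNIV. \<bar>x $ \<alpha>\<bar>) ^ 6 \<le> (real CARD('d) * m) ^ 6" by (intro power_mono sum_nonneg) auto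
    also have "\<dots> = real CARD('d) ^ 6 * (x $ \<alpha>) ^ 6" by (simp add: power_mult_distrib \<alpha> power_even_abs)
    also have "\<dots> \<le> real CARD('d) ^ 6 * (\<Sum>\<alpha>\<in>UNIV. (x $ \<alpha>) ^ 6)"
      by (intro mult_left_mono member_le_sum) auto
    finally show ?thesis by (simp flip: power_mult)
  qed
  have i: "integrable M (\<lambda>w. real CARD('d) ^ 6 * (\<Sum>\<alpha>\<in>UNIV. (dW s t w $ \<alpha>) ^ 6))"
    using increment_moment(1)[OF st] by simp
  have m3: "(\<lambda>w. (\<Sum>\<alpha>\<in>UNIV. \<bar>dW s t w $ \<alpha>\<bar>) ^ 3) \<in> borel_measurable M" using m by measurable
  show ?A by (rule sq_integrable_dominated(1)[OF m3 i]) (use le in auto)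
  have "msq M (\<lambda>w. (\<Sum>\<alpha>\<in>UNIV. \<bar>dW s t w $ \<alpha>\<bar>) ^ 3) \<le>
      (LINT w|M. real CARD('d) ^ 6 * (\<Sum>\<alpha>\<in>UNIV. (dW s t w $ \<alpha>) ^ 6))"
    by (rule sq_integrable_dominated(2)[OF m3 i]) (use le in auto)
  also have "\<dots> = real CARD('d) ^ 6 * (\<Sum>\<alpha>\<in>(UNIV::'d set). 15 * (t - s) ^ 3)"
    using increment_moment(1)[OF st] increment_moment(2)[OF st, of _ 3]
    by (simp add: fact_numeral)
  also have "\<dots> = 15 * real CARD('d) ^ 7 * (t - s) ^ 3" by (simp add: eval_nat_numeral)
  finally show ?B .
qed

text \<open>The constant 8 is 3 + 3 + 2: two fourth moments 3 (t - s)^2, and 2 (t - s)^2 for the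
  subtracted mean.\<close>

lemma sq_integrable_increment_product:
  fixes \<alpha> \<beta> :: 'd
  assumes st: "0 \<le> s" "s \<le> t"
  defines "g \<equiv> \<lambda>x::real^'d. x $ \<alpha> * x $ \<beta> - (if \<alpha> = \<beta> then t - s else 0)"
  shows "g \<in> borel_measurable borel" and "sq_integrable M (\<lambda>w. g (dW s t w))"
    and "msq M (\<lambda>w. g (dW s t w)) \<le> 8 * (t - s)\<^sup>2"
    and "(LINT w|M. g (dW s t w)) = 0"
proof -
  have m: "dW s t \<in> borel_measurable M" using st by (intro measurable_F_M[OF measurable_dW]) auto
  show gm: "g \<in> borel_measurable borel" unfolding g_def by measurable
  have le: "(norm (g x))\<^sup>2 \<le> (x $ \<alpha>) ^ 4 + (x $ \<beta>) ^ 4 + 2 * (t - s)\<^sup>2" for x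
  proof -
    have "(norm (g x))\<^sup>2 \<le> 2 * (x $ \<alpha> * x $ \<beta>)\<^sup>2 + 2 * (t - s)\<^sup>2"
      using norm_add_sq_le[of "x $ \<alpha> * x $ \<beta>" "- (if \<alpha> = \<beta> then t - s else 0)"]
      by (auto simp: g_def split: if_splits)
    moreover have "2 * (x $ \<alpha> * x $ \<beta>)\<^sup>2 \<le> (x $ \<alpha>) ^ 4 + (x $ \<beta>) ^ 4"
      using sum_squares_bound[of "(x $ \<alpha>)\<^sup>2" "(x $ \<beta>)\<^sup>2"] by (simp add: power_mult_distrib mult.assoc)
    ultimately show ?thesis by simp
  qed
  have i: "integrable M (\<lambda>w. (dW s t w $ \<alpha>) ^ 4 + (dW s t w $ \<beta>) ^ 4 + 2 * (t - s)\<^sup>2)"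
    using increment_moment(1)[OF st] by simp
  have gM: "(\<lambda>w. g (dW s t w)) \<in> borel_measurable M" using gm m by measurable
  note * = sq_integrable_dominated[OF gM i]
  show "sq_integrable M (\<lambda>w. g (dW s t w))" by (rule *) (use le in auto)
  have "msq M (\<lambda>w. g (dW s t w)) \<le> (LINT w|M. (dW s t w $ \<alpha>) ^ 4 + (dW s t w $ \<beta>) ^ 4 + 2 * (t - s)\<^sup>2)"
    by (rule *) (use le in auto)
  also have "\<dots> = 8 * (t - s)\<^sup>2"
    using increment_moment(1)[OF st] increment_moment(2)[OF st, of _ 2]
    by (simp add: fact_numeral prob_space)
  finally show "msq M (\<lambda>w. g (dW s t w)) \<le> 8 * (t - s)\<^sup>2" .
  have "integrable M (\<lambda>w. dW s t w $ \<alpha> * dW s t w $ \<beta>)"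
    using sq_integrable_inner[OF sq_integrable_increment(1)[OF st] sq_integrable_increment(1)[OF st]]
    by simp
  then show "(LINT w|M. g (dW s t w)) = 0"
    using increment_cross[OF st, of \<alpha> \<beta>] by (simp add: g_def prob_space)
qed

section \<open>Ito integrals\<close>

definition L2F :: "real \<Rightarrow> ('w \<Rightarrow> 'b::euclidean_space) set" where
  "L2F s = {\<xi>. \<xi> \<in> borel_measurable (F s) \<and> sq_integrable M \<xi>}"

definition ip :: "('w \<Rightarrow> 'b::euclidean_space) \<Rightarrow> ('w \<Rightarrow> 'b) \<Rightarrow> real" where
  "ip Y Z = (LINT w|M. Y w \<bullet> Z w)"

lemma L2F_sq: "\<xi> \<in> L2F s \<Longrightarrow> sq_integrable M \<xi>"
  by (simp add: L2F_def)

lemma L2F_mono: "\<xi> \<in> L2F s \<Longrightarrow> s \<le> t \<Longrightarrow> \<xi> \<in> L2F t"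
  by (auto simp: L2F_def intro: measurable_F_mono)

lemma L2F_zero: "(\<lambda>w. 0) \<in> L2F s"
  by (simp add: L2F_def sq_integrable_zero)

lemma L2F_const: "(\<lambda>w. c) \<in> L2F s"
  by (simp add: L2F_def sq_integrable_def)

lemma L2F_add: "\<xi> \<in> L2F s \<Longrightarrow> \<eta> \<in> L2F s \<Longrightarrow> (\<lambda>w. \<xi> w + \<eta> w) \<in> L2F s"
  by (auto simp: L2F_def intro: sq_integrable_add)

lemma L2F_diff: "\<xi> \<in> L2F s \<Longrightarrow> \<eta> \<in> L2F s \<Longrightarrow> (\<lambda>w. \<xi> w - \<eta> w) \<in> L2F s"
  by (auto simp: L2F_def intro: sq_integrable_diff)

lemma L2F_minus: "\<xi> \<in> L2F s \<Longrightarrow> (\<lambda>w. - \<xi> w) \<in> L2F s"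
  by (auto simp: L2F_def sq_integrable_minus)

lemma L2F_dW:
  assumes "\<xi> \<in> L2F s" "0 \<le> s" "s \<le> t"
  shows "(\<lambda>w. (dW s t w $ \<alpha>) *\<^sub>R \<xi> w) \<in> L2F t"
  unfolding L2F_def
proof (intro CollectI conjI)
  show "sq_integrable M (\<lambda>w. (dW s t w $ \<alpha>) *\<^sub>R \<xi> w)"
    using assms sq_integrable_increment(1)[of s t \<alpha>]
    by (intro increment_scaleR(1)[where g="\<lambda>x. x $ \<alpha>"]) (auto simp: L2F_def)
  have "dW s t \<in> borel_measurable (F t)" "\<xi> \<in> borel_measurable (F t)"
    using assms by (auto simp: L2F_def intro: measurable_dW measurable_F_mono)
  then show "(\<lambda>w. (dW s t w $ \<alpha>) *\<^sub>R \<xi> w) \<in> borel_measurable (F t)" by measurable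
qed

lemma msq_dW:
  assumes "\<xi> \<in> L2F s" "0 \<le> s" "s \<le> t"
  shows "msq M (\<lambda>w. (dW s t w $ \<alpha>) *\<^sub>R \<xi> w) = (t - s) * msq M \<xi>"
  using assms sq_integrable_increment[of s t \<alpha>]
  by (subst increment_scaleR(2)[where g="\<lambda>x. x $ \<alpha>"]) (auto simp: L2F_def)

lemma ip_dW:
  assumes "\<xi> \<in> L2F s" "Z \<in> L2F s" "0 \<le> s" "s \<le> t"
  shows "ip Z (\<lambda>w. (dW s t w $ \<alpha>) *\<^sub>R \<xi> w) = 0"
  unfolding ip_def
  using assms sq_integrable_increment(1)[of s t \<alpha>] increment_moment(3)[of s t \<alpha>]
  by (intro increment_scaleR(3)[where g="\<lambda>x. x $ \<alpha>"]) (auto simp: L2F_def)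

lemma ip_commute: "ip Y Z = ip Z Y"
  by (simp add: ip_def inner_commute)

lemma ip_add_left:
  "sq_integrable M Y \<Longrightarrow> sq_integrable M Y' \<Longrightarrow> sq_integrable M Z \<Longrightarrow>
   ip (\<lambda>w. Y w + Y' w) Z = ip Y Z + ip Y' Z"
  by (simp add: ip_def inner_add_left sq_integrable_inner)

lemma ip_add_right:
  "sq_integrable M Y \<Longrightarrow> sq_integrable M Y' \<Longrightarrow> sq_integrable M Z \<Longrightarrow>
   ip Z (\<lambda>w. Y w + Y' w) = ip Z Y + ip Z Y'"
  by (simp add: ip_def inner_add_right sq_integrable_inner)

lemma ip_diff_right:
  "sq_integrable M Y \<Longrightarrow> sq_integrable M Y' \<Longrightarrow> sq_integrable M Z \<Longrightarrow>
   ip Z (\<lambda>w. Y w - Y' w) = ip Z Y - ip Z Y'"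
  by (simp add: ip_def inner_diff_right sq_integrable_inner)

lemma ip_scaleR: "ip (\<lambda>w. c *\<^sub>R Y w) (\<lambda>w. d *\<^sub>R Z w) = c * d * ip Y Z"
  by (simp add: ip_def)

lemma ip_zero [simp]: "ip (\<lambda>w. 0) Z = 0" "ip Z (\<lambda>w. 0) = 0"
  by (simp_all add: ip_def)

lemma ip_self: "ip Y Y = msq M Y"
  by (simp add: ip_def msq_def power2_norm_eq_inner)

lemma ip_sum_right:
  assumes "sq_integrable M Z" "\<And>i. i \<in> A \<Longrightarrow> sq_integrable M (Y i)"
  shows "ip Z (\<lambda>w. \<Sum>i\<in>A. Y i w) = (\<Sum>i\<in>A. ip Z (Y i))"
  using assms
  by (induction A rule: infinite_finite_induct) (auto simp: ip_add_right sq_integrable_sum)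

text \<open>A stochastic integral over [s, t] with coefficients frozen at time s, as in an Euler
  step. Scheme and solution both contain such a term, so their difference is again of this
  form.\<close>

definition noise :: "real \<Rightarrow> real \<Rightarrow> ('d \<Rightarrow> 'w \<Rightarrow> 'b::euclidean_space) \<Rightarrow> 'w \<Rightarrow> 'b" where
  "noise s t \<xi> w = (\<Sum>\<alpha>\<in>UNIV. (dW s t w $ \<alpha>) *\<^sub>R \<xi> \<alpha> w)"

lemma noise:
  assumes \<xi>: "\<And>\<alpha>. \<xi> \<alpha> \<in> L2F s" and st: "0 \<le> s" "s \<le> t"
  shows sq_integrable_noise: "sq_integrable M (noise s t \<xi>)"
    and ip_noise: "Z \<in> L2F s \<Longrightarrow> ip Z (noise s t \<xi>) = 0"
    and msq_noise_le: "(\<And>\<alpha>. msq M (\<xi> \<alpha>) \<le> B) \<Longrightarrow> msq M (noise s t \<xi>) \<le> (real CARD('d))\<^sup>2 * (t - s) * B"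
proof -
  let ?n = "\<lambda>\<alpha> w. (dW s t w $ \<alpha>) *\<^sub>R \<xi> \<alpha> w"
  have n: "noise s t \<xi> = (\<lambda>w. \<Sum>\<alpha>\<in>UNIV. ?n \<alpha> w)" by (simp add: noise_def fun_eq_iff)
  have sq: "sq_integrable M (?n \<alpha>)" for \<alpha> by (rule L2F_sq[OF L2F_dW[OF \<xi> st]])
  show "sq_integrable M (noise s t \<xi>)" unfolding n by (intro sq_integrable_sum sq)
  show "ip Z (noise s t \<xi>) = 0" if "Z \<in> L2F s"
    unfolding n using ip_sum_right[OF L2F_sq[OF that] sq] ip_dW[OF \<xi> that st] by simp
  assume B: "\<And>\<alpha>. msq M (\<xi> \<alpha>) \<le> B"
  have "msq M (noise s t \<xi>) \<le> real CARD('d) * (\<Sum>\<alpha>\<in>UNIV. msq M (?n \<alpha>))"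
    unfolding n by (rule msq_sum_le[OF sq])
  also have "\<dots> = real CARD('d) * (\<Sum>\<alpha>\<in>UNIV. (t - s) * msq M (\<xi> \<alpha>))"
    using msq_dW[OF \<xi> st] by simp
  also have "\<dots> \<le> real CARD('d) * (\<Sum>\<alpha>\<in>(UNIV::'d set). (t - s) * B)"
    using st by (intro mult_left_mono sum_mono B) auto
  finally show "msq M (noise s t \<xi>) \<le> (real CARD('d))\<^sup>2 * (t - s) * B"
    by (simp add: power2_eq_square)
qed

section \<open>Covariance of two increments with random coefficients\<close>

lemma dW_split: "dW a c w = dW a b w + dW b c w"
  by (simp add: dW_def)

text \<open>Polarisation: \<open>msq_dW\<close> is applied to \<xi> + \<eta> and both squares are
  expanded.\<close>

lemma increment_isometry_same:
  assumes "\<xi> \<in> L2F a" "\<eta> \<in> L2F a" "0 \<le> a" "a \<le> b"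
  shows "ip (\<lambda>w. (dW a b w $ \<alpha>) *\<^sub>R \<xi> w) (\<lambda>w. (dW a b w $ \<alpha>) *\<^sub>R \<eta> w) = (b - a) * ip \<xi> \<eta>"
proof -
  let ?D = "\<lambda>\<xi> w. (dW a b w $ \<alpha>) *\<^sub>R \<xi> w"
  have sq: "sq_integrable M (?D \<xi>)" "sq_integrable M (?D \<eta>)" "sq_integrable M \<xi>" "sq_integrable M \<eta>"
    using assms by (auto intro: L2F_sq L2F_dW)
  have "msq M (\<lambda>w. ?D \<xi> w + ?D \<eta> w) = (b - a) * msq M (\<lambda>w. \<xi> w + \<eta> w)"
    using msq_dW[OF L2F_add[OF assms(1,2)] assms(3,4), of \<alpha>] by (simp add: scaleR_add_right)
  then show ?thesis
    unfolding msq_add[OF sq(1,2)] msq_add[OF sq(3,4)] ip_def[symmetric]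
    using assms by (simp add: msq_dW algebra_simps)
qed

text \<open>Both intervals are cut at \<open>c\<close> and at \<open>m = min b d\<close>. Only the
  common piece [c, m] pairs with itself; in every other pair of nondegenerate pieces one increment
  starts when the other factor is already measurable, so the pair is orthogonal.\<close>

lemma increment_isometry_ordered:
  assumes \<xi>: "\<xi> \<in> L2F a" and \<eta>: "\<eta> \<in> L2F c" and le: "0 \<le> a" "a \<le> b" "c \<le> d" "a \<le> c"
  shows "ip (\<lambda>w. (dW a b w $ \<alpha>) *\<^sub>R \<xi> w) (\<lambda>w. (dW c d w $ \<alpha>) *\<^sub>R \<eta> w)
         = max 0 (min b d - max a c) * ip \<xi> \<eta>"
proof (cases "b \<le> c")
  case True
  have "(\<lambda>w. (dW a b w $ \<alpha>) *\<^sub>R \<xi> w) \<in> L2F c"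
    using L2F_mono[OF L2F_dW[OF \<xi>] True] le by simp
  from ip_dW[OF \<eta> this, of d \<alpha>] show ?thesis using le True by simp
next
  case False
  define m where "m = min b d"
  let ?D = "\<lambda>s t \<xi> w. (dW s t w $ \<alpha>) *\<^sub>R \<xi> w"
  have m: "c \<le> m" "m \<le> b" "m \<le> d" using False le by (auto simp: m_def)
  have c0: "0 \<le> c" using le by simp
  have \<xi>c: "\<xi> \<in> L2F c" using L2F_mono[OF \<xi>] le by simp
  have m0: "0 \<le> m" using m c0 by simp
  have \<xi>m: "\<xi> \<in> L2F m" "\<eta> \<in> L2F m" using L2F_mono[OF \<xi>c] L2F_mono[OF \<eta>] m by auto
  have L: "?D a c \<xi> \<in> L2F c" "?D c m \<xi> \<in> L2F m" "?D c m \<eta> \<in> L2F m" "?D m b \<xi> \<in> L2F b"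
    "?D m d \<eta> \<in> L2F d" "?D c b \<xi> \<in> L2F b" "?D c d \<eta> \<in> L2F d"
    using L2F_dW[OF \<xi>c, of m \<alpha>] L2F_dW[OF \<xi>c, of b \<alpha>] L2F_dW[OF \<xi>, of c \<alpha>] L2F_dW[OF \<eta>, of m \<alpha>] L2F_dW[OF \<eta>, of d \<alpha>]
      L2F_dW[OF \<xi>m(1), of b \<alpha>] L2F_dW[OF \<xi>m(2), of d \<alpha>] le m c0 m0 False by auto
  note sq = L[THEN L2F_sq]
  have "?D a b \<xi> = (\<lambda>w. ?D a c \<xi> w + ?D c b \<xi> w)"
    using dW_split[of a b _ c] by (auto simp: scaleR_add_left)
  then have "ip (?D a b \<xi>) (?D c d \<eta>) = ip (?D a c \<xi>) (?D c d \<eta>) + ip (?D c b \<xi>) (?D c d \<eta>)"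
    using sq by (simp add: ip_add_left)
  also have "ip (?D a c \<xi>) (?D c d \<eta>) = 0" using ip_dW[OF \<eta> L(1)] le by simp
  also have "ip (?D c b \<xi>) (?D c d \<eta>) = ip (?D c m \<xi>) (?D c d \<eta>) + ip (?D m b \<xi>) (?D c d \<eta>)"
  proof -
    have "?D c b \<xi> = (\<lambda>w. ?D c m \<xi> w + ?D m b \<xi> w)"
      using dW_split[of c b _ m] by (auto simp: scaleR_add_left)
    then show ?thesis using sq by (simp add: ip_add_left)
  qed
  also have split: "ip Z (?D c d \<eta>) = ip Z (?D c m \<eta>) + ip Z (?D m d \<eta>)" if "sq_integrable M Z" for Z
  proof -
    have "?D c d \<eta> = (\<lambda>w. ?D c m \<eta> w + ?D m d \<eta> w)"
      using dW_split[of c d _ m] by (auto simp: scaleR_add_left)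
    then show ?thesis using sq that by (simp add: ip_add_right)
  qed
  note split[OF sq(2)]
  also have "ip (?D c m \<xi>) (?D m d \<eta>) = 0" using ip_dW[OF \<xi>m(2) L(2) m0] m by simp
  also have "ip (?D c m \<xi>) (?D c m \<eta>) = (m - c) * ip \<xi> \<eta>"
    using increment_isometry_same[OF \<xi>c \<eta> c0] m by simp
  also note split[OF sq(4)]
  also have "ip (?D m b \<xi>) (?D c m \<eta>) = 0"
    using ip_dW[OF \<xi>m(1) L(3) m0] m by (subst ip_commute) simp
  \<comment> \<open>One of the two intervals is degenerate, since \<open>m\<close> is either
    \<open>b\<close> or \<open>d\<close>.\<close>
  also have "ip (?D m b \<xi>) (?D m d \<eta>) = 0"
    by (cases "b \<le> d") (auto simp: m_def)
  finally show ?thesis using False le m by (simp add: m_def)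
qed

lemma increment_isometry:
  assumes "\<xi> \<in> L2F a" "\<eta> \<in> L2F c" "0 \<le> a" "a \<le> b" "0 \<le> c" "c \<le> d"
  shows "ip (\<lambda>w. (dW a b w $ \<alpha>) *\<^sub>R \<xi> w) (\<lambda>w. (dW c d w $ \<alpha>) *\<^sub>R \<eta> w)
         = max 0 (min b d - max a c) * ip \<xi> \<eta>"
proof (cases "a \<le> c")
  case True
  then show ?thesis using increment_isometry_ordered[of \<xi> a \<eta> c b d \<alpha>] assms by simp
next
  case False
  then have "ip (\<lambda>w. (dW c d w $ \<alpha>) *\<^sub>R \<eta> w) (\<lambda>w. (dW a b w $ \<alpha>) *\<^sub>R \<xi> w)
         = max 0 (min d b - max c a) * ip \<eta> \<xi>"
    using increment_isometry_ordered[of \<eta> c \<xi> a d b \<alpha>] assms by simp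
  then show ?thesis by (simp add: ip_commute min.commute max.commute)
qed

section \<open>Elementary integrals: splitting, orthogonality and isometry\<close>

text \<open>
  \<open>I\<close> is the integral of the elementary process \<open>H\<close>, which vanishes outside \<open>[lo, hi)\<close>.  The
  intervals of the summands may overlap, so sums of two such processes need no common partition.
\<close>

inductive simple_integral ::
    "'d \<Rightarrow> real \<Rightarrow> real \<Rightarrow> (real \<Rightarrow> 'w \<Rightarrow> 'b::euclidean_space) \<Rightarrow> ('w \<Rightarrow> 'b) \<Rightarrow> bool"
  for \<alpha> lo hi where
  zero: "simple_integral \<alpha> lo hi (\<lambda>s w. 0) (\<lambda>w. 0)"
| step: "simple_integral \<alpha> lo hi H I \<Longrightarrow> lo \<le> a \<Longrightarrow> a \<le> b \<Longrightarrow> b \<le> hi \<Longrightarrow> \<xi> \<in> L2F a \<Longrightarrow>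
    simple_integral \<alpha> lo hi (\<lambda>s w. indicator {a..<b} s *\<^sub>R \<xi> w + H s w)
      (\<lambda>w. (dW a b w $ \<alpha>) *\<^sub>R \<xi> w + I w)"

lemma simple_integral_props:
  assumes "simple_integral \<alpha> lo hi H I" "0 \<le> lo"
  shows "sq_integrable M (H s)" and "sq_integrable M I"
    and "s \<notin> {lo..<hi} \<Longrightarrow> H s = (\<lambda>w. 0)"
    and "(\<lambda>(s, w). H s w) \<in> borel_measurable (borel \<Otimes>\<^sub>M M)"
proof -
  have "(\<forall>s. sq_integrable M (H s)) \<and> sq_integrable M I \<and> (\<forall>s. s \<notin> {lo..<hi} \<longrightarrow> H s = (\<lambda>w. 0)) \<and>
      (\<lambda>(s, w). H s w) \<in> borel_measurable (borel \<Otimes>\<^sub>M M)"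
    using assms
  proof induction
    case zero
    then show ?case by (simp add: sq_integrable_zero)
  next
    case (step H I a b \<xi>)
    have \<xi>: "sq_integrable M \<xi>" using step by (simp add: L2F_def)
    have [measurable]: "\<xi> \<in> borel_measurable M" using \<xi> by (rule sq_integrable_measurable)
    have [measurable]: "(\<lambda>(s, w). H s w) \<in> borel_measurable (borel \<Otimes>\<^sub>M M)" using step by simp
    have "sq_integrable M (\<lambda>w. indicator {a..<b} s *\<^sub>R \<xi> w + H s w)" for s :: real
      using step by (intro sq_integrable_add sq_integrable_scaleR \<xi>) auto
    moreover have "sq_integrable M (\<lambda>w. (dW a b w $ \<alpha>) *\<^sub>R \<xi> w + I w)"
      using step L2F_sq[OF L2F_dW[OF step(5), of b \<alpha>]] by (intro sq_integrable_add) auto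
    moreover have "(\<lambda>(s, w). indicator {a..<b} s *\<^sub>R \<xi> w + H s w) \<in> borel_measurable (borel \<Otimes>\<^sub>M M)"
      by measurable
    moreover have "(\<lambda>w. indicator {a..<b} s *\<^sub>R \<xi> w + H s w) = (\<lambda>w. 0)" if "s \<notin> {lo..<hi}" for s :: real
      using step that by (auto simp: indicator_def)
    ultimately show ?case by blast
  qed
  then show "sq_integrable M (H s)" "sq_integrable M I" "s \<notin> {lo..<hi} \<Longrightarrow> H s = (\<lambda>w. 0)"
    "(\<lambda>(s, w). H s w) \<in> borel_measurable (borel \<Otimes>\<^sub>M M)" by auto
qed

lemma simple_integral_single:
  assumes "lo \<le> a" "a \<le> b" "b \<le> hi" "\<xi> \<in> L2F a"
  shows "simple_integral \<alpha> lo hi (\<lambda>s w. indicator {a..<b} s *\<^sub>R \<xi> w) (\<lambda>w. (dW a b w $ \<alpha>) *\<^sub>R \<xi> w)"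
  using simple_integral.step[OF simple_integral.zero assms] by simp

lemma simple_integral_add:
  assumes "simple_integral \<alpha> lo hi H I" "simple_integral \<alpha> lo hi G L"
  shows "simple_integral \<alpha> lo hi (\<lambda>s w. H s w + G s w) (\<lambda>w. I w + L w)"
  using assms
proof induction
  case zero
  then show ?case by simp
next
  case (step H I a b \<xi>)
  from simple_integral.step[OF step.IH[OF step.prems] step(2-5)]
  show ?case by (simp add: add.assoc)
qed

lemma simple_integral_minus:
  assumes "simple_integral \<alpha> lo hi H I"
  shows "simple_integral \<alpha> lo hi (\<lambda>s w. - H s w) (\<lambda>w. - I w)"
  using assms
proof induction
  case zero
  then show ?case using simple_integral.zero by simp
next
  case (step H I a b \<xi>)
  from simple_integral.step[OF step.IH step(2-4) L2F_minus[OF step(5)]]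
  show ?case by (simp add: add.commute)
qed

lemma simple_integral_diff:
  assumes "simple_integral \<alpha> lo hi H I" "simple_integral \<alpha> lo hi G L"
  shows "simple_integral \<alpha> lo hi (\<lambda>s w. H s w - G s w) (\<lambda>w. I w - L w)"
  using simple_integral_add[OF assms(1) simple_integral_minus[OF assms(2)]] by simp

lemma simple_integral_mono:
  assumes "simple_integral \<alpha> lo hi H I" "lo' \<le> lo" "hi \<le> hi'"
  shows "simple_integral \<alpha> lo' hi' H I"
  using assms
proof induction
  case zero
  show ?case by (rule simple_integral.zero)
next
  case (step H I a b \<xi>)
  then show ?case by (intro simple_integral.step) auto
qed

text \<open>A summand whose interval straddles \<open>t\<close> is cut there; its coefficient, known
  at \<open>a\<close>, is known at \<open>t\<close> as well. The second part is then orthogonal to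
  everything measurable at \<open>t\<close>, while the first is a competitor for the Ito integral up
  to \<open>t\<close>, for which the values of the process before \<open>t\<close> suffice.\<close>

lemma simple_integral_split:
  assumes "simple_integral \<alpha> lo hi H I" "lo \<le> t" "t \<le> hi" "0 \<le> lo"
  shows "\<exists>H1 I1 H2 I2. simple_integral \<alpha> lo t H1 I1 \<and> simple_integral \<alpha> t hi H2 I2 \<and>
    I = (\<lambda>w. I1 w + I2 w) \<and> (\<forall>r<t. H1 r = H r)"
  using assms
proof induction
  case zero
  show ?case using simple_integral.zero[of \<alpha> lo t] simple_integral.zero[of \<alpha> t hi] by fastforce
next
  case (step H I a b \<xi>)
  then obtain H1 I1 H2 I2 where IH: "simple_integral \<alpha> lo t H1 I1" "simple_integral \<alpha> t hi H2 I2"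
    "I = (\<lambda>w. I1 w + I2 w)" "\<And>r. r < t \<Longrightarrow> H1 r = H r" by blast
  show ?case
  proof (cases "t \<le> a")
    case True
    have "simple_integral \<alpha> t hi (\<lambda>s w. indicator {a..<b} s *\<^sub>R \<xi> w + H2 s w) (\<lambda>w. (dW a b w $ \<alpha>) *\<^sub>R \<xi> w + I2 w)"
      using True step IH(2) by (intro simple_integral.step) auto
    moreover have "H1 r = (\<lambda>w. indicator {a..<b} r *\<^sub>R \<xi> w + H r w)" if "r < t" for r
      using that True IH(4) by simp
    moreover have "(\<lambda>w. (dW a b w $ \<alpha>) *\<^sub>R \<xi> w + I w) = (\<lambda>w. I1 w + ((dW a b w $ \<alpha>) *\<^sub>R \<xi> w + I2 w))"
      by (simp add: IH(3) algebra_simps)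
    ultimately show ?thesis using IH(1) by blast
  next
    case False
    \<comment> \<open>These also cover \<open>b \<le> t\<close>, where the second interval is empty
      and its increment 0.\<close>
    let ?c = "min b t" and ?e = "max b t"
    have "simple_integral \<alpha> lo t (\<lambda>s w. indicator {a..<?c} s *\<^sub>R \<xi> w + H1 s w) (\<lambda>w. (dW a ?c w $ \<alpha>) *\<^sub>R \<xi> w + I1 w)"
      using False step IH(1) by (intro simple_integral.step) auto
    moreover have "simple_integral \<alpha> t hi (\<lambda>s w. indicator {t..<?e} s *\<^sub>R \<xi> w + H2 s w) (\<lambda>w. (dW t ?e w $ \<alpha>) *\<^sub>R \<xi> w + I2 w)"
      using False step IH(2) by (intro simple_integral.step) (auto intro: L2F_mono)
    moreover have "(\<lambda>w. indicator {a..<?c} r *\<^sub>R \<xi> w + H1 r w) = (\<lambda>w. indicator {a..<b} r *\<^sub>R \<xi> w + H r w)" if "r < t" for r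
      using that False IH(4) by (auto simp: indicator_def)
    moreover have "(\<lambda>w. (dW a b w $ \<alpha>) *\<^sub>R \<xi> w + I w)
        = (\<lambda>w. ((dW a ?c w $ \<alpha>) *\<^sub>R \<xi> w + I1 w) + ((dW t ?e w $ \<alpha>) *\<^sub>R \<xi> w + I2 w))"
      using dW_split[of a b _ t] by (auto simp: IH(3) min_def max_def algebra_simps)
    ultimately show ?thesis by (intro exI conjI) (assumption | blast)+
  qed
qed

lemma simple_integral_orthogonal:
  assumes "simple_integral \<alpha> lo hi H I" "0 \<le> lo" "Z \<in> L2F lo"
  shows "ip Z I = 0"
  using assms
proof induction
  case zero
  then show ?case by simp
next
  case (step H I a b \<xi>)
  have Z: "Z \<in> L2F a" using step by (auto intro: L2F_mono)
  have "ip Z (\<lambda>w. (dW a b w $ \<alpha>) *\<^sub>R \<xi> w) = 0" using ip_dW[OF step(5) Z] step by simp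
  moreover have "sq_integrable M (\<lambda>w. (dW a b w $ \<alpha>) *\<^sub>R \<xi> w)"
    using L2F_sq[OF L2F_dW[OF step(5), of b \<alpha>]] step by auto
  ultimately show ?case
    using step Z simple_integral_props(2)[OF step(1)] by (simp add: ip_add_right L2F_sq)
qed

text \<open>The bilinear Ito isometry is proved by induction on one argument at a time, here against
  a single summand and in \<open>simple_integral_inner\<close> against a general integral.
  Integrability in time is carried along because the Bochner integral is additive only for
  integrable functions.\<close>

lemma simple_integral_inner_single:
  assumes "simple_integral \<alpha> lo hi H I" "0 \<le> lo" "0 \<le> c" "c \<le> d" "\<eta> \<in> L2F c"
  shows "integrable lborel (\<lambda>s. ip (H s) (\<lambda>w. indicator {c..<d} s *\<^sub>R \<eta> w)) \<and>
    ip I (\<lambda>w. (dW c d w $ \<alpha>) *\<^sub>R \<eta> w) = (LINT s|lborel. ip (H s) (\<lambda>w. indicator {c..<d} s *\<^sub>R \<eta> w))"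
  using assms
proof induction
  case zero
  then show ?case by simp
next
  case (step H I a b \<xi>)
  have \<xi>: "sq_integrable M \<xi>" "sq_integrable M (\<lambda>w. (dW a b w $ \<alpha>) *\<^sub>R \<xi> w)"
    and \<eta>: "sq_integrable M \<eta>" "sq_integrable M (\<lambda>w. (dW c d w $ \<alpha>) *\<^sub>R \<eta> w)"
    using step L2F_sq[OF L2F_dW[OF step(5), of b \<alpha>]]
      L2F_sq[OF L2F_dW[OF step(10), of d \<alpha>]] by (auto simp: L2F_sq)
  have "indicator {a..<b} s * indicator {c..<d} s = (indicator {max a c..<min b d} s :: real)" for s
    by (auto simp: indicator_def)
  then have eq: "ip (\<lambda>w. indicator {a..<b} s *\<^sub>R \<xi> w + H s w) (\<lambda>w. indicator {c..<d} s *\<^sub>R \<eta> w) =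
      indicator {max a c..<min b d} s * ip \<xi> \<eta> + ip (H s) (\<lambda>w. indicator {c..<d} s *\<^sub>R \<eta> w)" for s
    using simple_integral_props(1)[OF step(1), of s] step \<xi>(1) \<eta>(1)
    by (subst ip_add_left) (auto intro: sq_integrable_scaleR simp: ip_scaleR)
  have i: "integrable lborel (\<lambda>s. indicator {max a c..<min b d} s * ip \<xi> \<eta>)"
    using emeasure_bounded_finite[of "{max a c..<min b d}"]
    by (intro integrable_mult_left integrable_real_indicator) auto
  have "(LINT s|lborel. indicator {max a c..<min b d} s * ip \<xi> \<eta>) = max 0 (min b d - max a c) * ip \<xi> \<eta>"
    by (auto simp: measure_lborel_Ico max_def)
  also have "\<dots> = ip (\<lambda>w. (dW a b w $ \<alpha>) *\<^sub>R \<xi> w) (\<lambda>w. (dW c d w $ \<alpha>) *\<^sub>R \<eta> w)"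
    using increment_isometry[of \<xi> a \<eta> c b d \<alpha>] step by simp
  finally have 1: "(LINT s|lborel. indicator {max a c..<min b d} s * ip \<xi> \<eta>) = \<dots>" .
  have IH: "integrable lborel (\<lambda>s. ip (H s) (\<lambda>w. indicator {c..<d} s *\<^sub>R \<eta> w))"
    "ip I (\<lambda>w. (dW c d w $ \<alpha>) *\<^sub>R \<eta> w) = (LINT s|lborel. ip (H s) (\<lambda>w. indicator {c..<d} s *\<^sub>R \<eta> w))"
    using step by auto
  show ?case
    unfolding eq using IH i simple_integral_props(2)[OF step(1)] step \<xi>(2) \<eta>(2)
    by (simp add: ip_add_left 1 del: integral_mult_left_zero integral_mult_right_zero integral_indicator)
qed

lemma simple_integral_inner:
  assumes "simple_integral \<alpha> lo' hi' G L" "0 \<le> lo'" "simple_integral \<alpha> lo hi H I" "0 \<le> lo"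
  shows "integrable lborel (\<lambda>s. ip (H s) (G s)) \<and> ip I L = (LINT s|lborel. ip (H s) (G s))"
  using assms
proof induction
  case zero
  then show ?case by simp
next
  case (step G L a b \<xi>)
  have \<xi>: "sq_integrable M \<xi>" "sq_integrable M (\<lambda>w. (dW a b w $ \<alpha>) *\<^sub>R \<xi> w)"
    using step L2F_sq[OF L2F_dW[OF step(5), of b \<alpha>]] by (auto simp: L2F_sq)
  have eq: "ip (H s) (\<lambda>w. indicator {a..<b} s *\<^sub>R \<xi> w + G s w) =
      ip (H s) (\<lambda>w. indicator {a..<b} s *\<^sub>R \<xi> w) + ip (H s) (G s)" for s
    using simple_integral_props(1)[OF step(1), of s] simple_integral_props(1)[OF step(8,9), of s] step \<xi>(1)
    by (intro ip_add_right sq_integrable_scaleR) auto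
  have eqI: "ip I (\<lambda>w. (dW a b w $ \<alpha>) *\<^sub>R \<xi> w + L w) = ip I (\<lambda>w. (dW a b w $ \<alpha>) *\<^sub>R \<xi> w) + ip I L"
    using simple_integral_props(2)[OF step(1)] simple_integral_props(2)[OF step(8,9)] step \<xi>(2)
    by (intro ip_add_right) auto
  have a: "0 \<le> a" using step by simp
  show ?case
    unfolding eq eqI
    using simple_integral_inner_single[OF step(8,9) a step(3,5)] step.IH[OF step(7-9)] by simp
qed

text \<open>The diagonal case, returned to \<open>ennreal\<close>, where the approximation errors of
  \<open>has_ito_integral\<close> live.\<close>

lemma simple_integral_isometry:
  assumes "simple_integral \<alpha> lo hi H I" "0 \<le> lo"
  shows "(\<integral>\<^sup>+s. mean_sq_dist M (H s) (\<lambda>w. 0) \<partial>lborel) = mean_sq_dist M I (\<lambda>w. 0)"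
proof -
  note * = simple_integral_inner[OF assms assms, unfolded ip_self]
  have 1: "mean_sq_dist M (H s) (\<lambda>w. 0) = ennreal (msq M (H s))" for s
    using mean_sq_dist_eq_msq[of M "H s" "\<lambda>w. 0"] simple_integral_props(1)[OF assms] by simp
  have 2: "mean_sq_dist M I (\<lambda>w. 0) = ennreal (msq M I)"
    using mean_sq_dist_eq_msq[of M I "\<lambda>w. 0"] simple_integral_props(2)[OF assms] by simp
  show ?thesis
    unfolding 1 2 using * by (subst nn_integral_eq_integral) auto
qed

lemma mean_sq_dist_diff_zero: "mean_sq_dist M (\<lambda>w. Y w - Z w) (\<lambda>w. 0) = mean_sq_dist M Y Z"
  by (simp add: mean_sq_dist_def)

lemma simple_integral_elementary:
  assumes "elementary_data M F t n \<tau> \<xi>"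
  shows "simple_integral \<alpha> 0 t (elementary_process n \<tau> \<xi>) (elementary_integral n \<tau> \<xi> (\<lambda>s w. W s w $ \<alpha>))"
proof -
  have step: "\<tau> i \<le> \<tau> (Suc i)" "\<xi> i \<in> L2F (\<tau> i)" if "i < n" for i
  proof -
    show "\<tau> i \<le> \<tau> (Suc i)" using assms that by (simp add: elementary_data_def)
    have "\<xi> i \<in> borel_measurable (F (\<tau> i))" "mean_sq_dist M (\<xi> i) (\<lambda>_. 0) < \<infinity>"
      using assms that by (simp_all add: elementary_data_def)
    then show "\<xi> i \<in> L2F (\<tau> i)"
      using sq_integrable_iff_mean_sq[OF measurable_F_M] by (auto simp: L2F_def)
  qed
  have lo: "0 \<le> \<tau> m" if "m \<le> n" for m
    using that
  proof (induction m)
    case 0 then show ?case using assms by (simp add: elementary_data_def)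
  next
    case (Suc m) then show ?case using step(1)[of m] by simp
  qed
  \<comment> \<open>The induction runs downwards from the last node, the one known to be at most
    \<open>t\<close>.\<close>
  have hi: "\<tau> (n - m) \<le> t" if "m \<le> n" for m
    using that
  proof (induction m)
    case 0 then show ?case using assms by (simp add: elementary_data_def)
  next
    case (Suc m)
    then have "Suc (n - Suc m) = n - m" by simp
    then show ?case using step(1)[of "n - Suc m"] Suc by simp
  qed
  have "simple_integral \<alpha> 0 t (elementary_process m \<tau> \<xi>) (elementary_integral m \<tau> \<xi> (\<lambda>s w. W s w $ \<alpha>))"
    if "m \<le> n" for m
    using that
  proof (induction m)
    case 0
    have "elementary_process 0 \<tau> \<xi> = (\<lambda>s w. 0)" "elementary_integral 0 \<tau> \<xi> (\<lambda>s w. W s w $ \<alpha>) = (\<lambda>w. 0)"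
      by (auto simp: elementary_process_def elementary_integral_def fun_eq_iff)
    then show ?case by (simp add: simple_integral.zero)
  next
    case (Suc m)
    have "elementary_process (Suc m) \<tau> \<xi> =
        (\<lambda>s w. indicator {\<tau> m..<\<tau> (Suc m)} s *\<^sub>R \<xi> m w + elementary_process m \<tau> \<xi> s w)"
      and "elementary_integral (Suc m) \<tau> \<xi> (\<lambda>s w. W s w $ \<alpha>) =
        (\<lambda>w. (dW (\<tau> m) (\<tau> (Suc m)) w $ \<alpha>) *\<^sub>R \<xi> m w + elementary_integral m \<tau> \<xi> (\<lambda>s w. W s w $ \<alpha>) w)"
      by (auto simp: elementary_process_def elementary_integral_def dW_def fun_eq_iff)
    moreover have "\<tau> (Suc m) \<le> t" using hi[of "n - Suc m"] Suc by simp
    ultimately show ?case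
      using Suc step[of m] lo[of m] by (auto intro!: simple_integral.step)
  qed
  then show ?thesis by simp
qed

section \<open>From elementary to general integrands\<close>

abbreviation dist_int :: "real \<Rightarrow> real \<Rightarrow> (real \<Rightarrow> 'w \<Rightarrow> 'b::euclidean_space) \<Rightarrow> (real \<Rightarrow> 'w \<Rightarrow> 'b) \<Rightarrow> ennreal" where
  "dist_int s t f g \<equiv> \<integral>\<^sup>+r\<in>{s..t}. mean_sq_dist M (f r) (g r) \<partial>lborel"

lemma has_ito_integral_approx:
  assumes "has_ito_integral M F (\<lambda>s w. W s w $ \<alpha>) t f J"
  obtains P I where "\<And>k::nat. simple_integral \<alpha> 0 t (P k) (I k)"
    "(\<lambda>k. dist_int 0 t f (P k)) \<longlonglongrightarrow> 0"
    "(\<lambda>k. mean_sq_dist M J (I k)) \<longlonglongrightarrow> 0"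
proof -
  obtain n \<tau> \<xi> where
    el: "\<And>k. elementary_data M F t (n k) (\<tau> k) (\<xi> k)" and
    lim: "(\<lambda>k. dist_int 0 t f (elementary_process (n k) (\<tau> k) (\<xi> k))) \<longlonglongrightarrow> 0"
    "(\<lambda>k. mean_sq_dist M J (elementary_integral (n k) (\<tau> k) (\<xi> k) (\<lambda>s w. W s w $ \<alpha>))) \<longlonglongrightarrow> 0"
    using assms unfolding has_ito_integral_def by blast
  show thesis by (rule that[OF simple_integral_elementary[OF el] lim])
qed

lemma mean_sq_dist_simple_measurable:
  assumes f: "(\<lambda>(s, w). f s w) \<in> borel_measurable (restrict_space lborel {0..t} \<Otimes>\<^sub>M M)"
    and H: "simple_integral \<alpha> lo hi H I" "0 \<le> lo"
  shows "(\<lambda>s. mean_sq_dist M (f s) (H s) * indicator {0..t} s) \<in> borel_measurable lborel"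
proof -
  have id: "(\<lambda>p. (fst p, snd p)) \<in> restrict_space lborel {0..t} \<Otimes>\<^sub>M M \<rightarrow>\<^sub>M borel \<Otimes>\<^sub>M M"
    by (intro measurable_Pair measurable_compose[OF measurable_fst] measurable_restrict_space1) auto
  have [measurable]: "(\<lambda>(s, w). H s w) \<in> borel_measurable (restrict_space lborel {0..t} \<Otimes>\<^sub>M M)"
    using measurable_compose[OF id simple_integral_props(4)[OF H]] by (simp add: case_prod_beta)
  note [measurable] = f
  have "(\<lambda>s. mean_sq_dist M (f s) (H s)) \<in> borel_measurable (restrict_space lborel {0..t})"
    unfolding mean_sq_dist_def by measurable
  then show ?thesis by (subst (asm) borel_measurable_restrict_space_iff_ennreal) auto
qed

text \<open>
  Bounds up to a constant factor are all that is needed below, so the exact isometry is not carried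
  over from elementary integrals to limits.
\<close>

lemma ito_simple_bound:
  assumes ito: "has_ito_integral M F (\<lambda>s w. W s w $ \<alpha>) t f J"
    and H: "simple_integral \<alpha> 0 t H L"
  shows "mean_sq_dist M J L \<le> 4 * (dist_int 0 t f H)"
proof -
  obtain P I where PI: "\<And>k::nat. simple_integral \<alpha> 0 t (P k) (I k)" and
    lim: "(\<lambda>k. dist_int 0 t f (P k)) \<longlonglongrightarrow> 0" "(\<lambda>k. mean_sq_dist M J (I k)) \<longlonglongrightarrow> 0"
    using has_ito_integral_approx[OF ito] by blast
  have J: "J \<in> borel_measurable M" and f: "ito_integrand M F t f"
    using ito by (auto simp: has_ito_integral_def)
  let ?A = "dist_int 0 t f H"
  let ?x = "\<lambda>k. mean_sq_dist M J (I k)"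
  let ?y = "\<lambda>k. dist_int 0 t f (P k)"
  have fm: "f s \<in> borel_measurable M" if "s \<in> {0..t}" for s
    using f that by (auto simp: ito_integrand_def intro: measurable_F_M)
  have fjoint: "(\<lambda>(s, w). f s w) \<in> borel_measurable (restrict_space lborel {0..t} \<Otimes>\<^sub>M M)"
    using f by (simp add: ito_integrand_def)
  have IL: "mean_sq_dist M (I k) L \<le> 2 * ?y k + 2 * ?A" for k
  proof -
    note D = simple_integral_diff[OF PI[of k] H]
    have "mean_sq_dist M (I k) L = (\<integral>\<^sup>+s. mean_sq_dist M (P k s) (H s) \<partial>lborel)"
      using simple_integral_isometry[OF D] by (simp add: mean_sq_dist_diff_zero)
    also have "\<dots> \<le> (\<integral>\<^sup>+s. 2 * (mean_sq_dist M (f s) (P k s) * indicator {0..t} s) +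
        2 * (mean_sq_dist M (f s) (H s) * indicator {0..t} s) \<partial>lborel)"
    proof (rule nn_integral_mono)
      fix s
      show "mean_sq_dist M (P k s) (H s) \<le> 2 * (mean_sq_dist M (f s) (P k s) * indicator {0..t} s) +
        2 * (mean_sq_dist M (f s) (H s) * indicator {0..t} s)"
      proof (cases "s \<in> {0..t}")
        case True
        have "P k s \<in> borel_measurable M" "H s \<in> borel_measurable M"
          using simple_integral_props(1)[OF PI, of k s] simple_integral_props(1)[OF H, of s]
          by (auto simp: sq_integrable_measurable)
        from mean_sq_dist_triangle[OF this(1) fm[OF True] this(2)] True
        show ?thesis by (simp add: mean_sq_dist_commute)
      next
        case False
        then have "P k s = (\<lambda>w. 0)" "H s = (\<lambda>w. 0)"
          using simple_integral_props(3)[OF PI] simple_integral_props(3)[OF H] by auto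
        then show ?thesis by (simp add: mean_sq_dist_def)
      qed
    qed
    also have "\<dots> = 2 * ?y k + 2 * ?A"
      using mean_sq_dist_simple_measurable[OF fjoint PI] mean_sq_dist_simple_measurable[OF fjoint H]
      by (subst nn_integral_add) (auto simp: nn_integral_cmult)
    finally show ?thesis .
  qed
  \<comment> \<open>Two triangle inequalities with factor 2 each, one through \<open>I k\<close> for
    the integrals and one through \<open>f\<close> for the integrands, produce the factor 4.\<close>
  have le: "mean_sq_dist M J L \<le> 2 * ?x k + (4 * ?y k + 4 * ?A)" for k
  proof -
    have "mean_sq_dist M J L \<le> 2 * ?x k + 2 * mean_sq_dist M (I k) L"
      using J simple_integral_props(2)[OF PI, of k] simple_integral_props(2)[OF H]
      by (intro mean_sq_dist_triangle) (auto simp: sq_integrable_measurable)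
    also have "\<dots> \<le> 2 * ?x k + 2 * (2 * ?y k + 2 * ?A)"
      by (intro add_left_mono mult_left_mono IL) auto
    also have "\<dots> = 2 * ?x k + (4 * ?y k + 4 * ?A)"
      by (simp add: distrib_left mult.assoc[symmetric])
    finally show ?thesis .
  qed
  have "(\<lambda>k. 2 * ?x k + (4 * ?y k + 4 * ?A)) \<longlonglongrightarrow> 2 * 0 + (4 * 0 + 4 * ?A)"
    by (intro tendsto_add tendsto_const ennreal_tendsto_cmult lim) auto
  then show ?thesis
    using le by (intro tendsto_lowerbound[where f="\<lambda>k. 2 * ?x k + (4 * ?y k + 4 * ?A)"]) auto
qed

text \<open>The zero process is elementary with integral 0, so comparing \<open>J\<close> with it
  bounds \<open>J\<close> itself.\<close>

lemma ito_sq_integrable: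
  assumes ito: "has_ito_integral M F (\<lambda>s w. W s w $ \<alpha>) t f J"
  shows "sq_integrable M J"
    and "mean_sq_dist M J (\<lambda>w. 0) \<le> 4 * (\<integral>\<^sup>+s\<in>{0..t}. mean_sq_dist M (f s) (\<lambda>w. 0) \<partial>lborel)"
proof -
  show le: "mean_sq_dist M J (\<lambda>w. 0) \<le> 4 * (\<integral>\<^sup>+s\<in>{0..t}. mean_sq_dist M (f s) (\<lambda>w. 0) \<partial>lborel)"
    using ito_simple_bound[OF ito simple_integral.zero] .
  have "\<dots> < \<infinity>" using ito by (auto simp: has_ito_integral_def ito_integrand_def ennreal_mult_less_top)
  with le show "sq_integrable M J"
    using ito by (subst sq_integrable_iff_mean_sq) (auto simp: has_ito_integral_def)
qed

text \<open>The integrals up to s and up to t come with unrelated approximating sequences. Only the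
  one for \<open>Jt\<close> is used, cut at s: its first part also approximates \<open>Js\<close> by
  \<open>ito_simple_bound\<close>, and its second part is orthogonal to \<open>Z\<close>.
  Subtracting the second part from \<open>Jt - Js\<close> therefore leaves the inner product with
  \<open>Z\<close> unchanged and makes the mean square tend to 0.\<close>

lemma ito_increment_orthogonal:
  assumes Js: "has_ito_integral M F (\<lambda>s w. W s w $ \<alpha>) s f Js"
    and Jt: "has_ito_integral M F (\<lambda>s w. W s w $ \<alpha>) t f Jt"
    and st: "0 \<le> s" "s \<le> t" and Z: "Z \<in> L2F s"
  shows "ip Z (\<lambda>w. Jt w - Js w) = 0"
proof -
  obtain P I where PI: "\<And>k::nat. simple_integral \<alpha> 0 t (P k) (I k)" and
    lim: "(\<lambda>k. dist_int 0 t f (P k)) \<longlonglongrightarrow> 0" "(\<lambda>k. mean_sq_dist M Jt (I k)) \<longlonglongrightarrow> 0"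
    using has_ito_integral_approx[OF Jt] by blast
  let ?x = "\<lambda>k. mean_sq_dist M Jt (I k)"
  let ?y = "\<lambda>k. dist_int 0 t f (P k)"
  have "\<exists>D. sq_integrable M D \<and> ip Z D = ip Z (\<lambda>w. Jt w - Js w) \<and> ennreal (msq M D) \<le> 2 * ?x k + 8 * ?y k" for k
  proof -
    obtain H1 I1 H2 I2 where sp: "simple_integral \<alpha> 0 s H1 I1"
      "simple_integral \<alpha> s t H2 I2" "I k = (\<lambda>w. I1 w + I2 w)" "\<And>r. r < s \<Longrightarrow> H1 r = P k r"
      using simple_integral_split[OF PI st order_refl, of k] by blast
    define D where "D w = (Jt w - Js w) - I2 w" for w
    have sq: "sq_integrable M Jt" "sq_integrable M Js" "sq_integrable M I2" "sq_integrable M I1"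
        "sq_integrable M (I k)" "sq_integrable M Z"
      using ito_sq_integrable(1)[OF Jt] ito_sq_integrable(1)[OF Js] simple_integral_props(2)[OF sp(1)]
        simple_integral_props(2)[OF sp(2)] simple_integral_props(2)[OF PI] st Z by (auto simp: L2F_sq)
    have D: "sq_integrable M D" unfolding D_def by (intro sq_integrable_diff sq)
    have "ip Z D = ip Z (\<lambda>w. Jt w - Js w) - ip Z I2"
      unfolding D_def by (intro ip_diff_right sq_integrable_diff sq)
    then have ipD: "ip Z D = ip Z (\<lambda>w. Jt w - Js w)"
      using simple_integral_orthogonal[OF sp(2) st(1) Z] by simp
    have "mean_sq_dist M Js I1 \<le> 4 * (dist_int 0 s f H1)"
      by (rule ito_simple_bound[OF Js sp(1)])
    also have "\<dots> \<le> 4 * ?y k"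
    proof (intro mult_left_mono nn_integral_mono_AE)
      show "AE r in lborel. mean_sq_dist M (f r) (H1 r) * indicator {0..s} r
          \<le> mean_sq_dist M (f r) (P k r) * indicator {0..t} r"
        \<comment> \<open>At the end point \<open>s\<close> itself \<open>H1\<close> and
          \<open>P k\<close> may differ, but a single time is a null set.\<close>
        using AE_lborel_singleton[of s]
        by eventually_elim (use st in \<open>auto simp: sp(4) indicator_def\<close>)
    qed simp
    finally have 1: "mean_sq_dist M Js I1 \<le> 4 * ?y k" .
    have "D = (\<lambda>w. (Jt w - I k w) - (Js w - I1 w))" by (auto simp: D_def sp(3))
    then have "msq M D \<le> 2 * msq M (\<lambda>w. Jt w - I k w) + 2 * msq M (\<lambda>w. Js w - I1 w)"
      using sq by (auto intro!: msq_diff_le sq_integrable_diff)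
    then have "ennreal (msq M D) \<le> ennreal (2 * msq M (\<lambda>w. Jt w - I k w) + 2 * msq M (\<lambda>w. Js w - I1 w))"
      by (rule ennreal_leI)
    also have "\<dots> = 2 * ?x k + 2 * mean_sq_dist M Js I1"
      using sq by (simp add: mean_sq_dist_eq_msq sq_integrable_diff ennreal_mult)
    also have "\<dots> \<le> 2 * ?x k + 2 * (4 * ?y k)" by (intro add_left_mono mult_left_mono 1) simp
    finally have "ennreal (msq M D) \<le> 2 * ?x k + 8 * ?y k" by (simp add: mult.assoc[symmetric])
    with D ipD show ?thesis by blast
  qed
  then have "\<exists>D. \<forall>k. sq_integrable M (D k) \<and> ip Z (D k) = ip Z (\<lambda>w. Jt w - Js w) \<and>
      ennreal (msq M (D k)) \<le> 2 * ?x k + 8 * ?y k"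
    by (intro choice allI)
  then obtain D where "\<forall>k. sq_integrable M (D k) \<and> ip Z (D k) = ip Z (\<lambda>w. Jt w - Js w) \<and>
      ennreal (msq M (D k)) \<le> 2 * ?x k + 8 * ?y k" ..
  then have D: "\<And>k. sq_integrable M (D k)" "\<And>k. ip Z (D k) = ip Z (\<lambda>w. Jt w - Js w)"
    and le: "\<And>k. ennreal (msq M (D k)) \<le> 2 * ?x k + 8 * ?y k"
    by blast+
  have "(\<lambda>k. 2 * ?x k + 8 * ?y k) \<longlonglongrightarrow> 2 * 0 + 8 * 0"
    by (intro tendsto_add ennreal_tendsto_cmult lim) auto
  then have "(\<lambda>k. ennreal (msq M (D k))) \<longlonglongrightarrow> 0"
    by (intro tendsto_sandwich[of "\<lambda>_. 0" "\<lambda>k. ennreal (msq M (D k))" sequentially "\<lambda>k. 2 * ?x k + 8 * ?y k"])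
      (auto simp: le)
  then have "(\<lambda>k. msq M (D k)) \<longlonglongrightarrow> 0" by (simp add: ennreal_tendsto_0_iff)
  from integral_inner_limit_zero[OF L2F_sq[OF Z] D(1) this, folded ip_def, OF D(2)]
  show ?thesis .
qed

text \<open>An approximation of \<open>f\<close> up to s is continued by \<zeta> on [s, t). This is
  an elementary process whose integral is \<open>I k\<close> plus the increment times \<zeta>, so
  \<open>ito_simple_bound\<close> compares it with \<open>Jt\<close>, and its error before s
  disappears in the limit. The constant 8 is the 4 of that bound, doubled by the triangle
  inequality.\<close>

lemma ito_increment_bound:
  assumes Js: "has_ito_integral M F (\<lambda>s w. W s w $ \<alpha>) s f Js"
    and Jt: "has_ito_integral M F (\<lambda>s w. W s w $ \<alpha>) t f Jt"
    and st: "0 \<le> s" "s \<le> t" and \<zeta>: "\<zeta> \<in> L2F s"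
  shows "ennreal (msq M (\<lambda>w. Jt w - Js w - (dW s t w $ \<alpha>) *\<^sub>R \<zeta> w))
    \<le> 8 * (\<integral>\<^sup>+r\<in>{s..t}. mean_sq_dist M (f r) \<zeta> \<partial>lborel)" (is "ennreal ?Y \<le> 8 * ?B")
proof -
  obtain P I where PI: "\<And>k::nat. simple_integral \<alpha> 0 s (P k) (I k)" and
    lim: "(\<lambda>k. dist_int 0 s f (P k)) \<longlonglongrightarrow> 0" "(\<lambda>k. mean_sq_dist M Js (I k)) \<longlonglongrightarrow> 0"
    using has_ito_integral_approx[OF Js] by blast
  define H where "H k = (\<lambda>r w. P k r w + indicator {s..<t} r *\<^sub>R \<zeta> w)" for k
  define L where "L k = (\<lambda>w. I k w + (dW s t w $ \<alpha>) *\<^sub>R \<zeta> w)" for k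
  have HL: "simple_integral \<alpha> 0 t (H k) (L k)" for k
    unfolding H_def L_def
    by (intro simple_integral_add simple_integral_mono[OF PI] simple_integral_single \<zeta>) (use st in auto)
  have fjoint: "(\<lambda>(s, w). f s w) \<in> borel_measurable (restrict_space lborel {0..s} \<Otimes>\<^sub>M M)"
     "(\<lambda>(s, w). f s w) \<in> borel_measurable (restrict_space lborel {0..t} \<Otimes>\<^sub>M M)"
    using Js Jt by (auto simp: has_ito_integral_def ito_integrand_def)
  have m\<zeta>: "(\<lambda>r. mean_sq_dist M (f r) \<zeta> * indicator {s..t} r) \<in> borel_measurable lborel"
  proof -
    have [measurable]: "\<zeta> \<in> borel_measurable M" using \<zeta> by (simp add: L2F_def sq_integrable_def)
    note [measurable] = fjoint(2)
    have "(\<lambda>s. mean_sq_dist M (f s) \<zeta>) \<in> borel_measurable (restrict_space lborel {0..t})"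
      unfolding mean_sq_dist_def by measurable
    then have "(\<lambda>r. mean_sq_dist M (f r) \<zeta> * indicator {0..t} r) \<in> borel_measurable lborel"
      by (subst (asm) borel_measurable_restrict_space_iff_ennreal) auto
    then have "(\<lambda>r. (mean_sq_dist M (f r) \<zeta> * indicator {0..t} r) * indicator {s..t} r) \<in> borel_measurable lborel"
      by measurable
    moreover have "(mean_sq_dist M (f r) \<zeta> * indicator {0..t} r) * indicator {s..t} r = mean_sq_dist M (f r) \<zeta> * indicator {s..t} r" for r
      using st by (auto simp: indicator_def)
    ultimately show ?thesis by simp
  qed
  let ?x = "\<lambda>k. mean_sq_dist M Js (I k)"
  let ?y = "\<lambda>k. dist_int 0 s f (P k)"
  have sq: "sq_integrable M Jt" "sq_integrable M Js" "sq_integrable M (I k)" "sq_integrable M (L k)" for k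
    using ito_sq_integrable(1)[OF Jt] ito_sq_integrable(1)[OF Js] simple_integral_props(2)[OF PI]
      simple_integral_props(2)[OF HL] by auto
  have "ennreal ?Y \<le> (8 * ?y k + 8 * ?B) + 2 * ?x k" for k
  proof -
    have "mean_sq_dist M Jt (L k) \<le> 4 * (dist_int 0 t f (H k))"
      by (rule ito_simple_bound[OF Jt HL])
    also have "\<dots> \<le> 4 * (\<integral>\<^sup>+r. mean_sq_dist M (f r) (P k r) * indicator {0..s} r +
        mean_sq_dist M (f r) \<zeta> * indicator {s..t} r \<partial>lborel)"
    proof (intro mult_left_mono nn_integral_mono_AE)
      show "AE r in lborel. mean_sq_dist M (f r) (H k r) * indicator {0..t} r
          \<le> mean_sq_dist M (f r) (P k r) * indicator {0..s} r + mean_sq_dist M (f r) \<zeta> * indicator {s..t} r"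
        using AE_lborel_singleton[of t]
      proof eventually_elim
        case (elim r)
        consider "r \<notin> {0..t}" | "0 \<le> r" "r < s" | "s \<le> r" "r < t" using elim by fastforce
        then show ?case
        proof cases
          case 2
          then have "H k r = P k r" by (auto simp: H_def)
          with 2 show ?thesis by (simp add: indicator_def)
        next
          case 3
          have "P k r = (\<lambda>w. 0)" using simple_integral_props(3)[OF PI[of k], of r] 3 by simp
          then have "H k r = \<zeta>" using 3 by (auto simp: H_def)
          with 3 st show ?thesis by (simp add: indicator_def)
        qed simp
      qed
    qed simp
    also have "\<dots> = 4 * ?y k + 4 * ?B"
      using mean_sq_dist_simple_measurable[OF fjoint(1) PI, of k] m\<zeta>
      by (subst nn_integral_add) (auto simp: distrib_left)
    finally have 1: "mean_sq_dist M Jt (L k) \<le> 4 * ?y k + 4 * ?B" .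
    have "(\<lambda>w. Jt w - Js w - (dW s t w $ \<alpha>) *\<^sub>R \<zeta> w) = (\<lambda>w. (Jt w - L k w) - (Js w - I k w))"
      by (auto simp: L_def)
    then have "?Y \<le> 2 * msq M (\<lambda>w. Jt w - L k w) + 2 * msq M (\<lambda>w. Js w - I k w)"
      using sq by (auto intro!: msq_diff_le sq_integrable_diff)
    then have "ennreal ?Y \<le> ennreal (2 * msq M (\<lambda>w. Jt w - L k w) + 2 * msq M (\<lambda>w. Js w - I k w))"
      by (rule ennreal_leI)
    also have "\<dots> = 2 * mean_sq_dist M Jt (L k) + 2 * ?x k"
      using sq by (simp add: mean_sq_dist_eq_msq sq_integrable_diff ennreal_mult)
    also have "\<dots> \<le> 2 * (4 * ?y k + 4 * ?B) + 2 * ?x k"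
      by (intro add_right_mono mult_left_mono 1) simp
    finally show ?thesis by (simp add: mult.assoc[symmetric] distrib_left)
  qed
  moreover have "(\<lambda>k. (8 * ?y k + 8 * ?B) + 2 * ?x k) \<longlonglongrightarrow> (8 * 0 + 8 * ?B) + 2 * 0"
    by (intro tendsto_add tendsto_const ennreal_tendsto_cmult lim) auto
  ultimately show ?thesis
    by (intro tendsto_lowerbound[where f="\<lambda>k. (8 * ?y k + 8 * ?B) + 2 * ?x k"]) auto
qed

end

section \<open>Time integrals and pathwise estimates\<close>

text \<open>Rounding the time down to multiples of 1 / (k + 1) leaves countably many times, hence a
  jointly measurable process; by continuity of the paths these processes converge to
  \<open>g\<close>.\<close>

lemma continuous_paths_measurable:
  fixes g :: "real \<Rightarrow> 'w \<Rightarrow> 'b::euclidean_space"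
  assumes g: "\<And>r. g r \<in> borel_measurable M"
    and cont: "\<And>w. w \<in> space M \<Longrightarrow> continuous_on UNIV (\<lambda>r. g r w)"
  shows "(\<lambda>(r, w). g r w) \<in> borel_measurable (borel \<Otimes>\<^sub>M M)"
proof (rule borel_measurable_LIMSEQ_metric)
  let ?a = "\<lambda>k r. of_int \<lfloor>r * real (Suc k)\<rfloor> / real (Suc k)"
  let ?f = "\<lambda>k (r, w). g (?a k r) w"
  show "?f k \<in> borel_measurable (borel \<Otimes>\<^sub>M M)" for k
  proof -
    have "(\<lambda>p. g (of_int \<lfloor>fst p * real (Suc k)\<rfloor> / real (Suc k)) (snd p)) \<in> borel_measurable (borel \<Otimes>\<^sub>M M)"
    proof (rule measurable_compose_countable[where f="\<lambda>(i::int) p. g (of_int i / real (Suc k)) (snd p)"])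
      show "(\<lambda>p. g (of_int i / real (Suc k)) (snd p)) \<in> borel_measurable (borel \<Otimes>\<^sub>M M)" for i :: int
        using measurable_compose[OF measurable_snd g] .
      show "(\<lambda>p. \<lfloor>fst p * real (Suc k)\<rfloor>) \<in> (borel \<Otimes>\<^sub>M M) \<rightarrow>\<^sub>M count_space UNIV"
        by measurable
    qed
    then show ?thesis by (simp add: case_prod_beta)
  qed
  fix p :: "real \<times> 'w" assume "p \<in> space (borel \<Otimes>\<^sub>M M)"
  then obtain r w where p: "p = (r, w)" "w \<in> space M" by (auto simp: space_pair_measure)
  have "(\<lambda>k. ?a k r) \<longlonglongrightarrow> r"
  proof (rule Lim_transform_bound[where g="\<lambda>k. inverse (real (Suc k))", THEN LIM_zero_cancel])
    show "\<forall>\<^sub>F k in sequentially. norm (?a k r - r) \<le> norm (inverse (real (Suc k)))"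
    proof (intro always_eventually allI)
      fix k
      have "?a k r - r = (of_int \<lfloor>r * real (Suc k)\<rfloor> - r * real (Suc k)) / real (Suc k)"
        by (simp add: field_simps)
      moreover have "\<bar>of_int \<lfloor>r * real (Suc k)\<rfloor> - r * real (Suc k)\<bar> \<le> 1" by linarith
      ultimately show "norm (?a k r - r) \<le> norm (inverse (real (Suc k)))"
        by (simp only: real_norm_def abs_divide) (simp add: inverse_eq_divide divide_right_mono)
    qed
  qed (rule LIMSEQ_inverse_real_of_nat)
  then have "(\<lambda>k. g (?a k r) w) \<longlonglongrightarrow> g r w"
    using cont[OF p(2)] by (intro continuous_on_tendsto_compose[of UNIV "\<lambda>r. g r w"]) auto
  then show "(\<lambda>k. ?f k p) \<longlonglongrightarrow> (case p of (r, w) \<Rightarrow> g r w)"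
    using p by simp
qed

lemma norm_set_integral_sq_le:
  fixes h :: "real \<Rightarrow> 'b::euclidean_space"
  assumes "s \<le> t" and h[measurable]: "h \<in> borel_measurable borel"
  shows "ennreal ((norm (LINT r:{s..t}|lborel. h r))\<^sup>2)
    \<le> ennreal (t - s) * (\<integral>\<^sup>+r\<in>{s..t}. ennreal ((norm (h r))\<^sup>2) \<partial>lborel)"
proof -
  let ?h = "\<lambda>r. ennreal (norm (h r)) * indicator {s..t} r"
  have "ennreal (norm (LINT r:{s..t}|lborel. h r)) \<le> (\<integral>\<^sup>+r. ?h r \<partial>lborel)"
  proof (cases "set_integrable lborel {s..t} h")
    case True
    then have "ennreal (norm (LINT r:{s..t}|lborel. h r)) \<le> (\<integral>\<^sup>+r. norm (indicator {s..t} r *\<^sub>R h r) \<partial>lborel)"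
      unfolding set_lebesgue_integral_def set_integrable_def by (rule integral_norm_bound_ennreal)
    also have "\<dots> = (\<integral>\<^sup>+r. ?h r \<partial>lborel)"
      by (intro nn_integral_cong) (auto simp: indicator_def)
    finally show ?thesis .
  next
    \<comment> \<open>For a non-integrable \<open>h\<close> the integral on the left is 0 by
      default.\<close>
    case False
    then show ?thesis by (simp add: set_lebesgue_integral_def set_integrable_def not_integrable_integral_eq)
  qed
  \<comment> \<open>The indicator is inserted a second time, as the factor that Cauchy-Schwarz turns
    into the length of the interval.\<close>
  then have "(ennreal (norm (LINT r:{s..t}|lborel. h r)))\<^sup>2 \<le> (\<integral>\<^sup>+r. ?h r * indicator {s..t} r \<partial>lborel)\<^sup>2"
    by (intro power_mono) (auto simp: indicator_def mult.assoc intro!: nn_integral_mono elim!: order_trans)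
  also have "\<dots> \<le> (\<integral>\<^sup>+r. (?h r)\<^sup>2 \<partial>lborel) * (\<integral>\<^sup>+r. (indicator {s..t} r)\<^sup>2 \<partial>lborel)"
    by (rule Cauchy_Schwarz_nn_integral) auto
  also have "(\<integral>\<^sup>+r. (?h r)\<^sup>2 \<partial>lborel) = (\<integral>\<^sup>+r\<in>{s..t}. ennreal ((norm (h r))\<^sup>2) \<partial>lborel)"
    by (intro nn_integral_cong) (auto simp: indicator_def ennreal_power)
  also have "(\<integral>\<^sup>+r. (indicator {s..t} r)\<^sup>2 \<partial>lborel) = (\<integral>\<^sup>+r. indicator {s..t} r \<partial>lborel)"
    by (intro nn_integral_cong) (auto simp: indicator_def)
  also have "\<dots> = ennreal (t - s)" using assms by simp
  finally show ?thesis by (simp add: ennreal_power mult.commute)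
qed

text \<open>One factor t - s comes from Cauchy-Schwarz in time, the other from integrating the
  uniform bound \<open>B\<close> after exchanging the integrals.\<close>

lemma (in prob_space) mean_sq_time_integral:
  fixes g :: "real \<Rightarrow> 'a \<Rightarrow> 'b::euclidean_space"
  assumes g: "(\<lambda>(r, w). g r w) \<in> borel_measurable (borel \<Otimes>\<^sub>M M)"
    and st: "s \<le> t" and B: "\<And>r. r \<in> {s..t} \<Longrightarrow> mean_sq_dist M (g r) (\<lambda>_. 0) \<le> ennreal B" "0 \<le> B"
  shows "mean_sq_dist M (\<lambda>w. LINT r:{s..t}|lborel. g r w) (\<lambda>_. 0) \<le> ennreal ((t - s)\<^sup>2 * B)"
proof -
  interpret pair_sigma_finite lborel M ..
  note [measurable] = g
  have gm: "(\<lambda>r. g r w) \<in> borel_measurable borel" if "w \<in> space M" for w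
    using measurable_compose[OF measurable_Pair2'[OF that, of borel] g] by simp
  have G: "(\<lambda>(r, w). ennreal ((norm (g r w))\<^sup>2) * indicator {s..t} r) \<in> borel_measurable (lborel \<Otimes>\<^sub>M M)"
  proof -
    have [measurable]: "(\<lambda>(r, w). g r w) \<in> borel_measurable (lborel \<Otimes>\<^sub>M M)"
      using g by (simp cong: measurable_cong_sets sets_pair_measure_cong)
    show ?thesis by measurable
  qed
  have "mean_sq_dist M (\<lambda>w. LINT r:{s..t}|lborel. g r w) (\<lambda>_. 0)
      \<le> (\<integral>\<^sup>+w. ennreal (t - s) * (\<integral>\<^sup>+r\<in>{s..t}. ennreal ((norm (g r w))\<^sup>2) \<partial>lborel) \<partial>M)"
    unfolding mean_sq_dist_def using norm_set_integral_sq_le[OF st gm]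
    by (intro nn_integral_mono) auto
  also have "\<dots> = ennreal (t - s) * (\<integral>\<^sup>+w. (\<integral>\<^sup>+r\<in>{s..t}. ennreal ((norm (g r w))\<^sup>2) \<partial>lborel) \<partial>M)"
    using measurable_pair_swap[OF G]
    by (intro nn_integral_cmult lborel.borel_measurable_nn_integral) simp
  also have "(\<integral>\<^sup>+w. (\<integral>\<^sup>+r\<in>{s..t}. ennreal ((norm (g r w))\<^sup>2) \<partial>lborel) \<partial>M)
     = (\<integral>\<^sup>+r. (\<integral>\<^sup>+w. ennreal ((norm (g r w))\<^sup>2) * indicator {s..t} r \<partial>M) \<partial>lborel)"
    by (rule Fubini'[OF G])
  also have "\<dots> \<le> (\<integral>\<^sup>+r. ennreal B * indicator {s..t} r \<partial>lborel)"
    using B(1) by (intro nn_integral_mono) (auto simp: indicator_def mean_sq_dist_def)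
  also have "\<dots> = ennreal (B * (t - s))"
    using st B(2) by (simp add: nn_integral_cmult ennreal_mult)
  also have "ennreal (t - s) * ennreal (B * (t - s)) = ennreal ((t - s)\<^sup>2 * B)"
    using st B(2) by (subst ennreal_mult[symmetric]) (auto simp: power2_eq_square ac_simps)
  finally show ?thesis by (simp add: mult_left_mono)
qed

text \<open>The bound is for the integral of \<open>u\<close>; put back into the hypothesis it
  yields one for \<open>u\<close>. The auxiliary function \<psi> applies the integrating factor
  exp(- L s) to the integral of \<open>u\<close> and subtracts the integral of \<open>v\<close>. It
  decreases because this factor is at most 1 and \<open>v\<close> is nonnegative.\<close>

lemma gronwall_integral:
  fixes u v :: "real \<Rightarrow> real"
  assumes u: "continuous_on {0..T} u" and v: "continuous_on {0..T} v"
    and le: "\<And>t. t \<in> {0..T} \<Longrightarrow> u t \<le> v t + L * integral {0..t} u"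
    and v0: "\<And>t. t \<in> {0..T} \<Longrightarrow> 0 \<le> v t" and L: "0 \<le> L" and t: "t \<in> {0..T}"
  shows "integral {0..t} u \<le> exp (L * T) * integral {0..T} v"
proof -
  define \<psi> where "\<psi> s = exp (- (L * s)) * integral {0..s} u - integral {0..s} v" for s
  have deriv: "((\<lambda>s. integral {0..s} g) has_real_derivative g s) (at s)"
    if "continuous_on {0..T} g" "0 < s" "s < t" for g :: "real \<Rightarrow> real" and s
    using integral_has_real_derivative[OF that(1), of s] that t by (simp add: at_within_Icc_at)
  have contI: "continuous_on {0..t} (\<lambda>s. integral {0..s} g)" if "continuous_on {0..T} g" for g :: "real \<Rightarrow> real"
    using that t by (intro indefinite_integral_continuous_1 integrable_continuous_real) (auto intro: continuous_on_subset)
  have "\<psi> t \<le> \<psi> 0"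
  proof (rule DERIV_nonpos_imp_decreasing_open[of 0 t \<psi>])
    show "0 \<le> t" using t by simp
  next
    fix s assume s: "0 < s" "s < t"
    have "(\<psi> has_real_derivative (exp (- (L * s)) * (- L) * integral {0..s} u + u s * exp (- (L * s)) - v s)) (at s)"
      unfolding \<psi>_def using deriv[OF u s] deriv[OF v s] by (auto intro!: derivative_eq_intros)
    moreover have "exp (- (L * s)) * (- L) * integral {0..s} u + u s * exp (- (L * s)) - v s \<le> 0"
    proof -
      have "exp (- (L * s)) * (u s - L * integral {0..s} u) \<le> exp (- (L * s)) * v s"
        using le[of s] s t by (intro mult_left_mono) auto
      also have "\<dots> \<le> 1 * v s" using v0[of s] s t L by (intro mult_right_mono) auto
      finally show ?thesis by (simp add: algebra_simps)
    qed
    ultimately show "\<exists>y. (\<psi> has_real_derivative y) (at s) \<and> y \<le> 0" by blast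
  next
    show "continuous_on {0..t} \<psi>" unfolding \<psi>_def by (intro continuous_intros contI u v)
  qed
  then have "exp (- (L * t)) * integral {0..t} u \<le> integral {0..t} v" by (simp add: \<psi>_def)
  then have "exp (L * t) * (exp (- (L * t)) * integral {0..t} u) \<le> exp (L * t) * integral {0..t} v"
    by (intro mult_left_mono) auto
  then have "integral {0..t} u \<le> exp (L * t) * integral {0..t} v"
    by (simp add: mult.assoc[symmetric] flip: exp_add)
  also have "\<dots> \<le> exp (L * T) * integral {0..T} v"
  proof (intro mult_mono)
    show "integral {0..t} v \<le> integral {0..T} v"
      using t v v0 by (intro integral_subset_le integrable_continuous_real) (auto intro: continuous_on_subset)
    show "0 \<le> integral {0..t} v" using t v0 by (intro integral_nonneg integrable_continuous_real continuous_on_subset[OF v]) auto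
    show "exp (L * t) \<le> exp (L * T)" using t L by (auto intro: mult_left_mono)
  qed auto
  finally show ?thesis .
qed

lemma lipschitz_continuous:
  fixes f :: "'a::real_normed_vector \<Rightarrow> 'b::real_normed_vector"
  assumes "\<And>x y. norm (f x - f y) \<le> L * norm (x - y)"
  shows "continuous_on UNIV f"
proof -
  have "(max L 0)-lipschitz_on UNIV f"
  proof (rule lipschitz_onI)
    fix x y
    have "norm (f x - f y) \<le> L * norm (x - y)" by fact
    also have "\<dots> \<le> max L 0 * norm (x - y)" by (intro mult_right_mono) auto
    finally show "dist (f x) (f y) \<le> max L 0 * dist x y" by (simp add: dist_norm)
  qed simp
  then show ?thesis by (rule lipschitz_on_continuous_on)
qed

lemma lipschitz_norm_sq_le:
  fixes f :: "'a::real_normed_vector \<Rightarrow> 'b::real_normed_vector"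
  assumes "\<And>x y. norm (f x - f y) \<le> L * norm (x - y)"
  shows "(norm (f x))\<^sup>2 \<le> 2 * L\<^sup>2 * (norm x)\<^sup>2 + 2 * (norm (f 0))\<^sup>2"
proof -
  have "(norm (f x))\<^sup>2 \<le> 2 * (norm (f x - f 0))\<^sup>2 + 2 * (norm (f 0))\<^sup>2"
    using norm_add_sq_le[of "f x - f 0" "f 0"] by simp
  moreover have "(norm (f x - f 0))\<^sup>2 \<le> (L * norm x)\<^sup>2"
    using assms[of x 0] by (intro power_mono) auto
  ultimately show ?thesis by (simp add: power_mult_distrib)
qed

context brownian
begin

lemma L2F_lipschitz:
  fixes f :: "'a::euclidean_space \<Rightarrow> 'b::euclidean_space"
  assumes lip: "\<And>x y. norm (f x - f y) \<le> L * norm (x - y)" and Y: "Y \<in> L2F s"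
  shows "(\<lambda>w. f (Y w)) \<in> L2F s"
    and "msq M (\<lambda>w. f (Y w)) \<le> 2 * L\<^sup>2 * msq M Y + 2 * (norm (f 0))\<^sup>2"
proof -
  have f: "f \<in> borel_measurable borel"
    using lipschitz_continuous[OF lip] by (rule borel_measurable_continuous_onI)
  have 1: "(\<lambda>w. f (Y w)) \<in> borel_measurable (F s)"
    using Y f by (auto simp: L2F_def)
  have i: "integrable M (\<lambda>w. 2 * L\<^sup>2 * (norm (Y w))\<^sup>2 + 2 * (norm (f 0))\<^sup>2)"
    using Y by (simp add: L2F_def sq_integrable_def)
  note * = sq_integrable_dominated[OF measurable_F_M[OF 1] i]
  have "sq_integrable M (\<lambda>w. f (Y w))" by (rule *) (simp add: lipschitz_norm_sq_le[OF lip])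
  with 1 show "(\<lambda>w. f (Y w)) \<in> L2F s" by (simp add: L2F_def)
  have "msq M (\<lambda>w. f (Y w)) \<le> (LINT w|M. 2 * L\<^sup>2 * (norm (Y w))\<^sup>2 + 2 * (norm (f 0))\<^sup>2)"
    by (rule *) (simp add: lipschitz_norm_sq_le[OF lip])
  also have "\<dots> = 2 * L\<^sup>2 * msq M Y + 2 * (norm (f 0))\<^sup>2"
    using Y by (simp add: L2F_def sq_integrable_def msq_def prob_space)
  finally show "msq M (\<lambda>w. f (Y w)) \<le> 2 * L\<^sup>2 * msq M Y + 2 * (norm (f 0))\<^sup>2" .
qed

lemma msq_lipschitz_diff:
  fixes f :: "'a::euclidean_space \<Rightarrow> 'b::euclidean_space"
  assumes lip: "\<And>x y. norm (f x - f y) \<le> L * norm (x - y)" and "0 \<le> L" and Y: "Y \<in> L2F s" "Z \<in> L2F s"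
  shows "msq M (\<lambda>w. f (Y w) - f (Z w)) \<le> L\<^sup>2 * msq M (\<lambda>w. Y w - Z w)"
proof -
  have sq: "sq_integrable M (\<lambda>w. Y w - Z w)" "sq_integrable M (\<lambda>w. f (Y w) - f (Z w))"
    using Y L2F_lipschitz(1)[OF lip Y(1)] L2F_lipschitz(1)[OF lip Y(2)]
    by (intro sq_integrable_diff; simp add: L2F_def)+
  have "msq M (\<lambda>w. f (Y w) - f (Z w)) \<le> msq M (\<lambda>w. L *\<^sub>R (Y w - Z w))"
    using lip \<open>0 \<le> L\<close> sq
    by (intro sq_integrable_bound(2)) (auto intro: sq_integrable_scaleR sq_integrable_measurable)
  then show ?thesis by (simp only: msq_scaleR)
qed

end

section \<open>Moments and increments of the solution\<close>

locale ito_sde = brownian M F W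
  for M :: "'w measure" and F and W :: "real \<Rightarrow> 'w \<Rightarrow> real ^ 'd::finite" +
  fixes a :: "real ^ 'n::finite \<Rightarrow> real ^ 'n" and b :: "'d \<Rightarrow> real ^ 'n \<Rightarrow> real ^ 'n"
    and T :: real and x\<^sub>0 :: "real ^ 'n" and X :: "real \<Rightarrow> 'w \<Rightarrow> real ^ 'n" and L :: real
  assumes T: "0 < T" and L: "0 \<le> L"
    and a_lip: "norm (a x - a y) \<le> L * norm (x - y)"
    and b_lip: "norm (b \<alpha> x - b \<alpha> y) \<le> L * norm (x - y)"
    and solution: "ito_solution M F W T a b x\<^sub>0 X"
begin

section \<open>Stochastic integrals and a continuous modification\<close>

definition are_ito_integrals :: "('d \<Rightarrow> real \<Rightarrow> 'w \<Rightarrow> real ^ 'n) \<Rightarrow> bool" where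
  "are_ito_integrals J \<longleftrightarrow> (\<forall>t\<in>{0..T}.
        (\<forall>\<alpha>. has_ito_integral M F (\<lambda>s w. W s w $ \<alpha>) t (\<lambda>s w. b \<alpha> (X s w)) (J \<alpha> t)) \<and>
        (AE w in M. X t w = x\<^sub>0 + (LINT s:{0..t}|lborel. a (X s w)) + (\<Sum>\<alpha>\<in>UNIV. J \<alpha> t w)))"

text \<open>Integrals are determined only up to null sets; fixing one choice makes statements about
  different times speak of the same versions.\<close>

definition J :: "'d \<Rightarrow> real \<Rightarrow> 'w \<Rightarrow> real ^ 'n" where
  "J = (SOME J. are_ito_integrals J)"

lemma J_props: "are_ito_integrals J"
  unfolding J_def
proof (rule someI_ex[of are_ito_integrals])
  show "\<exists>J. are_ito_integrals J"
    using solution unfolding ito_solution_def are_ito_integrals_def by blast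
qed

lemma J_ito:
  "t \<in> {0..T} \<Longrightarrow> has_ito_integral M F (\<lambda>s w. W s w $ \<alpha>) t (\<lambda>s w. b \<alpha> (X s w)) (J \<alpha> t)"
  using J_props unfolding are_ito_integrals_def by blast

lemma X_eq:
  "t \<in> {0..T} \<Longrightarrow> AE w in M. X t w = x\<^sub>0 + (LINT s:{0..t}|lborel. a (X s w)) + (\<Sum>\<alpha>\<in>UNIV. J \<alpha> t w)"
  using J_props unfolding are_ito_integrals_def by blast

lemma X_measurable: "t \<in> {0..T} \<Longrightarrow> X t \<in> borel_measurable (F t)"
  using solution by (simp add: ito_solution_def)

lemma J_sq_integrable: "t \<in> {0..T} \<Longrightarrow> sq_integrable M (J \<alpha> t)"
  using ito_sq_integrable(1)[OF J_ito] .

text \<open>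
  A modification in this sense is jointly measurable in time and \<open>w\<close>, which \<open>X\<close> itself need not be;
  but it may fail to be adapted, since null sets need not belong to the filtration.
\<close>

definition is_modification :: "(real \<Rightarrow> 'w \<Rightarrow> real ^ 'n) \<Rightarrow> bool" where
  "is_modification Y \<longleftrightarrow> (\<forall>r. Y r \<in> borel_measurable M) \<and>
    (\<forall>w\<in>space M. continuous_on UNIV (\<lambda>r. Y r w)) \<and> (AE w in M. \<forall>r\<in>{0..T}. Y r w = X r w)"

lemma modification_exists: "\<exists>Y. is_modification Y"
proof -
  have "AE w in M. continuous_on {0..T} (\<lambda>t. X t w)" using solution by (simp add: ito_solution_def)
  then obtain N where N: "{w\<in>space M. \<not> continuous_on {0..T} (\<lambda>t. X t w)} \<subseteq> N" "emeasure M N = 0" "N \<in> sets M"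
    by (rule AE_E)
  \<comment> \<open>Clamping the time to [0, T] extends the paths continuously to all reals; on the
    exceptional null set the path is replaced by 0.\<close>
  define Y where "Y r w = (if w \<in> N then 0 else X (max 0 (min T r)) w)" for r w
  have "Y r \<in> borel_measurable M" for r
  proof -
    have "X (max 0 (min T r)) \<in> borel_measurable M"
      using T by (intro measurable_F_M[OF X_measurable]) auto
    then show ?thesis unfolding Y_def using N(3) by measurable
  qed
  moreover have "continuous_on UNIV (\<lambda>r. Y r w)" if "w \<in> space M" for w
  proof (cases "w \<in> N")
    case False
    then have "continuous_on {0..T} (\<lambda>t. X t w)" using N(1) that by auto
    then have "continuous_on UNIV (\<lambda>r. X (max 0 (min T r)) w)"
      by (rule continuous_on_compose2) (use T in \<open>auto intro!: continuous_intros\<close>)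
    then show ?thesis using False by (simp add: Y_def)
  qed (simp add: Y_def)
  moreover have "AE w in M. \<forall>r\<in>{0..T}. Y r w = X r w"
  proof (rule AE_I)
    show "{w \<in> space M. \<not> (\<forall>r\<in>{0..T}. Y r w = X r w)} \<subseteq> N" by (auto simp: Y_def max_def min_def)
  qed fact+
  ultimately show ?thesis unfolding is_modification_def by blast
qed

definition Xc :: "real \<Rightarrow> 'w \<Rightarrow> real ^ 'n" where
  "Xc = (SOME Y. is_modification Y)"

lemma Xc: "is_modification Xc"
  unfolding Xc_def by (rule someI_ex[OF modification_exists])

lemma Xc_measurable: "Xc r \<in> borel_measurable M"
  and Xc_continuous: "w \<in> space M \<Longrightarrow> continuous_on UNIV (\<lambda>r. Xc r w)"
  and Xc_eq: "AE w in M. \<forall>r\<in>{0..T}. Xc r w = X r w"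
  using Xc by (auto simp: is_modification_def)

lemma a_continuous: "continuous_on S a"
  using lipschitz_continuous[OF a_lip] continuous_on_subset by blast

lemma a_measurable [measurable]: "a \<in> borel_measurable borel"
  by (intro borel_measurable_continuous_onI a_continuous)

lemma aXc_continuous: "w \<in> space M \<Longrightarrow> continuous_on S (\<lambda>r. a (Xc r w))"
  by (rule continuous_on_compose2[OF a_continuous[of UNIV]])
    (auto intro: continuous_on_subset[OF Xc_continuous])

lemma Xc_joint: "(\<lambda>(r, w). Xc r w) \<in> borel_measurable (borel \<Otimes>\<^sub>M M)"
  by (rule continuous_paths_measurable[OF Xc_measurable Xc_continuous])

lemma aXc_joint: "(\<lambda>(r, w). a (Xc r w)) \<in> borel_measurable (borel \<Otimes>\<^sub>M M)"
  using measurable_compose[OF Xc_joint a_measurable] by (simp add: case_prod_beta)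

lemma aXc_integral:
  assumes "w \<in> space M"
  shows "set_integrable lborel {s..t} (\<lambda>r. a (Xc r w))"
    and "(LINT r:{s..t}|lborel. a (Xc r w)) = integral {s..t} (\<lambda>r. a (Xc r w))"
proof -
  show i: "set_integrable lborel {s..t} (\<lambda>r. a (Xc r w))"
    by (rule borel_integrable_atLeastAtMost'[OF aXc_continuous[OF assms]])
  show "(LINT r:{s..t}|lborel. a (Xc r w)) = integral {s..t} (\<lambda>r. a (Xc r w))"
    by (rule set_borel_integral_eq_integral(2)[OF i])
qed

text \<open>Outside a single null set \<open>Xc\<close> and \<open>X\<close> agree at all times in
  [0, T], so their time integrals agree too.\<close>

lemma Xc_decomposition:
  assumes t: "t \<in> {0..T}"
  shows "AE w in M. Xc t w = x\<^sub>0 + (LINT r:{0..t}|lborel. a (Xc r w)) + (\<Sum>\<alpha>\<in>UNIV. J \<alpha> t w)"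
  using X_eq[OF t] Xc_eq
proof eventually_elim
  case (elim w)
  have "(LINT r:{0..t}|lborel. a (Xc r w)) = (LINT r:{0..t}|lborel. a (X r w))"
    using elim(2) t by (intro set_lebesgue_integral_cong) auto
  then show ?case using elim t by simp
qed

lemma X_increment:
  assumes st: "0 \<le> s" "s \<le> t" "t \<le> T"
  shows "AE w in M. X t w - X s w = (LINT r:{s..t}|lborel. a (Xc r w)) + (\<Sum>\<alpha>\<in>UNIV. J \<alpha> t w - J \<alpha> s w)"
proof -
  have "t \<in> {0..T}" "s \<in> {0..T}" using st by auto
  from Xc_decomposition[OF this(1)] Xc_decomposition[OF this(2)] Xc_eq AE_space[of M]
  show ?thesis
  proof eventually_elim
    case (elim w)
    have "integral {0..s} (\<lambda>r. a (Xc r w)) + integral {s..t} (\<lambda>r. a (Xc r w)) = integral {0..t} (\<lambda>r. a (Xc r w))"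
      using st elim(4) by (intro Henstock_Kurzweil_Integration.integral_combine integrable_continuous_real aXc_continuous) auto
    then have I: "integral {0..t} (\<lambda>r. a (Xc r w)) = integral {0..s} (\<lambda>r. a (Xc r w)) + integral {s..t} (\<lambda>r. a (Xc r w))" ..
    have "X t w - X s w = Xc t w - Xc s w" using elim(3) st by auto
    also have "\<dots> = integral {s..t} (\<lambda>r. a (Xc r w)) + ((\<Sum>\<alpha>\<in>UNIV. J \<alpha> t w) - (\<Sum>\<alpha>\<in>UNIV. J \<alpha> s w))"
      unfolding elim(1,2) aXc_integral(2)[OF elim(4)] I by (simp only: algebra_simps)
    finally show ?case unfolding aXc_integral(2)[OF elim(4)] sum_subtractf .
  qed
qed

text \<open>Uniform in t, since the integral of the mean square of \<open>b \<alpha> (X s)\<close>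
  up to t is at most the one up to T, which is finite for an Ito integrand.\<close>

lemma J_sum_bounded: "\<exists>B\<ge>0. \<forall>t\<in>{0..T}. msq M (\<lambda>w. \<Sum>\<alpha>\<in>UNIV. J \<alpha> t w) \<le> B"
proof -
  define q where "q \<alpha> = (\<integral>\<^sup>+s\<in>{0..T}. mean_sq_dist M (\<lambda>w. b \<alpha> (X s w)) (\<lambda>_. 0) \<partial>lborel)" for \<alpha>
  have q: "q \<alpha> < \<infinity>" for \<alpha>
    using J_ito[of T \<alpha>] T by (simp add: has_ito_integral_def ito_integrand_def q_def)
  have J: "msq M (J \<alpha> t) \<le> 4 * enn2real (q \<alpha>)" if t: "t \<in> {0..T}" for t \<alpha>
  proof -
    have "ennreal (msq M (J \<alpha> t)) = mean_sq_dist M (J \<alpha> t) (\<lambda>w. 0)"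
      using mean_sq_dist_eq_msq[of M "J \<alpha> t" "\<lambda>w. 0"] J_sq_integrable[OF t] by simp
    also have "\<dots> \<le> 4 * (\<integral>\<^sup>+s\<in>{0..t}. mean_sq_dist M (\<lambda>w. b \<alpha> (X s w)) (\<lambda>w. 0) \<partial>lborel)"
      by (rule ito_sq_integrable(2)[OF J_ito[OF t]])
    also have "\<dots> \<le> 4 * q \<alpha>"
      unfolding q_def using t by (intro mult_left_mono nn_integral_mono) (auto simp: indicator_def)
    also have "\<dots> = ennreal (4 * enn2real (q \<alpha>))"
      using q[of \<alpha>] by (simp add: ennreal_mult)
    finally show ?thesis by simp
  qed
  let ?B = "real CARD('d) * (\<Sum>\<alpha>\<in>UNIV. 4 * enn2real (q \<alpha>))"
  have "msq M (\<lambda>w. \<Sum>\<alpha>\<in>UNIV. J \<alpha> t w) \<le> ?B" if t: "t \<in> {0..T}" for t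
  proof -
    have "msq M (\<lambda>w. \<Sum>\<alpha>\<in>UNIV. J \<alpha> t w) \<le> real CARD('d) * (\<Sum>\<alpha>\<in>UNIV. msq M (J \<alpha> t))"
      by (rule msq_sum_le) (rule J_sq_integrable[OF t])
    also have "\<dots> \<le> ?B" by (intro mult_left_mono sum_mono J t) auto
    finally show ?thesis .
  qed
  moreover have "0 \<le> ?B" by (intro mult_nonneg_nonneg sum_nonneg) auto
  ultimately show ?thesis by blast
qed

text \<open>\<open>J \<alpha> 0\<close> is merely a version of an integral over a null set, so
  \<open>X 0\<close> equals \<open>x\<^sub>0\<close> in mean square only. This is the zero starting
  value for the discrete Gronwall inequality.\<close>

lemma X_initial: "msq M (\<lambda>w. x\<^sub>0 - X 0 w) = 0"
proof -
  have 0: "0 \<in> {0..T}" using T by simp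
  have J0: "msq M (J \<alpha> 0) = 0" for \<alpha>
  proof -
    have "ennreal (msq M (J \<alpha> 0)) = mean_sq_dist M (J \<alpha> 0) (\<lambda>w. 0)"
      using mean_sq_dist_eq_msq[of M "J \<alpha> 0" "\<lambda>w. 0"] J_sq_integrable[OF 0] by simp
    also have "\<dots> \<le> 4 * (\<integral>\<^sup>+s\<in>{0..0}. mean_sq_dist M (\<lambda>w. b \<alpha> (X s w)) (\<lambda>w. 0) \<partial>lborel)"
      by (rule ito_sq_integrable(2)[OF J_ito[OF 0]])
    also have "(\<integral>\<^sup>+s\<in>{0..0}. mean_sq_dist M (\<lambda>w. b \<alpha> (X s w)) (\<lambda>w. 0) \<partial>lborel) = (\<integral>\<^sup>+s. 0 \<partial>(lborel::real measure))"
      using AE_lborel_singleton[of "0::real"]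
      by (intro nn_integral_cong_AE) (auto elim!: eventually_mono simp: indicator_def)
    finally show ?thesis using msq_nonneg[of M "J \<alpha> 0"] by (simp add: ennreal_eq_0_iff)
  qed
  have "msq M (\<lambda>w. \<Sum>\<alpha>\<in>UNIV. J \<alpha> 0 w) \<le> real CARD('d) * (\<Sum>\<alpha>\<in>UNIV. msq M (J \<alpha> 0))"
    by (rule msq_sum_le) (rule J_sq_integrable[OF 0])
  then have J: "msq M (\<lambda>w. \<Sum>\<alpha>\<in>UNIV. J \<alpha> 0 w) = 0" using J0 msq_nonneg[of M "\<lambda>w. \<Sum>\<alpha>\<in>UNIV. J \<alpha> 0 w"] by simp
  have "msq M (\<lambda>w. x\<^sub>0 - X 0 w) \<le> msq M (\<lambda>w. \<Sum>\<alpha>\<in>UNIV. J \<alpha> 0 w)"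
  proof (rule sq_integrable_bound(2))
    show "(\<lambda>w. x\<^sub>0 - X 0 w) \<in> borel_measurable M"
      using measurable_F_M[OF X_measurable[OF 0]] by measurable
    show "sq_integrable M (\<lambda>w. \<Sum>\<alpha>\<in>UNIV. J \<alpha> 0 w)" by (intro sq_integrable_sum J_sq_integrable 0)
    show "AE w in M. norm (x\<^sub>0 - X 0 w) \<le> norm (\<Sum>\<alpha>\<in>UNIV. J \<alpha> 0 w)"
      using X_eq[OF 0]
    proof eventually_elim
      case (elim w)
      have "(\<lambda>s. indicator {0..0} s *\<^sub>R a (X s w)) = (\<lambda>s. indicator {0} s *\<^sub>R a (X 0 w))"
        by (auto simp: indicator_def)
      then have "(LINT s:{0..0::real}|lborel. a (X s w)) = 0"
        unfolding set_lebesgue_integral_def by simp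
      then show ?case using elim by (simp add: norm_minus_commute)
    qed
  qed
  then show ?thesis using J msq_nonneg[of M "\<lambda>w. x\<^sub>0 - X 0 w"] by simp
qed

text \<open>
  The notion of solution makes only \<open>b (X)\<close> square integrable, not \<open>X\<close> or \<open>a (X)\<close>.  A pathwise Gronwall
  argument bounds \<open>\<integral> |X| dr\<close> by an integral of \<open>v\<close>, which is square integrable because
  \<open>Xc - I\<close> is \<open>x\<^sub>0\<close> plus the stochastic integrals.
\<close>

lemma X_sq_bounded: "\<exists>C\<ge>0. \<forall>t\<in>{0..T}. X t \<in> L2F t \<and> msq M (X t) \<le> C"
proof -
  obtain B where B: "0 \<le> B" "\<And>t. t \<in> {0..T} \<Longrightarrow> msq M (\<lambda>w. \<Sum>\<alpha>\<in>UNIV. J \<alpha> t w) \<le> B"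
    using J_sum_bounded by auto
  define I where "I t w = (LINT r:{0..t}|lborel. a (Xc r w))" for t w
  \<comment> \<open>\<open>c\<close> dominates the integral of |a 0| in |a x| <= |a 0| + L |x|, so
    that pathwise |Xc| is at most \<open>v\<close> plus L times the integral of |Xc|.\<close>
  define c where "c = norm (a 0) * T"
  define v where "v t w = norm (Xc t w - I t w) + c" for t w
  define V where "V w = (LINT r:{0..T}|lborel. v r w)" for w
  have c0: "0 \<le> c" using T by (simp add: c_def)
  have I_joint: "(\<lambda>(t, w). I t w) \<in> borel_measurable (borel \<Otimes>\<^sub>M M)"
  proof -
    have [measurable]: "(\<lambda>q. a (Xc (snd q) (snd (fst q)))) \<in> borel_measurable ((borel \<Otimes>\<^sub>M M) \<Otimes>\<^sub>M lborel)"
    proof -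
      have "(\<lambda>q. (snd q, snd (fst q))) \<in> (borel \<Otimes>\<^sub>M M) \<Otimes>\<^sub>M lborel \<rightarrow>\<^sub>M borel \<Otimes>\<^sub>M M"
        by measurable
      from measurable_compose[OF this aXc_joint] show ?thesis by simp
    qed
    have "(\<lambda>p. LINT r|lborel. (if 0 \<le> r \<and> r \<le> fst p then a (Xc r (snd p)) else 0)) \<in> borel_measurable (borel \<Otimes>\<^sub>M M)"
      by (rule lborel.borel_measurable_lebesgue_integral) (simp add: case_prod_beta')
    moreover have "(LINT r|lborel. (if 0 \<le> r \<and> r \<le> t then a (Xc r w) else 0)) = I t w" for t w
      unfolding I_def set_lebesgue_integral_def by (intro Bochner_Integration.integral_cong) (auto simp: indicator_def)
    ultimately show ?thesis by (simp add: case_prod_beta)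
  qed
  have v_joint: "(\<lambda>(t, w). v t w) \<in> borel_measurable (borel \<Otimes>\<^sub>M M)"
    using Xc_joint I_joint unfolding v_def case_prod_beta' by measurable
  have v_meas: "v t \<in> borel_measurable M" for t
    using measurable_compose[OF measurable_Pair1' v_joint, of t] by simp
  have V_meas: "V \<in> borel_measurable M"
  proof -
    have [measurable]: "(\<lambda>p. v (snd p) (fst p)) \<in> borel_measurable (M \<Otimes>\<^sub>M lborel)"
    proof -
      have "(\<lambda>p. (snd p, fst p)) \<in> M \<Otimes>\<^sub>M lborel \<rightarrow>\<^sub>M borel \<Otimes>\<^sub>M M" by measurable
      from measurable_compose[OF this v_joint] show ?thesis by simp
    qed
    show ?thesis
      unfolding V_def set_lebesgue_integral_def
      by (rule lborel.borel_measurable_lebesgue_integral) (simp add: case_prod_beta')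
  qed
  define Bv where "Bv = 4 * (norm x\<^sub>0)\<^sup>2 + 2 * c\<^sup>2 + 4 * B"
  have Bv0: "0 \<le> Bv" using B by (simp add: Bv_def)
  have v: "sq_integrable M (v t)" "msq M (v t) \<le> Bv" if t: "t \<in> {0..T}" for t
  proof -
    let ?S = "\<lambda>w. \<Sum>\<alpha>\<in>UNIV. J \<alpha> t w"
    have S: "sq_integrable M ?S" by (intro sq_integrable_sum J_sq_integrable t)
    then have i: "integrable M (\<lambda>w. 4 * (norm x\<^sub>0)\<^sup>2 + 2 * c\<^sup>2 + 4 * (norm (?S w))\<^sup>2)"
      by (simp add: sq_integrable_def)
    have le: "AE w in M. (norm (v t w))\<^sup>2 \<le> 4 * (norm x\<^sub>0)\<^sup>2 + 2 * c\<^sup>2 + 4 * (norm (?S w))\<^sup>2"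
      using Xc_decomposition[OF t]
    proof eventually_elim
      case (elim w)
      have "(norm (v t w))\<^sup>2 \<le> 2 * (norm (x\<^sub>0 + ?S w))\<^sup>2 + 2 * c\<^sup>2"
        using norm_add_sq_le[of "norm (x\<^sub>0 + ?S w)" c] elim by (simp add: v_def I_def algebra_simps)
      also have "\<dots> \<le> 2 * (2 * (norm x\<^sub>0)\<^sup>2 + 2 * (norm (?S w))\<^sup>2) + 2 * c\<^sup>2"
        by (intro add_right_mono mult_left_mono norm_add_sq_le) auto
      finally show ?case by simp
    qed
    show "sq_integrable M (v t)" by (rule sq_integrable_dominated[OF v_meas i le])
    have "msq M (v t) \<le> (LINT w|M. 4 * (norm x\<^sub>0)\<^sup>2 + 2 * c\<^sup>2 + 4 * (norm (?S w))\<^sup>2)"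
      by (rule sq_integrable_dominated[OF v_meas i le])
    also have "\<dots> = 4 * (norm x\<^sub>0)\<^sup>2 + 2 * c\<^sup>2 + 4 * msq M ?S"
      using S by (simp add: sq_integrable_def msq_def prob_space)
    also have "\<dots> \<le> Bv" using B(2)[OF t] by (simp add: Bv_def)
    finally show "msq M (v t) \<le> Bv" .
  qed
  have "mean_sq_dist M (v t) (\<lambda>_. 0) \<le> ennreal Bv" if "t \<in> {0..T}" for t
    using mean_sq_dist_eq_msq[of M "v t" "\<lambda>w. 0"] v[OF that] by (simp add: ennreal_leI)
  from mean_sq_time_integral[OF v_joint _ this Bv0, of 0 T] T
  have "mean_sq_dist M V (\<lambda>_. 0) \<le> ennreal (T\<^sup>2 * Bv)" by (simp add: V_def[abs_def])
  from sq_integrable_mean_sq_bound[OF V_meas this] Bv0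
  have V: "sq_integrable M V" "msq M V \<le> T\<^sup>2 * Bv" by auto
  \<comment> \<open>The constant of \<open>gronwall_integral\<close>, times the L with which the
    integral of |Xc| enters the pathwise inequality.\<close>
  let ?k = "L * exp (L * T)"
  have bound: "norm (Xc t w) \<le> v t w + ?k * V w" if t: "t \<in> {0..T}" and w: "w \<in> space M" for t w
  proof -
    have u: "continuous_on {0..T} (\<lambda>r. norm (Xc r w))"
      by (intro continuous_on_norm continuous_on_subset[OF Xc_continuous[OF w]]) auto
    have I: "I r w = integral {0..r} (\<lambda>r. a (Xc r w))" for r
      unfolding I_def by (rule aXc_integral(2)[OF w])
    have "continuous_on {0..T} (\<lambda>t. I t w)"
      unfolding I by (intro indefinite_integral_continuous_1 integrable_continuous_real aXc_continuous w)
    then have vc: "continuous_on {0..T} (\<lambda>r. v r w)"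
      unfolding v_def by (intro continuous_intros continuous_on_subset[OF Xc_continuous[OF w]]) auto
    have le: "norm (Xc r w) \<le> v r w + L * integral {0..r} (\<lambda>r. norm (Xc r w))" if r: "r \<in> {0..T}" for r
    proof -
      have uc: "continuous_on {0..r} (\<lambda>r. norm (Xc r w))"
        using continuous_on_subset[OF u] r by auto
      have "norm (I r w) \<le> integral {0..r} (\<lambda>r. norm (a 0) + L * norm (Xc r w))"
        unfolding I
      proof (rule integral_norm_bound_integral)
        show "(\<lambda>r. a (Xc r w)) integrable_on {0..r}" by (intro integrable_continuous_real aXc_continuous w)
        show "(\<lambda>r. norm (a 0) + L * norm (Xc r w)) integrable_on {0..r}"
          by (intro integrable_continuous_real continuous_intros uc)
        show "norm (a (Xc s w)) \<le> norm (a 0) + L * norm (Xc s w)" for s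
          using norm_triangle_ineq[of "a 0" "a (Xc s w) - a 0"] a_lip[of "Xc s w" 0] by simp
      qed
      also have "\<dots> = norm (a 0) * r + L * integral {0..r} (\<lambda>r. norm (Xc r w))"
        using r uc by (subst Henstock_Kurzweil_Integration.integral_add)
          (auto intro!: integrable_continuous_real continuous_intros)
      also have "\<dots> \<le> c + L * integral {0..r} (\<lambda>r. norm (Xc r w))"
        using r by (auto simp: c_def intro: mult_left_mono)
      finally have "norm (I r w) \<le> \<dots>" .
      then show ?thesis
        using norm_triangle_ineq[of "Xc r w - I r w" "I r w"] by (simp add: v_def)
    qed
    have "integral {0..t} (\<lambda>r. norm (Xc r w)) \<le> exp (L * T) * integral {0..T} (\<lambda>r. v r w)"
      by (rule gronwall_integral[OF u vc le _ L t]) (use c0 in \<open>auto simp: v_def\<close>)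
    also have "integral {0..T} (\<lambda>r. v r w) = V w"
      unfolding V_def by (rule set_borel_integral_eq_integral(2)[symmetric, OF borel_integrable_atLeastAtMost'[OF vc]])
    finally have "L * integral {0..t} (\<lambda>r. norm (Xc r w)) \<le> L * (exp (L * T) * V w)"
      using L by (rule mult_left_mono)
    then show ?thesis using le[OF t] by (simp add: mult.assoc)
  qed
  let ?C = "2 * Bv + 2 * (?k\<^sup>2 * (T\<^sup>2 * Bv))"
  have "X t \<in> L2F t \<and> msq M (X t) \<le> ?C" if t: "t \<in> {0..T}" for t
  proof -
    have vV: "sq_integrable M (\<lambda>w. v t w + ?k *\<^sub>R V w)"
      by (intro sq_integrable_add sq_integrable_scaleR v t V)
    have le: "AE w in M. norm (X t w) \<le> norm (v t w + ?k *\<^sub>R V w)"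
      using Xc_eq AE_space[of M]
    proof eventually_elim
      case (elim w)
      then have "norm (X t w) = norm (Xc t w)" using t by auto
      also have "\<dots> \<le> \<bar>v t w + ?k * V w\<bar>" using bound[OF t elim(2)] by linarith
      finally show ?case by simp
    qed
    note * = sq_integrable_bound[OF measurable_F_M[OF X_measurable[OF t]] vV le]
    have "msq M (X t) \<le> msq M (\<lambda>w. v t w + ?k *\<^sub>R V w)" by (rule *)
    also have "\<dots> \<le> 2 * msq M (v t) + 2 * msq M (\<lambda>w. ?k *\<^sub>R V w)"
      by (intro msq_add_le sq_integrable_scaleR v t V)
    also have "\<dots> = 2 * msq M (v t) + 2 * (?k\<^sup>2 * msq M V)" by (simp only: msq_scaleR)
    also have "\<dots> \<le> ?C"
      using v(2)[OF t] V(2) by (intro add_mono mult_left_mono) auto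
    finally show ?thesis using *(1) X_measurable[OF t] by (simp add: L2F_def)
  qed
  moreover have "0 \<le> ?C" using Bv0 by simp
  ultimately show ?thesis by blast
qed

text \<open>Used with \<zeta> = 0 for the size of an increment and with \<zeta> = a(X s) for the
  local remainder. The bound is assumed for \<open>X\<close>, while the integral is that of the
  jointly measurable \<open>Xc\<close>, as exchanging the integrals over time and w
  requires.\<close>

lemma drift_integral_bound:
  assumes st: "0 \<le> s" "s \<le> t" "t \<le> T" and \<zeta>: "\<zeta> \<in> borel_measurable M"
    and B: "\<And>r. r \<in> {s..t} \<Longrightarrow> sq_integrable M (\<lambda>w. a (X r w) - \<zeta> w) \<and> msq M (\<lambda>w. a (X r w) - \<zeta> w) \<le> B" "0 \<le> B"
    and D: "D \<in> borel_measurable M" "AE w in M. D w = (LINT r:{s..t}|lborel. a (Xc r w)) - (t - s) *\<^sub>R \<zeta> w"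
  shows "sq_integrable M D" and "msq M D \<le> (t - s)\<^sup>2 * B"
proof -
  let ?g = "\<lambda>r w. a (Xc r w) - \<zeta> w"
  have g: "(\<lambda>(r, w). ?g r w) \<in> borel_measurable (borel \<Otimes>\<^sub>M M)"
    using aXc_joint \<zeta> unfolding case_prod_beta' by measurable
  have gb: "mean_sq_dist M (?g r) (\<lambda>_. 0) \<le> ennreal B" if r: "r \<in> {s..t}" for r
  proof -
    have "mean_sq_dist M (?g r) (\<lambda>_. 0) = mean_sq_dist M (\<lambda>w. a (X r w) - \<zeta> w) (\<lambda>_. 0)"
      unfolding mean_sq_dist_def using Xc_eq r st
      by (intro nn_integral_cong_AE) (auto elim!: eventually_mono)
    also have "\<dots> \<le> ennreal B"
      using B(1)[OF r] mean_sq_dist_eq_msq[of M "\<lambda>w. a (X r w) - \<zeta> w" "\<lambda>_. 0"] by (simp add: ennreal_leI)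
    finally show ?thesis .
  qed
  have "AE w in M. D w = (LINT r:{s..t}|lborel. ?g r w)"
    using D(2) AE_space[of M]
  proof eventually_elim
    case (elim w)
    have "(LINT r:{s..t}|lborel. ?g r w) = (LINT r:{s..t}|lborel. a (Xc r w)) - (LINT r:{s..t}|lborel. \<zeta> w)"
      by (intro set_integral_diff(2) aXc_integral(1) elim borel_integrable_atLeastAtMost' continuous_on_const)
    also have "(LINT r:{s..t}|lborel. \<zeta> w) = (t - s) *\<^sub>R \<zeta> w"
      using st by (subst set_integral_const) auto
    finally show ?case using elim by simp
  qed
  then have "mean_sq_dist M D (\<lambda>_. 0) = mean_sq_dist M (\<lambda>w. LINT r:{s..t}|lborel. ?g r w) (\<lambda>_. 0)"
    unfolding mean_sq_dist_def by (intro nn_integral_cong_AE) (auto elim!: eventually_mono)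
  also have "\<dots> \<le> ennreal ((t - s)\<^sup>2 * B)"
    by (rule mean_sq_time_integral[OF g st(2) gb B(2)])
  finally show "sq_integrable M D" "msq M D \<le> (t - s)\<^sup>2 * B"
    using sq_integrable_mean_sq_bound[OF D(1)] B(2) by auto
qed

lemma J_increment_bound:
  assumes st: "0 \<le> s" "s \<le> t" "t \<le> T" and \<zeta>: "\<zeta> \<in> L2F s"
    and B: "\<And>r. r \<in> {s..t} \<Longrightarrow> sq_integrable M (\<lambda>w. b \<alpha> (X r w) - \<zeta> w) \<and> msq M (\<lambda>w. b \<alpha> (X r w) - \<zeta> w) \<le> B" "0 \<le> B"
  shows "msq M (\<lambda>w. J \<alpha> t w - J \<alpha> s w - (dW s t w $ \<alpha>) *\<^sub>R \<zeta> w) \<le> 8 * (t - s) * B"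
proof -
  have "ennreal (msq M (\<lambda>w. J \<alpha> t w - J \<alpha> s w - (dW s t w $ \<alpha>) *\<^sub>R \<zeta> w))
    \<le> 8 * (\<integral>\<^sup>+r\<in>{s..t}. mean_sq_dist M (\<lambda>w. b \<alpha> (X r w)) \<zeta> \<partial>lborel)"
    using st \<zeta> by (intro ito_increment_bound J_ito) auto
  also have "\<dots> \<le> 8 * (\<integral>\<^sup>+r. ennreal B * indicator {s..t} r \<partial>lborel)"
    using B(1) by (intro mult_left_mono nn_integral_mono) (auto simp: indicator_def mean_sq_dist_eq_msq ennreal_leI)
  also have "\<dots> = ennreal (8 * (t - s) * B)"
  proof -
    have "ennreal (8 * (t - s) * B) = ennreal 8 * ennreal (t - s) * ennreal B"
      using st B(2) by (metis ennreal_mult diff_ge_0_iff_ge mult_nonneg_nonneg zero_le_numeral)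
    then show ?thesis using st by (simp add: nn_integral_cmult ac_simps)
  qed
  finally show ?thesis using st B(2) by simp
qed

text \<open>First round of a bootstrap: with \<zeta> = 0 and uniform second moments of the
  coefficients, the drift contributes O((t - s)^2) and the noise O(t - s). In
  \<open>solution_expansion\<close> the coefficients are centred at their values at time s, and the
  present bound supplies one more factor t - s.\<close>

lemma X_increment_sq_bounded:
  "\<exists>C\<ge>0. \<forall>s t. 0 \<le> s \<longrightarrow> s \<le> t \<longrightarrow> t \<le> T \<longrightarrow> msq M (\<lambda>w. X t w - X s w) \<le> C * (t - s)"
proof -
  obtain C where C: "0 \<le> C" "\<And>t. t \<in> {0..T} \<Longrightarrow> X t \<in> L2F t" "\<And>t. t \<in> {0..T} \<Longrightarrow> msq M (X t) \<le> C"
    using X_sq_bounded by blast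
  define B where "B f = 2 * L\<^sup>2 * C + 2 * (norm (f 0))\<^sup>2" for f :: "real ^ 'n \<Rightarrow> real ^ 'n"
  have B0: "0 \<le> B f" for f using C(1) by (simp add: B_def)
  have B: "sq_integrable M (\<lambda>w. f (X r w))" "msq M (\<lambda>w. f (X r w)) \<le> B f"
    if r: "r \<in> {0..T}" and f: "\<And>x y. norm (f x - f y) \<le> L * norm (x - y)" for r f
  proof -
    show "sq_integrable M (\<lambda>w. f (X r w))" using L2F_lipschitz(1)[OF f C(2)[OF r]] by (rule L2F_sq)
    show "msq M (\<lambda>w. f (X r w)) \<le> B f"
      unfolding B_def using mult_left_mono[OF C(3)[OF r], of "2 * L\<^sup>2"]
      by (intro order_trans[OF L2F_lipschitz(2)[OF f C(2)[OF r]]]) simp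
  qed
  let ?C = "2 * T * B a + 2 * (real CARD('d) * (\<Sum>\<alpha>\<in>UNIV. 8 * B (b \<alpha>)))"
  have "msq M (\<lambda>w. X t w - X s w) \<le> ?C * (t - s)" if st: "0 \<le> s" "s \<le> t" "t \<le> T" for s t
  proof -
    let ?S = "\<lambda>w. \<Sum>\<alpha>\<in>UNIV. J \<alpha> t w - J \<alpha> s w"
    define D where "D w = X t w - X s w - ?S w" for w
    have JJ: "sq_integrable M (\<lambda>w. J \<alpha> t w - J \<alpha> s w)" for \<alpha>
      using st by (intro sq_integrable_diff J_sq_integrable) auto
    have S: "sq_integrable M ?S" by (intro sq_integrable_sum JJ)
    have "sq_integrable M D" unfolding D_def
      using st by (intro sq_integrable_diff S L2F_sq[OF C(2)]) auto
    then have Dm: "D \<in> borel_measurable M" by (rule sq_integrable_measurable)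
    have "AE w in M. D w = (LINT r:{s..t}|lborel. a (Xc r w)) - (t - s) *\<^sub>R 0"
      using X_increment[OF st] by eventually_elim (simp add: D_def)
    note * = drift_integral_bound[OF st _ _ B0[of a] Dm this]
    have D: "sq_integrable M D" "msq M D \<le> (t - s)\<^sup>2 * B a"
      using B[OF _ a_lip] st by (auto intro!: *)
    have "msq M ?S \<le> real CARD('d) * (\<Sum>\<alpha>\<in>UNIV. msq M (\<lambda>w. J \<alpha> t w - J \<alpha> s w))"
      by (intro msq_sum_le JJ)
    also have "\<dots> \<le> real CARD('d) * (\<Sum>\<alpha>\<in>UNIV. 8 * (t - s) * B (b \<alpha>))"
      using J_increment_bound[OF st L2F_zero _ B0] B[OF _ b_lip] st by (intro mult_left_mono sum_mono) auto
    also have "\<dots> = (t - s) * (real CARD('d) * (\<Sum>\<alpha>\<in>UNIV. 8 * B (b \<alpha>)))"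
      by (simp add: sum_distrib_left ac_simps del: right_diff_distrib_numeral left_diff_distrib_numeral)
    finally have Sb: "msq M ?S \<le> \<dots>" .
    have "(t - s)\<^sup>2 * B a \<le> ((t - s) * T) * B a"
      unfolding power2_eq_square using st B0 by (intro mult_right_mono mult_left_mono) auto
    moreover have "msq M (\<lambda>w. X t w - X s w) \<le> 2 * msq M D + 2 * msq M ?S"
      using msq_add_le[OF D(1) S] by (simp add: D_def)
    ultimately show ?thesis using D(2) Sb by (simp add: algebra_simps)
  qed
  moreover have "0 \<le> ?C" using B0 T by (intro add_nonneg_nonneg mult_nonneg_nonneg sum_nonneg) auto
  ultimately show ?thesis by blast
qed

text \<open>
  The witness \<open>A\<close> will be the integral of \<open>a (X r) - a (X s)\<close> and \<open>V\<close> the stochastic integral of \<open>b (X r) - b (X s)\<close>.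
\<close>

definition solution_remainder :: "real \<Rightarrow> real \<Rightarrow> real \<Rightarrow> ('w \<Rightarrow> real ^ 'n) \<Rightarrow> ('w \<Rightarrow> real ^ 'n) \<Rightarrow> bool" where
  "solution_remainder C s t A V \<longleftrightarrow> sq_integrable M A \<and> sq_integrable M V \<and>
    (\<forall>w. X t w = X s w + (t - s) *\<^sub>R a (X s w) + noise s t (\<lambda>\<alpha> w. b \<alpha> (X s w)) w + A w + V w) \<and>
    msq M A \<le> C * (t - s) ^ 3 \<and> msq M V \<le> C * (t - s)\<^sup>2 \<and> (\<forall>Z\<in>L2F s. ip Z V = 0)"

text \<open>The increment bound and the Lipschitz condition give mean square O(h) for a(X r) - a(X
  s) and b(X r) - b(X s), where h = t - s. Integrating in time multiplies this by h^2, integrating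
  against Brownian motion by a constant times h.\<close>

lemma solution_expansion:
  "\<exists>C\<ge>0. \<forall>s t. 0 \<le> s \<longrightarrow> s \<le> t \<longrightarrow> t \<le> T \<longrightarrow> (\<exists>A V. solution_remainder C s t A V)"
proof -
  obtain C0 where C0: "\<And>t. t \<in> {0..T} \<Longrightarrow> X t \<in> L2F t"
    using X_sq_bounded by blast
  obtain C where C: "0 \<le> C" "\<And>s t. 0 \<le> s \<Longrightarrow> s \<le> t \<Longrightarrow> t \<le> T \<Longrightarrow> msq M (\<lambda>w. X t w - X s w) \<le> C * (t - s)"
    using X_increment_sq_bounded by blast
  let ?C = "L\<^sup>2 * C + real CARD('d) * (real CARD('d) * (8 * (L\<^sup>2 * C)))"
  have LC: "0 \<le> L\<^sup>2 * C" using C(1) by simp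
  have "\<exists>A V. solution_remainder ?C s t A V"
    if st: "0 \<le> s" "s \<le> t" "t \<le> T" for s t
  proof -
    have sT: "s \<in> {0..T}" "t \<in> {0..T}" using st by auto
    have Xs: "X s \<in> L2F s" by (rule C0[OF sT(1)])
    have lip: "sq_integrable M (\<lambda>w. f (X r w) - f (X s w)) \<and> msq M (\<lambda>w. f (X r w) - f (X s w)) \<le> L\<^sup>2 * C * (t - s)"
      if f: "\<And>x y. norm (f x - f y) \<le> L * norm (x - y)" and r: "r \<in> {s..t}" for f :: "real^'n \<Rightarrow> real^'n" and r
    proof -
      have X: "X r \<in> L2F r" "X s \<in> L2F r" using C0[of r] L2F_mono[OF Xs, of r] r st by auto
      have "msq M (\<lambda>w. f (X r w) - f (X s w)) \<le> L\<^sup>2 * msq M (\<lambda>w. X r w - X s w)"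
        by (rule msq_lipschitz_diff[OF f L X])
      also have "\<dots> \<le> L\<^sup>2 * (C * (t - s))"
        using C(2)[of s r] mult_left_mono[of "r - s" "t - s" C] C(1) r st by (intro mult_left_mono) auto
      finally show ?thesis
        using L2F_diff[OF L2F_lipschitz(1)[OF f X(1)] L2F_lipschitz(1)[OF f X(2)]]
        by (simp add: L2F_sq mult.assoc)
    qed
    have bXs: "(\<lambda>w. b \<alpha> (X s w)) \<in> L2F s" for \<alpha> by (rule L2F_lipschitz(1)[OF b_lip Xs])
    have aXs: "sq_integrable M (\<lambda>w. a (X s w))"
      using L2F_lipschitz(1)[OF a_lip Xs] by (rule L2F_sq)
    let ?V = "\<lambda>\<alpha> w. J \<alpha> t w - J \<alpha> s w - (dW s t w $ \<alpha>) *\<^sub>R b \<alpha> (X s w)"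
    have JJ: "sq_integrable M (\<lambda>w. J \<alpha> t w - J \<alpha> s w)" for \<alpha>
      by (intro sq_integrable_diff J_sq_integrable sT)
    have dWb: "sq_integrable M (\<lambda>w. (dW s t w $ \<alpha>) *\<^sub>R b \<alpha> (X s w))" for \<alpha>
      using L2F_dW[OF bXs st(1,2)] by (rule L2F_sq)
    have V\<alpha>: "sq_integrable M (?V \<alpha>)" for \<alpha> by (intro sq_integrable_diff[OF JJ dWb])
    define V where "V w = (\<Sum>\<alpha>\<in>UNIV. ?V \<alpha> w)" for w
    \<comment> \<open>\<open>A\<close> is defined as a difference, so the expansion holds for every
      w; that it equals the centred drift integral is known almost surely, which is enough for the
      bound.\<close>
    define A where "A w = X t w - X s w - (t - s) *\<^sub>R a (X s w) - (\<Sum>\<alpha>\<in>UNIV. J \<alpha> t w - J \<alpha> s w)" for w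
    have V: "sq_integrable M V" unfolding V_def by (intro sq_integrable_sum V\<alpha>)
    have "sq_integrable M A" unfolding A_def
      by (intro sq_integrable_diff sq_integrable_scaleR sq_integrable_sum J_sq_integrable sT aXs L2F_sq[OF C0])
    then have Am: "A \<in> borel_measurable M" by (rule sq_integrable_measurable)
    have "AE w in M. A w = (LINT r:{s..t}|lborel. a (Xc r w)) - (t - s) *\<^sub>R a (X s w)"
      using X_increment[OF st] by eventually_elim (simp add: A_def)
    from drift_integral_bound[OF st sq_integrable_measurable[OF aXs] lip[OF a_lip] _ Am this]
    have A: "sq_integrable M A" "msq M A \<le> (t - s)\<^sup>2 * (L\<^sup>2 * C * (t - s))" using C(1) st by auto
    have "(t - s)\<^sup>2 * (L\<^sup>2 * C * (t - s)) = L\<^sup>2 * C * (t - s) ^ 3"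
      by (simp add: power2_eq_square power3_eq_cube)
    also have "\<dots> \<le> ?C * (t - s) ^ 3" using LC st by (intro mult_right_mono) auto
    finally have A2: "msq M A \<le> ?C * (t - s) ^ 3" using A(2) by simp
    have "msq M V \<le> real CARD('d) * (\<Sum>\<alpha>\<in>UNIV. msq M (?V \<alpha>))"
      unfolding V_def by (intro msq_sum_le V\<alpha>)
    also have "\<dots> \<le> real CARD('d) * (\<Sum>\<alpha>\<in>(UNIV::'d set). 8 * (t - s) * (L\<^sup>2 * C * (t - s)))"
      using st C(1) by (intro mult_left_mono sum_mono J_increment_bound bXs lip b_lip) auto
    also have "\<dots> = real CARD('d) * (real CARD('d) * (8 * (L\<^sup>2 * C))) * (t - s)\<^sup>2"
      by (simp add: power2_eq_square)
    also have "\<dots> \<le> ?C * (t - s)\<^sup>2" using LC by (intro mult_right_mono) auto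
    finally have V2: "msq M V \<le> ?C * (t - s)\<^sup>2" .
    have "ip Z V = 0" if Z: "Z \<in> L2F s" for Z
    proof -
      have "ip Z (?V \<alpha>) = 0" for \<alpha>
        using ito_increment_orthogonal[OF J_ito[OF sT(1)] J_ito[OF sT(2)] st(1,2) Z]
          ip_dW[OF bXs Z st(1,2)] ip_diff_right[OF JJ dWb L2F_sq[OF Z]] by simp
      then show ?thesis
        unfolding V_def using ip_sum_right[OF L2F_sq[OF Z] V\<alpha>] by simp
    qed
    moreover have "X t w = X s w + (t - s) *\<^sub>R a (X s w) + noise s t (\<lambda>\<alpha> w. b \<alpha> (X s w)) w + A w + V w" for w
      by (simp add: A_def V_def noise_def sum_subtractf sum.distrib algebra_simps)
    ultimately show ?thesis unfolding solution_remainder_def using A(1) V A2 V2 by blast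
  qed
  moreover have "0 \<le> ?C" using LC by simp
  ultimately show ?thesis by blast
qed

end

section \<open>Taylor expansion of the family\<close>

text \<open>Smoothness is assumed jointly in (x, u), Taylor's formula is used for fixed x. The
  derivative of a slice in direction v is that of \<open>G\<close> in direction (0, v), again a
  slice, so the induction has to range over all \<open>G\<close>.\<close>

lemma times_cont_diff_slice:
  fixes G :: "'a::euclidean_space \<times> 'b::euclidean_space \<Rightarrow> 'c::real_normed_vector"
  assumes "times_cont_diff k G"
  shows "times_cont_diff k (\<lambda>u. G (x, u))"
  using assms
proof (induction k arbitrary: G)
  case 0
  then show ?case
    by (auto intro!: continuous_on_compose2[of UNIV G] continuous_intros)
next
  case (Suc k)
  have der: "((\<lambda>u. G (x, u)) has_derivative (\<lambda>v. frechet_derivative G (at (x, u)) (0, v))) (at u)" for u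
  proof -
    have "(G has_derivative frechet_derivative G (at (x, u))) (at (x, u))"
      using Suc.prems by (simp add: frechet_derivative_works)
    moreover have "((\<lambda>u. (x, u)) has_derivative (\<lambda>v. (0, v))) (at u)"
      by (intro has_derivative_Pair has_derivative_const has_derivative_ident)
    ultimately show ?thesis
      using has_derivative_compose[of "\<lambda>u. (x, u)" "\<lambda>v. (0, v)" u UNIV G] by simp
  qed
  have eq: "frechet_derivative (\<lambda>u. G (x, u)) (at u) = (\<lambda>v. frechet_derivative G (at (x, u)) (0, v))" for u
    using frechet_derivative_at[OF der] by simp
  have "(\<lambda>u. G (x, u)) differentiable at u" for u using der by (auto simp: differentiable_def)
  moreover have "times_cont_diff k (\<lambda>u. frechet_derivative G (at (x, u)) (0, v))" for v
    using Suc.IH[of "\<lambda>p. frechet_derivative G (at p) (0, v)"] Suc.prems by simp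
  ultimately show ?case by (simp add: eq)
qed

lemma partial_deriv_eq_frechet:
  assumes "f differentiable at u"
  shows "partial_deriv \<alpha> f u = frechet_derivative f (at u) (axis \<alpha> 1)"
proof -
  have "(f has_derivative frechet_derivative f (at u)) (at u)"
    using assms by (simp add: frechet_derivative_works)
  then have "(f has_derivative frechet_derivative f (at u)) (at (u + 0 *\<^sub>R axis \<alpha> 1))" by simp
  moreover have "((\<lambda>h. u + h *\<^sub>R axis \<alpha> 1) has_derivative (\<lambda>h. h *\<^sub>R axis \<alpha> (1::real))) (at 0)"
    by (auto intro!: derivative_eq_intros)
  ultimately have "((\<lambda>h. f (u + h *\<^sub>R axis \<alpha> 1)) has_derivative (\<lambda>h. frechet_derivative f (at u) (h *\<^sub>R axis \<alpha> 1))) (at 0)"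
    using has_derivative_compose[of "\<lambda>h. u + h *\<^sub>R axis \<alpha> 1" _ 0 UNIV f] by simp
  then have "((\<lambda>h. f (u + h *\<^sub>R axis \<alpha> 1)) has_vector_derivative frechet_derivative f (at u) (axis \<alpha> 1)) (at 0)"
    using linear_cmul[OF linear_frechet_derivative[OF assms]] by (simp add: has_vector_derivative_def)
  then show ?thesis unfolding partial_deriv_def by (rule vector_derivative_at)
qed

lemma times_cont_diff_partial_deriv:
  assumes "times_cont_diff (Suc k) f"
  shows "times_cont_diff k (partial_deriv \<alpha> f)"
proof -
  have "partial_deriv \<alpha> f = (\<lambda>u. frechet_derivative f (at u) (axis \<alpha> 1))"
    using assms by (auto simp: partial_deriv_eq_frechet)
  then show ?thesis using assms by simp
qed

lemma has_vector_derivative_ray: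
  fixes f :: "real ^ 'd::finite \<Rightarrow> 'b::real_normed_vector"
  assumes "times_cont_diff (Suc k) f"
  shows "((\<lambda>h. f (h *\<^sub>R u)) has_vector_derivative (\<Sum>\<alpha>\<in>UNIV. (u $ \<alpha>) *\<^sub>R partial_deriv \<alpha> f (h *\<^sub>R u))) (at h)"
proof -
  have diff: "f differentiable at (h *\<^sub>R u)" using assms by simp
  let ?f = "frechet_derivative f (at (h *\<^sub>R u))"
  note lin = linear_frechet_derivative[OF diff]
  have f: "(f has_derivative ?f) (at (h *\<^sub>R u))" using diff by (simp add: frechet_derivative_works)
  have "((\<lambda>h. h *\<^sub>R u) has_derivative (\<lambda>h. h *\<^sub>R u)) (at h)"
    by (auto intro!: derivative_eq_intros)
  from has_derivative_compose[OF this f]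
  have "((\<lambda>h. f (h *\<^sub>R u)) has_derivative (\<lambda>h. ?f (h *\<^sub>R u))) (at h)" .
  then have "((\<lambda>h. f (h *\<^sub>R u)) has_vector_derivative ?f u) (at h)"
    using linear_cmul[OF lin] by (simp add: has_vector_derivative_def)
  moreover have "?f u = (\<Sum>\<alpha>\<in>UNIV. (u $ \<alpha>) *\<^sub>R partial_deriv \<alpha> f (h *\<^sub>R u))"
  proof -
    have "u = (\<Sum>\<alpha>\<in>UNIV. (u $ \<alpha>) *\<^sub>R axis \<alpha> 1)"
      using basis_expansion[of u] by (simp add: scalar_mult_eq_scaleR)
    then have "?f u = ?f (\<Sum>\<alpha>\<in>UNIV. (u $ \<alpha>) *\<^sub>R axis \<alpha> 1)" by simp
    also have "\<dots> = (\<Sum>\<alpha>\<in>UNIV. (u $ \<alpha>) *\<^sub>R ?f (axis \<alpha> 1))"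
      by (simp add: linear_sum[OF lin] linear_cmul[OF lin])
    finally show ?thesis by (simp add: partial_deriv_eq_frechet[OF diff])
  qed
  ultimately show ?thesis by simp
qed

text \<open>The intermediate point of the one-dimensional formula lies anywhere on the segment from
  0 to u, hence the bound on third derivatives away from 0. The triple sum of |u| products
  factorises into a cube; the factor 1/6 is given away.\<close>

lemma taylor_remainder_bound:
  fixes f :: "real ^ 'd::finite \<Rightarrow> 'b::real_inner"
  assumes f: "times_cont_diff 3 f"
    and K: "\<And>u \<alpha> \<beta> \<kappa>. norm (partial_deriv \<alpha> (partial_deriv \<beta> (partial_deriv \<kappa> f)) u) \<le> K"
  shows "norm (f u - (f 0 + (\<Sum>\<beta>\<in>UNIV. (u $ \<beta>) *\<^sub>R partial_deriv \<beta> f 0) +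
      (1/2) *\<^sub>R (\<Sum>\<beta>\<in>UNIV. \<Sum>\<alpha>\<in>UNIV. (u $ \<beta> * u $ \<alpha>) *\<^sub>R partial_deriv \<alpha> (partial_deriv \<beta> f) 0)))
    \<le> K * (\<Sum>\<alpha>\<in>UNIV. \<bar>u $ \<alpha>\<bar>) ^ 3"
proof -
  define g0 where "g0 h = f (h *\<^sub>R u)" for h
  define g1 where "g1 h = (\<Sum>\<beta>\<in>UNIV. (u $ \<beta>) *\<^sub>R partial_deriv \<beta> f (h *\<^sub>R u))" for h
  define g2 where "g2 h = (\<Sum>\<beta>\<in>UNIV. \<Sum>\<alpha>\<in>UNIV. (u $ \<beta> * u $ \<alpha>) *\<^sub>R partial_deriv \<alpha> (partial_deriv \<beta> f) (h *\<^sub>R u))" for h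
  define g3 where "g3 h = (\<Sum>\<beta>\<in>UNIV. \<Sum>\<alpha>\<in>UNIV. \<Sum>\<kappa>\<in>UNIV. (u $ \<beta> * u $ \<alpha> * u $ \<kappa>) *\<^sub>R
    partial_deriv \<kappa> (partial_deriv \<alpha> (partial_deriv \<beta> f)) (h *\<^sub>R u))" for h
  have f3: "times_cont_diff (Suc (Suc (Suc 0))) f" using f by (simp only: numeral_3_eq_3)
  note f2 = times_cont_diff_partial_deriv[OF f3]
  note f1 = times_cont_diff_partial_deriv[OF f2]
  have d0: "(g0 has_vector_derivative g1 h) (at h)" for h
    unfolding g0_def g1_def by (rule has_vector_derivative_ray[OF f3])
  have d1: "(g1 has_vector_derivative g2 h) (at h)" for h
  proof -
    have "(g1 has_vector_derivative (\<Sum>\<beta>\<in>UNIV. (u $ \<beta>) *\<^sub>R (\<Sum>\<alpha>\<in>UNIV. (u $ \<alpha>) *\<^sub>R partial_deriv \<alpha> (partial_deriv \<beta> f) (h *\<^sub>R u)))) (at h)"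
      unfolding g1_def
      by (intro has_vector_derivative_sum bounded_linear.has_vector_derivative[OF bounded_linear_scaleR_right] has_vector_derivative_ray[OF f2])
    then show ?thesis by (simp add: g2_def scaleR_sum_right)
  qed
  have d2: "(g2 has_vector_derivative g3 h) (at h)" for h
  proof -
    have "(g2 has_vector_derivative (\<Sum>\<beta>\<in>UNIV. \<Sum>\<alpha>\<in>UNIV. (u $ \<beta> * u $ \<alpha>) *\<^sub>R
        (\<Sum>\<kappa>\<in>UNIV. (u $ \<kappa>) *\<^sub>R partial_deriv \<kappa> (partial_deriv \<alpha> (partial_deriv \<beta> f)) (h *\<^sub>R u)))) (at h)"
      unfolding g2_def
      by (intro has_vector_derivative_sum bounded_linear.has_vector_derivative[OF bounded_linear_scaleR_right] has_vector_derivative_ray[OF f1])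
    then show ?thesis by (simp add: g3_def scaleR_sum_right)
  qed
  have inner: "((\<lambda>h. g h \<bullet> r) has_real_derivative g' \<bullet> r) (at h)"
    if "(g has_vector_derivative g') (at h)" for g :: "real \<Rightarrow> 'b" and g' r h
    using bounded_linear.has_vector_derivative[OF bounded_linear_inner_left that]
    by (simp add: has_real_derivative_iff_has_vector_derivative)
  txt \<open>The scalar Taylor formula is applied to the component of \<open>f\<close> in the direction of its own remainder.\<close>
  define r where "r = g0 1 - (g0 0 + g1 0 + (1/2) *\<^sub>R g2 0)"
  define D where "D m = (\<lambda>h. (if m = 0 then g0 h else if m = 1 then g1 h else if m = 2 then g2 h else g3 h) \<bullet> r)" for m :: nat
  have "\<exists>t::real. 0 < t \<and> t < 1 \<and>
      g0 1 \<bullet> r = (\<Sum>m<3. D m 0 / fact m * 1 ^ m) + D 3 t / fact 3 * 1 ^ 3"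
  proof (rule Maclaurin)
    show "D 0 = (\<lambda>h. g0 h \<bullet> r)" by (simp add: D_def)
    show "\<forall>m t. m < 3 \<and> 0 \<le> t \<and> t \<le> (1::real) \<longrightarrow> (D m has_real_derivative D (Suc m) t) (at t)"
    proof (intro allI impI)
      fix m :: nat and t :: real assume "m < 3 \<and> 0 \<le> t \<and> t \<le> 1"
      then consider "m = 0" | "m = 1" | "m = 2" by linarith
      then show "(D m has_real_derivative D (Suc m) t) (at t)"
        by cases (simp_all add: D_def inner d0 d1 d2)
    qed
  qed auto
  then obtain t where t: "g0 1 \<bullet> r = (\<Sum>m<3. D m 0 / fact m * 1 ^ m) + D 3 t / fact 3 * 1 ^ 3" by blast
  have "g0 1 \<bullet> r = g0 0 \<bullet> r + g1 0 \<bullet> r + (g2 0 \<bullet> r) / 2 + (g3 t \<bullet> r) / 6"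
    using t by (simp add: D_def eval_nat_numeral)
  \<comment> \<open>One of the two occurrences of \<open>r\<close> is unfolded, and the Taylor
    polynomial cancels.\<close>
  then have "r \<bullet> r = (g3 t \<bullet> r) / 6"
    by (subst (1) r_def) (simp add: inner_diff_left inner_add_left)
  also have "\<dots> \<le> norm (g3 t) * norm r"
    using norm_cauchy_schwarz[of "g3 t" r] mult_nonneg_nonneg[OF norm_ge_zero[of "g3 t"] norm_ge_zero[of r]] by linarith
  finally have "norm r * norm r \<le> norm (g3 t) * norm r"
    by (simp add: power2_norm_eq_inner[symmetric] power2_eq_square)
  then have r: "norm r \<le> norm (g3 t)" by (cases "norm r = 0") auto
  have "norm (g3 t) \<le> (\<Sum>\<beta>\<in>UNIV. \<Sum>\<alpha>\<in>UNIV. \<Sum>\<kappa>\<in>UNIV. norm ((u $ \<beta> * u $ \<alpha> * u $ \<kappa>) *\<^sub>R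
    partial_deriv \<kappa> (partial_deriv \<alpha> (partial_deriv \<beta> f)) (t *\<^sub>R u)))"
    unfolding g3_def by (intro sum_norm_le order_refl norm_sum)
  also have "\<dots> \<le> (\<Sum>\<beta>\<in>UNIV. \<Sum>\<alpha>\<in>UNIV. \<Sum>\<kappa>\<in>UNIV. (\<bar>u $ \<beta>\<bar> * \<bar>u $ \<alpha>\<bar> * \<bar>u $ \<kappa>\<bar>) * K)"
    by (intro sum_mono) (simp add: abs_mult mult_left_mono K)
  also have "\<dots> = K * (\<Sum>\<alpha>\<in>UNIV. \<bar>u $ \<alpha>\<bar>) ^ 3"
    by (simp add: power3_eq_cube sum_distrib_left sum_distrib_right mult.assoc) (simp add: ac_simps)
  finally have "norm r \<le> K * (\<Sum>\<alpha>\<in>UNIV. \<bar>u $ \<alpha>\<bar>) ^ 3" using r by simp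
  then show ?thesis by (simp add: r_def g0_def g1_def g2_def)
qed

text \<open>For step length \<delta> it is applied with c of order \<delta>, d of order \<delta>^2
  and n \<delta> at most T, so the bound is O(\<delta>) with a constant independent of n.\<close>

lemma discrete_gronwall:
  fixes e :: "nat \<Rightarrow> real"
  assumes "e 0 = 0" and step: "\<And>k. k < n \<Longrightarrow> e (Suc k) \<le> (1 + c) * e k + d" and "0 \<le> c" "0 \<le> d"
  shows "e n \<le> d * real n * exp (c * real n)"
proof -
  have "e k \<le> d * real k * exp (c * real k)" if "k \<le> n" for k
    using that
  proof (induction k)
    case 0
    then show ?case using assms by simp
  next
    case (Suc k)
    let ?x = "exp (c * real k)"
    have "e (Suc k) \<le> (1 + c) * e k + d" using step Suc by simp
    also have "\<dots> \<le> (1 + c) * (d * real k * ?x) + d * 1"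
      using Suc assms by (intro add_mono mult_left_mono) auto
    also have "\<dots> \<le> exp c * (d * real k * ?x) + d * (exp c * ?x)"
      using assms exp_ge_add_one_self[of c]
      by (intro add_mono mult_right_mono mult_left_mono) (auto simp flip: exp_add)
    also have "\<dots> = d * real (Suc k) * exp (c * real (Suc k))"
      by (simp add: algebra_simps exp_add)
    finally show ?case .
  qed
  then show ?thesis by simp
qed

section \<open>The family as a source of Lipschitz coefficients\<close>

locale jet_family =
  fixes \<gamma> :: "real ^ 'n::finite \<Rightarrow> real ^ 'd::finite \<Rightarrow> real ^ 'n" and K :: real
  assumes K: "0 < K" and admissible: "admissible_family \<gamma> K"
begin

abbreviation hess :: "'d \<Rightarrow> 'd \<Rightarrow> real ^ 'n \<Rightarrow> real ^ 'n" where
  "hess \<alpha> \<beta> x \<equiv> partial_deriv \<alpha> (partial_deriv \<beta> (\<gamma> x)) 0"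

text \<open>One constant for drift and diffusion, as \<open>ito_sde\<close> expects; the factor is
  the number of second derivatives summed in the drift.\<close>

definition Lip :: real where
  "Lip = K * real CARD('d)"

lemma Lip_ge: "K \<le> Lip" "0 \<le> Lip"
proof -
  have "1 \<le> real CARD('d)" by (simp add: Suc_leI)
  then show "K \<le> Lip" using K mult_left_mono[of 1 "real CARD('d)" K] by (simp add: Lip_def)
  then show "0 \<le> Lip" using K by simp
qed

lemma hess_lipschitz: "norm (hess \<alpha> \<beta> x - hess \<alpha> \<beta> y) \<le> K * norm (x - y)"
  using admissible by (simp add: admissible_family_def)

lemma diffusion_lipschitz: "norm (jet_diffusion \<gamma> \<alpha> x - jet_diffusion \<gamma> \<alpha> y) \<le> Lip * norm (x - y)"
proof -
  have "norm (jet_diffusion \<gamma> \<alpha> x - jet_diffusion \<gamma> \<alpha> y) \<le> K * norm (x - y)"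
    using admissible by (simp add: admissible_family_def jet_diffusion_def)
  also have "\<dots> \<le> Lip * norm (x - y)" by (intro mult_right_mono Lip_ge) auto
  finally show ?thesis .
qed

lemma drift_lipschitz: "norm (jet_drift \<gamma> x - jet_drift \<gamma> y) \<le> Lip * norm (x - y)"
proof -
  have "jet_drift \<gamma> x - jet_drift \<gamma> y = (1 / 2) *\<^sub>R (\<Sum>\<alpha>\<in>UNIV. hess \<alpha> \<alpha> x - hess \<alpha> \<alpha> y)"
    by (simp add: jet_drift_def sum_subtractf scaleR_diff_right)
  then have "norm (jet_drift \<gamma> x - jet_drift \<gamma> y) \<le> (1 / 2) * (\<Sum>\<alpha>\<in>UNIV. norm (hess \<alpha> \<alpha> x - hess \<alpha> \<alpha> y))"
    by (simp add: norm_sum)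
  also have "\<dots> \<le> 1 * (\<Sum>\<alpha>\<in>(UNIV::'d set). K * norm (x - y))"
    by (intro mult_mono sum_mono hess_lipschitz sum_nonneg) auto
  finally show ?thesis by (simp add: Lip_def ac_simps)
qed

lemma gamma_continuous: "continuous_on UNIV (\<lambda>p. \<gamma> (fst p) (snd p))"
proof -
  have "times_cont_diff 0 (\<lambda>(x, u). \<gamma> x u)"
    using admissible unfolding admissible_family_def smooth_def by blast
  then show ?thesis by (simp add: case_prod_beta')
qed

lemma gamma_measurable:
  assumes "Y \<in> borel_measurable N" "U \<in> borel_measurable N"
  shows "(\<lambda>w. \<gamma> (Y w) (U w)) \<in> borel_measurable N"
proof -
  have "(\<lambda>p. \<gamma> (fst p) (snd p)) \<in> borel_measurable borel"
    by (rule borel_measurable_continuous_onI[OF gamma_continuous])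
  from measurable_compose[OF borel_measurable_Pair[OF assms] this] show ?thesis by simp
qed

lemma gamma_zero: "\<gamma> x 0 = x"
  using admissible by (simp add: admissible_family_def)

lemma gamma_taylor:
  "norm (\<gamma> x u - (x + (\<Sum>\<alpha>\<in>UNIV. (u $ \<alpha>) *\<^sub>R jet_diffusion \<gamma> \<alpha> x) +
      (1/2) *\<^sub>R (\<Sum>\<beta>\<in>UNIV. \<Sum>\<alpha>\<in>UNIV. (u $ \<beta> * u $ \<alpha>) *\<^sub>R hess \<alpha> \<beta> x)))
    \<le> K * (\<Sum>\<alpha>\<in>UNIV. \<bar>u $ \<alpha>\<bar>) ^ 3"
proof -
  have "times_cont_diff 3 (\<lambda>(x, u). \<gamma> x u)"
    using admissible unfolding admissible_family_def smooth_def by blast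
  from times_cont_diff_slice[OF this, of x] have f: "times_cont_diff 3 (\<gamma> x)" by simp
  have "norm (partial_deriv \<alpha> (partial_deriv \<beta> (partial_deriv \<kappa> (\<gamma> x))) u) \<le> K" for u \<alpha> \<beta> \<kappa>
    using admissible by (simp add: admissible_family_def)
  from taylor_remainder_bound[OF f this, of u] show ?thesis
    by (simp add: gamma_zero jet_diffusion_def)
qed

end

section \<open>Error of the scheme\<close>

locale jet_sde = brownian M F W + jet_family \<gamma> K
  for M :: "'w measure" and F and W :: "real \<Rightarrow> 'w \<Rightarrow> real ^ 'd::finite"
    and \<gamma> :: "real ^ 'n::finite \<Rightarrow> real ^ 'd \<Rightarrow> real ^ 'n" and K +
  fixes T :: real and x\<^sub>0 :: "real ^ 'n" and X :: "real \<Rightarrow> 'w \<Rightarrow> real ^ 'n"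
  assumes T_pos: "0 < T"
    and jet_solution: "ito_solution M F W T (jet_drift \<gamma>) (jet_diffusion \<gamma>) x\<^sub>0 X"

sublocale jet_sde \<subseteq> ito_sde M F W "jet_drift \<gamma>" "jet_diffusion \<gamma>" T x\<^sub>0 X Lip
  by unfold_locales (rule T_pos Lip_ge drift_lipschitz diffusion_lipschitz jet_solution)+

context jet_sde
begin

section \<open>Local expansion of the scheme\<close>

lemma L2F_hess:
  assumes Y: "Y \<in> L2F s"
  shows "(\<lambda>w. hess \<alpha> \<beta> (Y w)) \<in> L2F s"
  by (rule L2F_lipschitz(1)[where L = K, OF _ Y]) (rule hess_lipschitz)

text \<open>
  The witness \<open>Q\<close> will be half the sum of the second derivatives times \<open>dW\<^sub>\<alpha> dW\<^sub>\<beta> - \<delta>\<^sub>\<alpha>\<^sub>\<beta> (t - s)\<close>.  The factor \<open>\<theta>\<close>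
  covers the times between two grid points.
\<close>

definition jet_remainder ::
    "real \<Rightarrow> real \<Rightarrow> real \<Rightarrow> real \<Rightarrow> ('w \<Rightarrow> real ^ 'n) \<Rightarrow> ('w \<Rightarrow> real ^ 'n) \<Rightarrow> ('w \<Rightarrow> real ^ 'n) \<Rightarrow> bool" where
  "jet_remainder C \<theta> s t Y R Q \<longleftrightarrow> sq_integrable M R \<and> sq_integrable M Q \<and>
    (\<forall>w. \<gamma> (Y w) (\<theta> *\<^sub>R dW s t w) = Y w + \<theta> *\<^sub>R noise s t (\<lambda>\<alpha> w. jet_diffusion \<gamma> \<alpha> (Y w)) w +
       \<theta>\<^sup>2 *\<^sub>R ((t - s) *\<^sub>R jet_drift \<gamma> (Y w) + Q w) + R w) \<and>
    msq M R \<le> C * (t - s) ^ 3 \<and> msq M Q \<le> C * (t - s)\<^sup>2 * (1 + msq M Y) \<and> (\<forall>Z\<in>L2F s. ip Z Q = 0)"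

text \<open>Subtracting the mean of each product of increments leaves the drift and a centred term.
  The second derivatives grow linearly in x, which explains the factor \<open>1 + msq M Y\<close>
  for \<open>Q\<close>; the third are bounded, so \<open>R\<close> has none. For \<theta> = 1 drift
  and noise have the form they have for the solution.\<close>

lemma jet_expansion:
  "\<exists>C\<ge>0. \<forall>s t \<theta> Y. 0 \<le> s \<longrightarrow> s \<le> t \<longrightarrow> 0 \<le> \<theta> \<longrightarrow> \<theta> \<le> 1 \<longrightarrow> Y \<in> L2F s \<longrightarrow>
    (\<exists>R Q. jet_remainder C \<theta> s t Y R Q)"
proof -
  \<comment> \<open>Summing over all pairs of indices gives one bound for every second derivative at
    x = 0.\<close>
  define h0 where "h0 = (\<Sum>\<beta>\<in>UNIV. \<Sum>\<alpha>\<in>UNIV. 2 * (norm (hess \<alpha> \<beta> 0))\<^sup>2)"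
  define B where "B = 2 * K\<^sup>2 + h0"
  define d where "d = real CARD('d)"
  \<comment> \<open>The first summand serves \<open>R\<close>: K^2 times the sixth moment bound. The
    second serves \<open>Q\<close>: each of its two nested sums costs a factor d by Cauchy-Schwarz
    and another for its number of terms, and 8 is the constant of the compensated products.\<close>
  let ?C = "K\<^sup>2 * (15 * d ^ 7) + d * (d * (d * (d * (8 * B))))"
  have d0: "0 \<le> d" by (simp add: d_def)
  have h0: "0 \<le> h0" unfolding h0_def by (intro sum_nonneg) auto
  then have B0: "0 \<le> B" by (simp add: B_def)
  have "\<exists>R Q. jet_remainder ?C \<theta> s t Y R Q"
    if st: "0 \<le> s" "s \<le> t" and \<theta>: "0 \<le> \<theta>" "\<theta> \<le> 1" and Y: "Y \<in> L2F s" for s t \<theta> Y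
  proof -
    let ?g = "\<lambda>\<beta> \<alpha> (x::real^'d). x $ \<beta> * x $ \<alpha> - (if \<beta> = \<alpha> then t - s else 0)"
    let ?q = "\<lambda>\<beta> \<alpha> w. ?g \<beta> \<alpha> (dW s t w) *\<^sub>R hess \<alpha> \<beta> (Y w)"
    define Q where "Q w = (1/2) *\<^sub>R (\<Sum>\<beta>\<in>UNIV. \<Sum>\<alpha>\<in>UNIV. ?q \<beta> \<alpha> w)" for w
    define S where "S = noise s t (\<lambda>\<alpha> w. jet_diffusion \<gamma> \<alpha> (Y w))"
    define R where "R w = \<gamma> (Y w) (\<theta> *\<^sub>R dW s t w) - (Y w + \<theta> *\<^sub>R S w + \<theta>\<^sup>2 *\<^sub>R ((t - s) *\<^sub>R jet_drift \<gamma> (Y w) + Q w))" for w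
    have H: "hess \<alpha> \<beta> \<circ> Y \<in> borel_measurable (F s)" "sq_integrable M (\<lambda>w. hess \<alpha> \<beta> (Y w))"
      "msq M (\<lambda>w. hess \<alpha> \<beta> (Y w)) \<le> B * (1 + msq M Y)" for \<alpha> \<beta>
    proof -
      show "hess \<alpha> \<beta> \<circ> Y \<in> borel_measurable (F s)" "sq_integrable M (\<lambda>w. hess \<alpha> \<beta> (Y w))"
        using L2F_hess[OF Y, of \<alpha> \<beta>] by (simp_all add: L2F_def comp_def)
      have "2 * (norm (hess \<alpha> \<beta> 0))\<^sup>2 \<le> (\<Sum>\<alpha>\<in>UNIV. 2 * (norm (hess \<alpha> \<beta> 0))\<^sup>2)"
        by (rule member_le_sum) auto
      also have "\<dots> \<le> h0"
        unfolding h0_def by (rule member_le_sum[of \<beta> UNIV "\<lambda>\<beta>. \<Sum>\<alpha>\<in>UNIV. 2 * (norm (hess \<alpha> \<beta> 0))\<^sup>2"]) (auto intro: sum_nonneg)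
      finally have "2 * (norm (hess \<alpha> \<beta> 0))\<^sup>2 \<le> h0" .
      moreover have "msq M (\<lambda>w. hess \<alpha> \<beta> (Y w)) \<le> 2 * K\<^sup>2 * msq M Y + 2 * (norm (hess \<alpha> \<beta> 0))\<^sup>2"
        by (rule L2F_lipschitz(2)[where f = "hess \<alpha> \<beta>", OF _ Y]) (rule hess_lipschitz)
      moreover have "0 \<le> h0 * msq M Y" "0 \<le> K\<^sup>2" using h0 by auto
      ultimately have "msq M (\<lambda>w. hess \<alpha> \<beta> (Y w)) \<le> 2 * K\<^sup>2 * msq M Y + h0 + h0 * msq M Y + 2 * K\<^sup>2"
        by linarith
      then show "msq M (\<lambda>w. hess \<alpha> \<beta> (Y w)) \<le> B * (1 + msq M Y)"
        by (simp add: B_def algebra_simps)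
    qed
    note g = sq_integrable_increment_product[OF st]
    have q: "sq_integrable M (?q \<beta> \<alpha>)" "msq M (?q \<beta> \<alpha>) \<le> 8 * (t - s)\<^sup>2 * (B * (1 + msq M Y))"
      "Z \<in> L2F s \<Longrightarrow> ip Z (?q \<beta> \<alpha>) = 0" for \<alpha> \<beta> Z
    proof -
      note * = increment_scaleR[OF st H(1)[unfolded comp_def] H(2) g(1,2)]
      show "sq_integrable M (?q \<beta> \<alpha>)" by (rule *(1))
      have "msq M (?q \<beta> \<alpha>) = msq M (\<lambda>w. ?g \<beta> \<alpha> (dW s t w)) * msq M (\<lambda>w. hess \<alpha> \<beta> (Y w))" by (rule *(2))
      also have "\<dots> \<le> 8 * (t - s)\<^sup>2 * (B * (1 + msq M Y))"
        by (intro mult_mono g(3) H(3)) auto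
      finally show "msq M (?q \<beta> \<alpha>) \<le> 8 * (t - s)\<^sup>2 * (B * (1 + msq M Y))" .
      assume "Z \<in> L2F s"
      then show "ip Z (?q \<beta> \<alpha>) = 0" unfolding ip_def
        by (intro *(3) g(4)) (auto simp: L2F_def)
    qed
    have q1: "sq_integrable M (\<lambda>w. \<Sum>\<alpha>\<in>UNIV. ?q \<beta> \<alpha> w)" for \<beta>
      by (intro sq_integrable_sum q)
    have q2: "sq_integrable M (\<lambda>w. \<Sum>\<beta>\<in>UNIV. \<Sum>\<alpha>\<in>UNIV. ?q \<beta> \<alpha> w)"
      by (intro sq_integrable_sum q)
    have Q: "sq_integrable M Q" unfolding Q_def by (intro sq_integrable_scaleR q2)
    have Qip: "ip Z Q = 0" if Z: "Z \<in> L2F s" for Z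
    proof -
      have "ip Z (\<lambda>w. \<Sum>\<beta>\<in>UNIV. \<Sum>\<alpha>\<in>UNIV. ?q \<beta> \<alpha> w) = 0"
      proof -
        have "ip Z (\<lambda>w. \<Sum>\<beta>\<in>UNIV. \<Sum>\<alpha>\<in>UNIV. ?q \<beta> \<alpha> w) = (\<Sum>\<beta>\<in>UNIV. ip Z (\<lambda>w. \<Sum>\<alpha>\<in>UNIV. ?q \<beta> \<alpha> w))"
          by (rule ip_sum_right[OF L2F_sq[OF Z] q1])
        also have "\<dots> = (\<Sum>\<beta>\<in>UNIV. \<Sum>\<alpha>\<in>UNIV. ip Z (?q \<beta> \<alpha>))"
          by (intro sum.cong refl ip_sum_right[OF L2F_sq[OF Z] q(1)])
        also have "\<dots> = 0" by (simp only: q(3)[OF Z] sum.neutral_const)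
        finally show ?thesis .
      qed
      moreover have "ip Z Q = 1/2 * ip Z (\<lambda>w. \<Sum>\<beta>\<in>UNIV. \<Sum>\<alpha>\<in>UNIV. ?q \<beta> \<alpha> w)"
        using ip_scaleR[of 1 Z "1/2" "\<lambda>w. \<Sum>\<beta>\<in>UNIV. \<Sum>\<alpha>\<in>UNIV. ?q \<beta> \<alpha> w"]
        unfolding Q_def[abs_def] by (simp only: scaleR_one mult_1_left)
      ultimately show ?thesis by simp
    qed
    have Y1: "0 \<le> 1 + msq M Y" by (simp add: add_nonneg_nonneg)
    have "msq M Q \<le> (1/2)\<^sup>2 * msq M (\<lambda>w. \<Sum>\<beta>\<in>UNIV. \<Sum>\<alpha>\<in>UNIV. ?q \<beta> \<alpha> w)"
      unfolding Q_def by (simp only: msq_scaleR)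
    also have "\<dots> \<le> 1 * (d * (\<Sum>\<beta>\<in>(UNIV::'d set). d * (\<Sum>\<alpha>\<in>(UNIV::'d set). 8 * (t - s)\<^sup>2 * (B * (1 + msq M Y)))))"
    proof (intro mult_mono)
      have "msq M (\<lambda>w. \<Sum>\<beta>\<in>UNIV. \<Sum>\<alpha>\<in>UNIV. ?q \<beta> \<alpha> w) \<le> d * (\<Sum>\<beta>\<in>UNIV. msq M (\<lambda>w. \<Sum>\<alpha>\<in>UNIV. ?q \<beta> \<alpha> w))"
        unfolding d_def by (rule msq_sum_le[OF q1])
      also have "\<dots> \<le> d * (\<Sum>\<beta>\<in>UNIV. d * (\<Sum>\<alpha>\<in>UNIV. msq M (?q \<beta> \<alpha>)))"
        unfolding d_def by (intro mult_left_mono sum_mono msq_sum_le q) auto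
      also have "\<dots> \<le> d * (\<Sum>\<beta>\<in>(UNIV::'d set). d * (\<Sum>\<alpha>\<in>(UNIV::'d set). 8 * (t - s)\<^sup>2 * (B * (1 + msq M Y))))"
        by (intro mult_left_mono sum_mono q d0)
      finally show "msq M (\<lambda>w. \<Sum>\<beta>\<in>UNIV. \<Sum>\<alpha>\<in>UNIV. ?q \<beta> \<alpha> w) \<le>
        d * (\<Sum>\<beta>\<in>(UNIV::'d set). d * (\<Sum>\<alpha>\<in>(UNIV::'d set). 8 * (t - s)\<^sup>2 * (B * (1 + msq M Y))))" .
    qed (auto simp: power2_eq_square)
    also have "\<dots> = d * (d * (d * (d * (8 * B)))) * (t - s)\<^sup>2 * (1 + msq M Y)"
      by (simp add: d_def)
    also have "\<dots> \<le> ?C * (t - s)\<^sup>2 * (1 + msq M Y)"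
      using d0 Y1 by (intro mult_right_mono) auto
    finally have Q2: "msq M Q \<le> ?C * (t - s)\<^sup>2 * (1 + msq M Y)" .
    have quad: "(t - s) *\<^sub>R jet_drift \<gamma> (Y w) + Q w =
       (1/2) *\<^sub>R (\<Sum>\<beta>\<in>UNIV. \<Sum>\<alpha>\<in>UNIV. (dW s t w $ \<beta> * dW s t w $ \<alpha>) *\<^sub>R hess \<alpha> \<beta> (Y w))" for w
    proof -
      have "(\<Sum>\<beta>\<in>UNIV. \<Sum>\<alpha>\<in>UNIV. (dW s t w $ \<beta> * dW s t w $ \<alpha>) *\<^sub>R hess \<alpha> \<beta> (Y w)) =
        (\<Sum>\<beta>\<in>UNIV. \<Sum>\<alpha>\<in>UNIV. ?q \<beta> \<alpha> w + (if \<beta> = \<alpha> then t - s else 0) *\<^sub>R hess \<alpha> \<beta> (Y w))"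
        by (simp add: scaleR_diff_left)
      also have "\<dots> = (\<Sum>\<beta>\<in>UNIV. \<Sum>\<alpha>\<in>UNIV. ?q \<beta> \<alpha> w) + (\<Sum>\<beta>\<in>UNIV. \<Sum>\<alpha>\<in>UNIV. (if \<beta> = \<alpha> then t - s else 0) *\<^sub>R hess \<alpha> \<beta> (Y w))"
        by (simp only: sum.distrib)
      also have "(\<Sum>\<beta>\<in>UNIV. \<Sum>\<alpha>\<in>UNIV. (if \<beta> = \<alpha> then t - s else 0) *\<^sub>R hess \<alpha> \<beta> (Y w)) = (\<Sum>\<beta>\<in>UNIV. (t - s) *\<^sub>R hess \<beta> \<beta> (Y w))"
        by (intro sum.cong) (auto simp: if_distrib[of "\<lambda>r. r *\<^sub>R _"] cong: if_cong)
      finally show ?thesis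
        by (simp add: Q_def jet_drift_def scaleR_sum_right[symmetric] scaleR_add_right ac_simps)
    qed
    have dWM: "dW s t \<in> borel_measurable M" using st by (intro measurable_F_M[OF measurable_dW]) auto
    have YM: "sq_integrable M Y" "Y \<in> borel_measurable M"
      using Y by (auto simp: L2F_def sq_integrable_def)
    have aY: "sq_integrable M (\<lambda>w. jet_drift \<gamma> (Y w))"
      using L2F_lipschitz(1)[OF drift_lipschitz Y] by (rule L2F_sq)
    have S: "sq_integrable M S" unfolding S_def
      by (rule sq_integrable_noise[OF L2F_lipschitz(1)[OF diffusion_lipschitz Y] st])
    have "sq_integrable M (\<lambda>w. Y w + \<theta> *\<^sub>R S w + \<theta>\<^sup>2 *\<^sub>R ((t - s) *\<^sub>R jet_drift \<gamma> (Y w) + Q w))"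
      by (intro sq_integrable_add sq_integrable_scaleR YM S aY Q)
    from sq_integrable_measurable[OF this] have Rm: "R \<in> borel_measurable M"
      unfolding R_def using YM(2) dWM by (intro borel_measurable_diff gamma_measurable) auto
    let ?c = "\<lambda>w. (\<Sum>\<alpha>\<in>UNIV. \<bar>dW s t w $ \<alpha>\<bar>) ^ 3"
    have R_le: "norm (R w) \<le> norm (K *\<^sub>R ?c w)" for w
    proof -
      have "R w = \<gamma> (Y w) (\<theta> *\<^sub>R dW s t w) - (Y w + (\<Sum>\<alpha>\<in>UNIV. ((\<theta> *\<^sub>R dW s t w) $ \<alpha>) *\<^sub>R jet_diffusion \<gamma> \<alpha> (Y w)) +
        (1/2) *\<^sub>R (\<Sum>\<beta>\<in>UNIV. \<Sum>\<alpha>\<in>UNIV. ((\<theta> *\<^sub>R dW s t w) $ \<beta> * (\<theta> *\<^sub>R dW s t w) $ \<alpha>) *\<^sub>R hess \<alpha> \<beta> (Y w)))"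
        unfolding R_def quad S_def noise_def
        by (simp add: scaleR_sum_right power2_eq_square ac_simps)
      then have "norm (R w) \<le> K * (\<Sum>\<alpha>\<in>UNIV. \<bar>(\<theta> *\<^sub>R dW s t w) $ \<alpha>\<bar>) ^ 3"
        using gamma_taylor[of "Y w" "\<theta> *\<^sub>R dW s t w"] by simp
      also have "\<dots> \<le> K * ?c w"
      proof (intro mult_left_mono power_mono sum_mono sum_nonneg)
        fix \<alpha>
        show "\<bar>(\<theta> *\<^sub>R dW s t w) $ \<alpha>\<bar> \<le> \<bar>dW s t w $ \<alpha>\<bar>"
          using \<theta> mult_right_mono[of \<theta> 1 "\<bar>dW s t w $ \<alpha>\<bar>"] by (simp add: abs_mult)
      qed (use K in auto)
      finally show ?thesis by simp
    qed
    note c = sq_integrable_increment_sum_cubed[OF st]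
    note RR = sq_integrable_bound[OF Rm sq_integrable_scaleR[OF c(1), of K] AE_I2[OF R_le]]
    have "msq M R \<le> msq M (\<lambda>w. K *\<^sub>R ?c w)" by (rule RR)
    also have "\<dots> = K\<^sup>2 * msq M ?c" by (simp only: msq_scaleR)
    also have "\<dots> \<le> K\<^sup>2 * (15 * d ^ 7 * (t - s) ^ 3)"
      unfolding d_def by (intro mult_left_mono c(2)) auto
    also have "\<dots> = K\<^sup>2 * (15 * d ^ 7) * (t - s) ^ 3" by simp
    also have "\<dots> \<le> ?C * (t - s) ^ 3"
      using d0 B0 st by (intro mult_right_mono) auto
    finally have R2: "msq M R \<le> ?C * (t - s) ^ 3" .
    have "jet_remainder ?C \<theta> s t Y R Q"
      unfolding jet_remainder_def
    proof (intro conjI allI ballI RR(1) Q R2 Q2 Qip)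
      show "\<gamma> (Y w) (\<theta> *\<^sub>R dW s t w) = Y w + \<theta> *\<^sub>R noise s t (\<lambda>\<alpha> w. jet_diffusion \<gamma> \<alpha> (Y w)) w +
       \<theta>\<^sup>2 *\<^sub>R ((t - s) *\<^sub>R jet_drift \<gamma> (Y w) + Q w) + R w" for w
        by (simp add: R_def S_def)
    qed
    then show ?thesis by blast
  qed
  moreover have "0 \<le> ?C" using d0 B0 by auto
  ultimately show ?thesis by blast
qed

text \<open>\<open>U\<close> collects what may correlate with the old error \<open>e\<close>,
  \<open>N\<close> what is orthogonal to it. The difference \<open>S\<close> of the noise terms
  belongs to \<open>N\<close>: its mean square is only O(h E), so dividing it by h in Young's
  inequality would be too costly.\<close>

lemma jet_step:
  "\<exists>C\<ge>0. \<forall>s t Y. 0 \<le> s \<longrightarrow> s < t \<longrightarrow> t \<le> T \<longrightarrow> Y \<in> L2F s \<longrightarrow>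
    (\<lambda>w. \<gamma> (Y w) (dW s t w)) \<in> L2F t \<and>
    msq M (\<lambda>w. \<gamma> (Y w) (dW s t w) - X t w) \<le> (1 + C * (t - s)) * msq M (\<lambda>w. Y w - X s w) + C * (t - s)\<^sup>2"
proof -
  obtain C1 where C1: "0 \<le> C1" and ex1: "\<And>s t \<theta> Y. 0 \<le> s \<Longrightarrow> s \<le> t \<Longrightarrow> 0 \<le> \<theta> \<Longrightarrow> \<theta> \<le> 1 \<Longrightarrow> Y \<in> L2F s \<Longrightarrow>
    \<exists>R Q. jet_remainder C1 \<theta> s t Y R Q"
    using jet_expansion by blast
  obtain C2 where C2: "0 \<le> C2" and ex2: "\<And>s t. 0 \<le> s \<Longrightarrow> s \<le> t \<Longrightarrow> t \<le> T \<Longrightarrow>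
    \<exists>A V. solution_remainder C2 s t A V"
    using solution_expansion by blast
  obtain CX where CX: "0 \<le> CX" "\<And>t. t \<in> {0..T} \<Longrightarrow> X t \<in> L2F t" "\<And>t. t \<in> {0..T} \<Longrightarrow> msq M (X t) \<le> CX"
    using X_sq_bounded by blast
  define d where "d = real CARD('d)"
  define P where "P = 1 + 2 * Lip\<^sup>2 + 4 * T * Lip\<^sup>2 + 4 * (d * d * Lip\<^sup>2) + 16 * C1 * T"
  define P' where "P' = 4 * (C1 + C2) + 8 * T * (C1 + C2) + 8 * C1 * (1 + 2 * CX) + 8 * C2"
  have P0: "0 \<le> P" "0 \<le> P'"
    using C1 C2 CX(1) T_pos by (auto simp: P_def P'_def d_def intro!: add_nonneg_nonneg mult_nonneg_nonneg)
  have "(\<lambda>w. \<gamma> (Y w) (dW s t w)) \<in> L2F t \<and>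
    msq M (\<lambda>w. \<gamma> (Y w) (dW s t w) - X t w) \<le> (1 + (P + P') * (t - s)) * msq M (\<lambda>w. Y w - X s w) + (P + P') * (t - s)\<^sup>2"
    if s: "0 \<le> s" and lt: "s < t" and t: "t \<le> T" and Y: "Y \<in> L2F s" for s t Y
  proof -
    have le: "s \<le> t" using lt by simp
    have Xs: "X s \<in> L2F s" using CX(2) s lt t by auto
    define h where "h = t - s"
    have h: "0 < h" "h \<le> T" using s lt t by (auto simp: h_def)
    obtain R Q where RQ: "sq_integrable M R" "sq_integrable M Q"
      "\<And>w. \<gamma> (Y w) (dW s t w) = Y w + noise s t (\<lambda>\<alpha> w. jet_diffusion \<gamma> \<alpha> (Y w)) w +
       (h *\<^sub>R jet_drift \<gamma> (Y w) + Q w) + R w"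
      "msq M R \<le> C1 * h ^ 3" "msq M Q \<le> C1 * h\<^sup>2 * (1 + msq M Y)" "\<And>Z. Z \<in> L2F s \<Longrightarrow> ip Z Q = 0"
      using ex1[OF s le zero_le_one order_refl Y] by (auto simp: h_def jet_remainder_def)
    obtain A V where AV: "sq_integrable M A" "sq_integrable M V"
      "\<And>w. X t w = X s w + h *\<^sub>R jet_drift \<gamma> (X s w) + noise s t (\<lambda>\<alpha> w. jet_diffusion \<gamma> \<alpha> (X s w)) w + A w + V w"
      "msq M A \<le> C2 * h ^ 3" "msq M V \<le> C2 * h\<^sup>2" "\<And>Z. Z \<in> L2F s \<Longrightarrow> ip Z V = 0"
      using ex2[OF s le t] by (auto simp: h_def solution_remainder_def)
    define e where "e w = Y w - X s w" for w
    define Da where "Da w = jet_drift \<gamma> (Y w) - jet_drift \<gamma> (X s w)" for w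
    define Db where "Db \<alpha> w = jet_diffusion \<gamma> \<alpha> (Y w) - jet_diffusion \<gamma> \<alpha> (X s w)" for \<alpha> w
    define S where "S = noise s t Db"
    define U where "U w = h *\<^sub>R Da w + (R w - A w)" for w
    define N where "N w = S w + (Q w - V w)" for w
    define E where "E = msq M e"
    have E0: "0 \<le> E" by (simp add: E_def)
    have e: "e \<in> L2F s" unfolding e_def by (intro L2F_diff Y Xs)
    note e_sq = L2F_sq[OF e]
    have Da: "sq_integrable M Da" "msq M Da \<le> Lip\<^sup>2 * E"
    proof -
      show "sq_integrable M Da" unfolding Da_def
        by (intro L2F_sq[of _ s] L2F_diff L2F_lipschitz(1)[OF drift_lipschitz] Y Xs)
      show "msq M Da \<le> Lip\<^sup>2 * E" unfolding Da_def E_def e_def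
        by (rule msq_lipschitz_diff[OF drift_lipschitz Lip_ge(2) Y Xs])
    qed
    have Db: "Db \<alpha> \<in> L2F s" "msq M (Db \<alpha>) \<le> Lip\<^sup>2 * E" for \<alpha>
    proof -
      show "Db \<alpha> \<in> L2F s" unfolding Db_def
        by (intro L2F_diff L2F_lipschitz(1)[OF diffusion_lipschitz] Y Xs)
      show "msq M (Db \<alpha>) \<le> Lip\<^sup>2 * E" unfolding Db_def E_def e_def
        by (rule msq_lipschitz_diff[OF diffusion_lipschitz Lip_ge(2) Y Xs])
    qed
    have S: "sq_integrable M S" and Sip: "ip e S = 0"
      unfolding S_def by (rule sq_integrable_noise[OF Db(1) s le], rule ip_noise[OF Db(1) s le e])
    have Sb: "msq M S \<le> d * d * Lip\<^sup>2 * h * E"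
      using msq_noise_le[OF Db(1) s le Db(2)] by (simp add: S_def d_def h_def power2_eq_square ac_simps)
    have RA: "sq_integrable M (\<lambda>w. R w - A w)" and QV: "sq_integrable M (\<lambda>w. Q w - V w)"
      by (intro sq_integrable_diff RQ AV)+
    have U: "sq_integrable M U" and N: "sq_integrable M N"
      unfolding U_def N_def by (intro sq_integrable_add sq_integrable_scaleR Da RA S QV)+
    have UN: "sq_integrable M (\<lambda>w. U w + N w)" by (rule sq_integrable_add[OF U N])
    have Nip: "ip e N = 0"
      unfolding N_def using ip_add_right[OF S QV e_sq] ip_diff_right[OF RQ(2) AV(2) e_sq] Sip RQ(6)[OF e] AV(6)[OF e] by simp
    have eq: "\<gamma> (Y w) (dW s t w) - X t w = e w + (U w + N w)" for w
      unfolding RQ(3) AV(3) U_def N_def S_def noise_def Da_def Db_def e_def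
      by (simp add: scaleR_diff_right sum_subtractf algebra_simps)
    have Ub: "msq M U \<le> 2 * (h\<^sup>2 * (Lip\<^sup>2 * E)) + 2 * (2 * (C1 * h ^ 3) + 2 * (C2 * h ^ 3))"
    proof -
      have "msq M U \<le> 2 * msq M (\<lambda>w. h *\<^sub>R Da w) + 2 * msq M (\<lambda>w. R w - A w)"
        unfolding U_def by (intro msq_add_le sq_integrable_scaleR Da RA)
      also have "\<dots> \<le> 2 * msq M (\<lambda>w. h *\<^sub>R Da w) + 2 * (2 * msq M R + 2 * msq M A)"
        by (intro add_left_mono mult_left_mono msq_diff_le RQ AV) auto
      also have "\<dots> \<le> 2 * (h\<^sup>2 * (Lip\<^sup>2 * E)) + 2 * (2 * (C1 * h ^ 3) + 2 * (C2 * h ^ 3))"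
        unfolding msq_scaleR by (intro add_mono mult_left_mono Da RQ AV) auto
      finally show ?thesis .
    qed
    have Yb: "msq M Y \<le> 2 * E + 2 * CX"
    proof -
      have "msq M Y \<le> 2 * msq M e + 2 * msq M (X s)"
        using msq_add_le[OF e_sq L2F_sq[OF Xs]] by (simp add: e_def)
      then show ?thesis using CX(3)[of s] s lt t by (simp add: E_def)
    qed
    have Nb: "msq M N \<le> 2 * (d * d * Lip\<^sup>2 * h * E) + 2 * (2 * (C1 * h\<^sup>2 * (1 + (2 * E + 2 * CX))) + 2 * (C2 * h\<^sup>2))"
    proof -
      have "msq M N \<le> 2 * msq M S + 2 * msq M (\<lambda>w. Q w - V w)"
        unfolding N_def by (intro msq_add_le S QV)
      also have "\<dots> \<le> 2 * msq M S + 2 * (2 * msq M Q + 2 * msq M V)"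
        by (intro add_left_mono mult_left_mono msq_diff_le RQ AV) auto
      also have "\<dots> \<le> 2 * (d * d * Lip\<^sup>2 * h * E) + 2 * (2 * (C1 * h\<^sup>2 * (1 + (2 * E + 2 * CX))) + 2 * (C2 * h\<^sup>2))"
      proof (intro add_mono mult_left_mono Sb AV)
        have "msq M Q \<le> C1 * h\<^sup>2 * (1 + msq M Y)" by fact
        also have "\<dots> \<le> C1 * h\<^sup>2 * (1 + (2 * E + 2 * CX))"
          using C1 Yb by (intro mult_left_mono add_left_mono) auto
        finally show "msq M Q \<le> C1 * h\<^sup>2 * (1 + (2 * E + 2 * CX))" .
      qed auto
      finally show ?thesis .
    qed
    \<comment> \<open>With weight h, the term h E fits the recursion, and dividing the O(h^3) part
      of the mean square of \<open>U\<close> by h leaves O(h^2).\<close>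
    have ipU: "2 * ip e U \<le> h * E + msq M U / h"
      using two_integral_inner_le[OF e_sq U h(1)] by (simp add: ip_def E_def)
    have "msq M U / h \<le> (2 * (h\<^sup>2 * (Lip\<^sup>2 * E)) + 2 * (2 * (C1 * h ^ 3) + 2 * (C2 * h ^ 3))) / h"
      using Ub h by (intro divide_right_mono) auto
    also have "\<dots> = 2 * (Lip\<^sup>2 * (h * E)) + 4 * (C1 + C2) * h\<^sup>2"
      using h by (simp add: field_simps power2_eq_square power3_eq_cube)
    finally have Uh: "msq M U / h \<le> 2 * (Lip\<^sup>2 * (h * E)) + 4 * (C1 + C2) * h\<^sup>2" .
    have hz: "h\<^sup>2 * z \<le> T * (h * z)" if "0 \<le> z" for z
      using h that mult_right_mono[of h T "h * z"] by (simp add: power2_eq_square)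
    have hE: "h\<^sup>2 * (Lip\<^sup>2 * E) \<le> T * (Lip\<^sup>2 * (h * E))" using hz[of "Lip\<^sup>2 * E"] E0 by (simp add: ac_simps)
    have hEC: "C1 * h\<^sup>2 * E \<le> T * (C1 * (h * E))" using hz[of "C1 * E"] E0 C1 by (simp add: ac_simps)
    have hC: "(C1 + C2) * h ^ 3 \<le> T * ((C1 + C2) * h\<^sup>2)"
      using hz[of "h * (C1 + C2)"] h C1 C2 by (simp add: power2_eq_square power3_eq_cube ac_simps)
    have "msq M (\<lambda>w. \<gamma> (Y w) (dW s t w) - X t w) = E + msq M (\<lambda>w. U w + N w) + 2 * ip e (\<lambda>w. U w + N w)"
      unfolding eq E_def ip_def by (rule msq_add[OF e_sq UN])
    also have "\<dots> \<le> E + (2 * msq M U + 2 * msq M N) + (h * E + msq M U / h)"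
      using msq_add_le[OF U N] ipU Nip ip_add_right[OF U N e_sq] by simp
    also have "\<dots> \<le> E + P * (h * E) + P' * h\<^sup>2"
      using Ub Nb Uh hE hC hEC unfolding P_def P'_def by (simp add: algebra_simps)
    also have "\<dots> \<le> (1 + (P + P') * h) * E + (P + P') * h\<^sup>2"
      using P0 h E0 by (simp add: algebra_simps)
    finally have main: "msq M (\<lambda>w. \<gamma> (Y w) (dW s t w) - X t w) \<le> (1 + (P + P') * h) * E + (P + P') * h\<^sup>2" .
    have "sq_integrable M (\<lambda>w. (e w + (U w + N w)) + X t w)"
      using CX(2)[of t] s lt t by (intro sq_integrable_add e_sq U N L2F_sq[of "X t" t]) auto
    then have "sq_integrable M (\<lambda>w. \<gamma> (Y w) (dW s t w))" by (simp flip: eq)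
    moreover have "(\<lambda>w. \<gamma> (Y w) (dW s t w)) \<in> borel_measurable (F t)"
      using L2F_mono[OF Y le] s le by (intro gamma_measurable measurable_dW) (auto simp: L2F_def)
    ultimately show ?thesis using main by (simp add: L2F_def h_def E_def e_def[abs_def])
  qed
  moreover have "0 \<le> P + P'" using P0 by simp
  ultimately show ?thesis by blast
qed

text \<open>For times between grid points, where only the size of the displacement matters. The
  condition is \<open>t - s \<le> T\<close> instead of \<open>t \<le> T\<close>: at time T the
  formula of the scheme refers to the increment over the step after T, multiplied by \<theta> =
  0.\<close>

lemma jet_displacement:
  "\<exists>C\<ge>0. \<forall>s t \<theta> Y. 0 \<le> s \<longrightarrow> s \<le> t \<longrightarrow> t - s \<le> T \<longrightarrow> 0 \<le> \<theta> \<longrightarrow> \<theta> \<le> 1 \<longrightarrow> Y \<in> L2F s \<longrightarrow>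
    sq_integrable M (\<lambda>w. \<gamma> (Y w) (\<theta> *\<^sub>R dW s t w) - Y w) \<and>
    msq M (\<lambda>w. \<gamma> (Y w) (\<theta> *\<^sub>R dW s t w) - Y w) \<le> C * (t - s) * (1 + msq M Y)"
proof -
  obtain C1 where C1: "0 \<le> C1" and ex1: "\<And>s t \<theta> Y. 0 \<le> s \<Longrightarrow> s \<le> t \<Longrightarrow> 0 \<le> \<theta> \<Longrightarrow> \<theta> \<le> 1 \<Longrightarrow> Y \<in> L2F s \<Longrightarrow>
    \<exists>R Q. jet_remainder C1 \<theta> s t Y R Q"
    using jet_expansion by blast
  define B where "B = 2 * Lip\<^sup>2 + 2 * (norm (jet_drift \<gamma> 0))\<^sup>2 + (\<Sum>\<alpha>\<in>UNIV. 2 * (norm (jet_diffusion \<gamma> \<alpha> 0))\<^sup>2)"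
  define d where "d = real CARD('d)"
  have d0: "0 \<le> d" by (simp add: d_def)
  have B0: "0 \<le> B" unfolding B_def by (intro add_nonneg_nonneg sum_nonneg) auto
  have Bdrift: "2 * (norm (jet_drift \<gamma> 0))\<^sup>2 \<le> B" and Bdiff: "2 * (norm (jet_diffusion \<gamma> \<alpha> 0))\<^sup>2 \<le> B"
    and BL: "2 * Lip\<^sup>2 \<le> B" for \<alpha>
  proof -
    have "2 * (norm (jet_diffusion \<gamma> \<alpha> 0))\<^sup>2 \<le> (\<Sum>\<alpha>\<in>UNIV. 2 * (norm (jet_diffusion \<gamma> \<alpha> 0))\<^sup>2)" for \<alpha>
      by (rule member_le_sum) auto
    moreover have "0 \<le> (\<Sum>\<alpha>\<in>UNIV. 2 * (norm (jet_diffusion \<gamma> \<alpha> 0))\<^sup>2)" by (intro sum_nonneg) auto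
    moreover have "0 \<le> Lip\<^sup>2" "0 \<le> (norm (jet_drift \<gamma> 0))\<^sup>2" by auto
    ultimately show "2 * (norm (jet_drift \<gamma> 0))\<^sup>2 \<le> B" "2 * (norm (jet_diffusion \<gamma> \<alpha> 0))\<^sup>2 \<le> B" "2 * Lip\<^sup>2 \<le> B" for \<alpha>
      unfolding B_def by (smt (verit))+
  qed
  let ?C = "2 * (d * d * B) + 8 * (T * B) + 8 * (C1 * T) + 4 * (C1 * T\<^sup>2)"
  have "sq_integrable M (\<lambda>w. \<gamma> (Y w) (\<theta> *\<^sub>R dW s t w) - Y w) \<and>
    msq M (\<lambda>w. \<gamma> (Y w) (\<theta> *\<^sub>R dW s t w) - Y w) \<le> ?C * (t - s) * (1 + msq M Y)"
    if st: "0 \<le> s" "s \<le> t" and tT: "t - s \<le> T" and \<theta>: "0 \<le> \<theta>" "\<theta> \<le> 1" and Y: "Y \<in> L2F s" for s t \<theta> Y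
  proof -
    define h where "h = t - s"
    have h: "0 \<le> h" "h \<le> T" using st tT by (auto simp: h_def)
    obtain R Q where RQ: "sq_integrable M R" "sq_integrable M Q"
      "\<And>w. \<gamma> (Y w) (\<theta> *\<^sub>R dW s t w) = Y w + \<theta> *\<^sub>R noise s t (\<lambda>\<alpha> w. jet_diffusion \<gamma> \<alpha> (Y w)) w +
       \<theta>\<^sup>2 *\<^sub>R (h *\<^sub>R jet_drift \<gamma> (Y w) + Q w) + R w"
      "msq M R \<le> C1 * h ^ 3" "msq M Q \<le> C1 * h\<^sup>2 * (1 + msq M Y)"
      using ex1[OF st \<theta> Y] by (auto simp: h_def jet_remainder_def)
    let ?y = "1 + msq M Y"
    have y: "0 \<le> ?y" by (simp add: add_nonneg_nonneg)
    let ?b = "\<lambda>\<alpha> w. jet_diffusion \<gamma> \<alpha> (Y w)"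
    let ?a = "\<lambda>w. jet_drift \<gamma> (Y w)"
    let ?S = "noise s t ?b"
    have b: "?b \<alpha> \<in> L2F s" for \<alpha> by (rule L2F_lipschitz(1)[OF diffusion_lipschitz Y])
    have Lm: "2 * Lip\<^sup>2 * msq M Y \<le> B * msq M Y" by (intro mult_right_mono BL) auto
    have bb: "msq M (?b \<alpha>) \<le> B * ?y" for \<alpha>
    proof -
      have "msq M (?b \<alpha>) \<le> 2 * Lip\<^sup>2 * msq M Y + 2 * (norm (jet_diffusion \<gamma> \<alpha> 0))\<^sup>2"
        by (rule L2F_lipschitz(2)[OF diffusion_lipschitz Y])
      then show ?thesis using Lm Bdiff[of \<alpha>] by (simp add: algebra_simps)
    qed
    have ab: "msq M ?a \<le> B * ?y"
    proof -
      have "msq M ?a \<le> 2 * Lip\<^sup>2 * msq M Y + 2 * (norm (jet_drift \<gamma> 0))\<^sup>2"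
        by (rule L2F_lipschitz(2)[OF drift_lipschitz Y])
      then show ?thesis using Lm Bdrift by (simp add: algebra_simps)
    qed
    have a: "sq_integrable M ?a" by (rule L2F_sq[OF L2F_lipschitz(1)[OF drift_lipschitz Y]])
    have S: "sq_integrable M ?S" by (rule sq_integrable_noise[OF b st])
    have Sb: "msq M ?S \<le> d * d * B * (h * ?y)"
      using msq_noise_le[OF b st bb] by (simp add: d_def h_def power2_eq_square ac_simps)
    have haQ: "sq_integrable M (\<lambda>w. h *\<^sub>R ?a w + Q w)"
      by (intro sq_integrable_add sq_integrable_scaleR a RQ)
    have haQb: "msq M (\<lambda>w. h *\<^sub>R ?a w + Q w) \<le> 2 * (h\<^sup>2 * (B * ?y)) + 2 * (C1 * h\<^sup>2 * ?y)"
    proof -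
      have "msq M (\<lambda>w. h *\<^sub>R ?a w + Q w) \<le> 2 * msq M (\<lambda>w. h *\<^sub>R ?a w) + 2 * msq M Q"
        by (intro msq_add_le sq_integrable_scaleR a RQ)
      also have "\<dots> \<le> 2 * (h\<^sup>2 * (B * ?y)) + 2 * (C1 * h\<^sup>2 * ?y)"
        unfolding msq_scaleR by (intro add_mono mult_left_mono ab RQ) auto
      finally show ?thesis .
    qed
    have \<theta>1: "\<theta>\<^sup>2 \<le> 1" "(\<theta>\<^sup>2)\<^sup>2 \<le> 1" using \<theta> by (auto simp: power_le_one)
    have TR: "sq_integrable M (\<lambda>w. \<theta>\<^sup>2 *\<^sub>R (h *\<^sub>R ?a w + Q w) + R w)"
      by (intro sq_integrable_add sq_integrable_scaleR haQ RQ)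
    have eq: "\<gamma> (Y w) (\<theta> *\<^sub>R dW s t w) - Y w = \<theta> *\<^sub>R ?S w + (\<theta>\<^sup>2 *\<^sub>R (h *\<^sub>R ?a w + Q w) + R w)" for w
      unfolding RQ(3) by simp
    have sq: "sq_integrable M (\<lambda>w. \<gamma> (Y w) (\<theta> *\<^sub>R dW s t w) - Y w)"
      unfolding eq by (intro sq_integrable_add[OF sq_integrable_scaleR TR] S)
    have hh: "h\<^sup>2 * z \<le> T * (h * z)" "h ^ 3 * z \<le> T\<^sup>2 * (h * z)" if "0 \<le> z" for z
    proof -
      show "h\<^sup>2 * z \<le> T * (h * z)"
        using h that mult_right_mono[of h T "h * z"] by (simp add: power2_eq_square)
      have "h ^ 3 * z = h\<^sup>2 * (h * z)" by (simp add: power2_eq_square power3_eq_cube)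
      also have "\<dots> \<le> T\<^sup>2 * (h * z)" using h that by (intro mult_right_mono power_mono) auto
      finally show "h ^ 3 * z \<le> T\<^sup>2 * (h * z)" .
    qed
    have "msq M (\<lambda>w. \<gamma> (Y w) (\<theta> *\<^sub>R dW s t w) - Y w)
        \<le> 2 * msq M (\<lambda>w. \<theta> *\<^sub>R ?S w) + 2 * msq M (\<lambda>w. \<theta>\<^sup>2 *\<^sub>R (h *\<^sub>R ?a w + Q w) + R w)"
      unfolding eq by (intro msq_add_le[OF sq_integrable_scaleR TR] S)
    also have "\<dots> \<le> 2 * msq M (\<lambda>w. \<theta> *\<^sub>R ?S w) + 2 * (2 * msq M (\<lambda>w. \<theta>\<^sup>2 *\<^sub>R (h *\<^sub>R ?a w + Q w)) + 2 * msq M R)"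
      by (intro add_left_mono mult_left_mono msq_add_le[OF sq_integrable_scaleR RQ(1)] haQ) auto
    also have "\<dots> \<le> 2 * (1 * (d * d * B * (h * ?y))) +
        2 * (2 * (1 * (2 * (h\<^sup>2 * (B * ?y)) + 2 * (C1 * h\<^sup>2 * ?y))) + 2 * (C1 * h ^ 3))"
      unfolding msq_scaleR using \<theta>1 by (intro add_mono mult_left_mono mult_mono Sb haQb RQ) auto
    also have "\<dots> \<le> ?C * (h * ?y)"
    proof -
      \<comment> \<open>The bound on \<open>R\<close> lacks the factor \<open>1 + msq M Y\<close>,
        which is at least 1.\<close>
      have "h ^ 3 * C1 \<le> h ^ 3 * (C1 * ?y)"
        using h C1 mult_left_mono[of 1 ?y C1] by (intro mult_left_mono) auto
      then have "h ^ 3 * C1 \<le> T\<^sup>2 * (h * (C1 * ?y))" using hh(2)[of "C1 * ?y"] C1 y by auto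
      then show ?thesis
        using hh(1)[of "B * ?y"] hh(1)[of "C1 * ?y"] B0 C1 y by (simp add: algebra_simps)
    qed
    finally show ?thesis using sq by (simp add: h_def mult.assoc)
  qed
  moreover have "0 \<le> ?C" using d0 B0 C1 T_pos by auto
  ultimately show ?thesis by blast
qed

lemma jet_grid_error:
  "\<exists>C\<ge>0. \<forall>\<delta> k. 0 < \<delta> \<longrightarrow> real k * \<delta> \<le> T \<longrightarrow>
    jet_grid \<gamma> W x\<^sub>0 \<delta> k \<in> L2F (real k * \<delta>) \<and>
    msq M (\<lambda>w. jet_grid \<gamma> W x\<^sub>0 \<delta> k w - X (real k * \<delta>) w) \<le> C * \<delta>"
proof -
  obtain C where C: "0 \<le> C" and step: "\<And>s t Y. 0 \<le> s \<Longrightarrow> s < t \<Longrightarrow> t \<le> T \<Longrightarrow> Y \<in> L2F s \<Longrightarrow>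
    (\<lambda>w. \<gamma> (Y w) (dW s t w)) \<in> L2F t \<and>
    msq M (\<lambda>w. \<gamma> (Y w) (dW s t w) - X t w) \<le> (1 + C * (t - s)) * msq M (\<lambda>w. Y w - X s w) + C * (t - s)\<^sup>2"
    using jet_step by blast
  have "jet_grid \<gamma> W x\<^sub>0 \<delta> k \<in> L2F (real k * \<delta>) \<and>
    msq M (\<lambda>w. jet_grid \<gamma> W x\<^sub>0 \<delta> k w - X (real k * \<delta>) w) \<le> (C * T * exp (C * T)) * \<delta>"
    if \<delta>: "0 < \<delta>" and k: "real k * \<delta> \<le> T" for \<delta> k
  proof -
    let ?G = "\<lambda>j. jet_grid \<gamma> W x\<^sub>0 \<delta> j"
    define e where "e j = msq M (\<lambda>w. ?G j w - X (real j * \<delta>) w)" for j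
    have G_Suc: "?G (Suc j) = (\<lambda>w. \<gamma> (?G j w) (dW (real j * \<delta>) (real (Suc j) * \<delta>) w))" for j
      by (simp add: dW_def fun_eq_iff algebra_simps)
    have grid: "0 \<le> real j * \<delta>" "real j * \<delta> < real (Suc j) * \<delta>" for j using \<delta> by (auto simp: algebra_simps)
    have gridT: "real (Suc j) * \<delta> \<le> T" if "j < k" for j
    proof -
      have "real (Suc j) * \<delta> \<le> real k * \<delta>" using that \<delta> by (intro mult_right_mono) auto
      then show ?thesis using k by simp
    qed
    have G: "?G j \<in> L2F (real j * \<delta>)" if "j \<le> k" for j
      using that
    proof (induction j)
      case 0
      have "?G 0 = (\<lambda>w. x\<^sub>0)" by (simp add: fun_eq_iff)
      then show ?case by (simp add: L2F_const)
    next
      case (Suc j)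
      then have "?G j \<in> L2F (real j * \<delta>)" by simp
      from step[OF grid gridT this] Suc(2) show ?case unfolding G_Suc by simp
    qed
    have "e k \<le> C * \<delta>\<^sup>2 * real k * exp (C * \<delta> * real k)"
    proof (rule discrete_gronwall)
      have "?G 0 = (\<lambda>w. x\<^sub>0)" by (simp add: fun_eq_iff)
      then show "e 0 = 0" using X_initial by (simp add: e_def)
      fix j assume j: "j < k"
      have "real (Suc j) * \<delta> - real j * \<delta> = \<delta>" by (simp add: algebra_simps)
      then show "e (Suc j) \<le> (1 + C * \<delta>) * e j + C * \<delta>\<^sup>2"
        using step[OF grid gridT[OF j] G] j unfolding e_def G_Suc by simp
    qed (use C \<delta> in auto)
    \<comment> \<open>One factor \<delta> is kept as the rate; each other one joins k to form an
      elapsed time of at most T.\<close>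
    also have "\<dots> = (C * (real k * \<delta>) * exp (C * (real k * \<delta>))) * \<delta>"
      by (simp add: power2_eq_square ac_simps)
    also have "\<dots> \<le> (C * T * exp (C * T)) * \<delta>"
      using k C \<delta> T_pos by (intro mult_right_mono mult_mono mult_left_mono) (auto intro!: mult_left_mono)
    finally show ?thesis using G[of k] by (simp add: e_def)
  qed
  moreover have "0 \<le> C * T * exp (C * T)" using C T_pos by simp
  ultimately show ?thesis by blast
qed

lemma jet_scheme_error:
  "\<exists>C. \<forall>N\<ge>1. \<forall>t\<in>{0..T}. mean_sq_dist M (jet_scheme \<gamma> W x\<^sub>0 T N t) (X t) \<le> ennreal (C * (T / real N))"
proof -
  obtain C1 where C1: "0 \<le> C1" and disp: "\<And>s t \<theta> Y. 0 \<le> s \<Longrightarrow> s \<le> t \<Longrightarrow> t - s \<le> T \<Longrightarrow> 0 \<le> \<theta> \<Longrightarrow> \<theta> \<le> 1 \<Longrightarrow> Y \<in> L2F s \<Longrightarrow>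
    sq_integrable M (\<lambda>w. \<gamma> (Y w) (\<theta> *\<^sub>R dW s t w) - Y w) \<and>
    msq M (\<lambda>w. \<gamma> (Y w) (\<theta> *\<^sub>R dW s t w) - Y w) \<le> C1 * (t - s) * (1 + msq M Y)"
    using jet_displacement by blast
  obtain C2 where C2: "0 \<le> C2" and gerr: "\<And>\<delta> k. 0 < \<delta> \<Longrightarrow> real k * \<delta> \<le> T \<Longrightarrow>
    jet_grid \<gamma> W x\<^sub>0 \<delta> k \<in> L2F (real k * \<delta>) \<and>
    msq M (\<lambda>w. jet_grid \<gamma> W x\<^sub>0 \<delta> k w - X (real k * \<delta>) w) \<le> C2 * \<delta>"
    using jet_grid_error by blast
  obtain C3 where C3: "0 \<le> C3" "\<And>s t. 0 \<le> s \<Longrightarrow> s \<le> t \<Longrightarrow> t \<le> T \<Longrightarrow> msq M (\<lambda>w. X t w - X s w) \<le> C3 * (t - s)"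
    using X_increment_sq_bounded by blast
  obtain CX where CX: "0 \<le> CX" "\<And>t. t \<in> {0..T} \<Longrightarrow> X t \<in> L2F t" "\<And>t. t \<in> {0..T} \<Longrightarrow> msq M (X t) \<le> CX"
    using X_sq_bounded by blast
  let ?C = "2 * (C1 * (1 + (2 * (C2 * T) + 2 * CX))) + 2 * (2 * C2 + 2 * C3)"
  have "mean_sq_dist M (jet_scheme \<gamma> W x\<^sub>0 T N t) (X t) \<le> ennreal (?C * (T / real N))"
    if N: "1 \<le> N" and t: "t \<in> {0..T}" for N t
  proof -
    define \<delta> where "\<delta> = T / real N"
    define k where "k = nat \<lfloor>t / \<delta>\<rfloor>"
    define s where "s = real k * \<delta>"
    define \<theta> where "\<theta> = (t - s) / \<delta>"
    have \<delta>: "0 < \<delta>" "\<delta> \<le> T" using T_pos N by (auto simp: \<delta>_def field_simps)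
    have "0 \<le> t / \<delta>" using t \<delta> by simp
    then have "real k \<le> t / \<delta>" "t / \<delta> < real k + 1" by (auto simp: k_def)
    then have st: "s \<le> t" "t < s + \<delta>" using \<delta> by (auto simp: s_def field_simps)
    have s: "0 \<le> s" "s \<in> {0..T}" using \<delta> st t by (auto simp: s_def)
    have \<theta>: "0 \<le> \<theta>" "\<theta> \<le> 1" using st \<delta> by (auto simp: \<theta>_def field_simps)
    let ?G = "jet_grid \<gamma> W x\<^sub>0 \<delta> k"
    have G: "?G \<in> L2F s" "msq M (\<lambda>w. ?G w - X s w) \<le> C2 * \<delta>"
      using gerr[of \<delta> k] \<delta> s by (auto simp: s_def)
    have scheme: "jet_scheme \<gamma> W x\<^sub>0 T N t w = \<gamma> (?G w) (\<theta> *\<^sub>R dW s (s + \<delta>) w)" for w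
      by (simp add: jet_scheme_def Let_def \<delta>_def[symmetric] k_def[symmetric] s_def[symmetric] \<theta>_def dW_def)
    have Xsq: "sq_integrable M (X s)" "sq_integrable M (X t)"
      using CX(2)[OF s(2)] CX(2)[OF t] by (auto simp: L2F_sq)
    have Gsq: "sq_integrable M ?G" by (rule L2F_sq[OF G(1)])
    have GX: "sq_integrable M (\<lambda>w. ?G w - X s w)" "sq_integrable M (\<lambda>w. X t w - X s w)"
      by (intro sq_integrable_diff Gsq Xsq)+
    have GXX: "sq_integrable M (\<lambda>w. (?G w - X s w) - (X t w - X s w))"
      by (intro sq_integrable_diff GX)
    have "msq M ?G \<le> 2 * msq M (\<lambda>w. ?G w - X s w) + 2 * msq M (X s)"
      using msq_add_le[OF GX(1) Xsq(1)] by simp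
    also have "\<dots> \<le> 2 * (C2 * T) + 2 * CX"
      using G(2) CX(3)[OF s(2)] mult_left_mono[OF \<delta>(2) C2] by simp
    finally have Gb: "msq M ?G \<le> 2 * (C2 * T) + 2 * CX" .
    let ?D = "\<lambda>w. \<gamma> (?G w) (\<theta> *\<^sub>R dW s (s + \<delta>) w) - ?G w"
    have D: "sq_integrable M ?D" "msq M ?D \<le> C1 * \<delta> * (1 + msq M ?G)"
      using disp[OF s(1) _ _ \<theta> G(1), of "s + \<delta>"] \<delta> by auto
    \<comment> \<open>Three errors: the scheme since the last grid point, the grid error there, and
      the solution since then; each has mean square O(\<delta>).\<close>
    have eq: "jet_scheme \<gamma> W x\<^sub>0 T N t w - X t w = ?D w + ((?G w - X s w) - (X t w - X s w))" for w
      by (simp add: scheme)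
    have "msq M (\<lambda>w. jet_scheme \<gamma> W x\<^sub>0 T N t w - X t w) \<le> 2 * msq M ?D + 2 * msq M (\<lambda>w. (?G w - X s w) - (X t w - X s w))"
      unfolding eq by (rule msq_add_le[OF D(1) GXX])
    also have "\<dots> \<le> 2 * msq M ?D + 2 * (2 * msq M (\<lambda>w. ?G w - X s w) + 2 * msq M (\<lambda>w. X t w - X s w))"
      by (intro add_left_mono mult_left_mono msq_diff_le GX) auto
    also have "\<dots> \<le> 2 * (C1 * \<delta> * (1 + (2 * (C2 * T) + 2 * CX))) + 2 * (2 * (C2 * \<delta>) + 2 * (C3 * \<delta>))"
    proof (intro add_mono mult_left_mono G(2))
      have "C1 * \<delta> * (1 + msq M ?G) \<le> C1 * \<delta> * (1 + (2 * (C2 * T) + 2 * CX))"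
        using C1 \<delta> Gb by (intro mult_left_mono add_left_mono) auto
      then show "msq M ?D \<le> C1 * \<delta> * (1 + (2 * (C2 * T) + 2 * CX))" using D(2) by simp
      have "msq M (\<lambda>w. X t w - X s w) \<le> C3 * (t - s)" using C3(2) s st t by auto
      also have "\<dots> \<le> C3 * \<delta>" using C3(1) st by (intro mult_left_mono) auto
      finally show "msq M (\<lambda>w. X t w - X s w) \<le> C3 * \<delta>" .
    qed auto
    also have "\<dots> = ?C * \<delta>" by (simp add: algebra_simps)
    finally have "msq M (\<lambda>w. jet_scheme \<gamma> W x\<^sub>0 T N t w - X t w) \<le> ?C * \<delta>" .
    moreover have "sq_integrable M (\<lambda>w. jet_scheme \<gamma> W x\<^sub>0 T N t w - X t w)"
      unfolding eq by (rule sq_integrable_add[OF D(1) GXX])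
    ultimately show ?thesis by (simp add: mean_sq_dist_eq_msq ennreal_leI \<delta>_def)
  qed
  then show ?thesis by blast
qed

end

theorem theorem1:
  fixes M :: "'w measure" and F :: "real \<Rightarrow> 'w measure"
    and W :: "real \<Rightarrow> 'w \<Rightarrow> real ^ 'd::finite"
    and \<gamma> :: "real ^ 'n::finite \<Rightarrow> real ^ 'd \<Rightarrow> real ^ 'n"
    and X :: "real \<Rightarrow> 'w \<Rightarrow> real ^ 'n"
    and x\<^sub>0 :: "real ^ 'n" and K T :: real
  assumes "K > 0" and "admissible_family \<gamma> K"
    and "standard_brownian_motion M F W"
    and "T > 0"
    and "ito_solution M F W T (jet_drift \<gamma>) (jet_diffusion \<gamma>) x\<^sub>0 X"
  shows "(\<forall>t\<in>{0..T}. (\<lambda>N. mean_sq_dist M (jet_scheme \<gamma> W x\<^sub>0 T N t) (X t)) \<longlonglongrightarrow> 0) \<and>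
         (\<exists>C::real. \<forall>N\<ge>1.
            (SUP t\<in>{0..T}. mean_sq_dist M (jet_scheme \<gamma> W x\<^sub>0 T N t) (X t))
              \<le> ennreal (C * (T / real N)))"
proof -
  interpret jet_sde M F W \<gamma> K T x\<^sub>0 X
    using assms by unfold_locales
  obtain C where C: "\<And>N t. N \<ge> 1 \<Longrightarrow> t \<in> {0..T} \<Longrightarrow>
      mean_sq_dist M (jet_scheme \<gamma> W x\<^sub>0 T N t) (X t) \<le> ennreal (C * (T / real N))"
    using jet_scheme_error by blast
  have "(\<lambda>N. mean_sq_dist M (jet_scheme \<gamma> W x\<^sub>0 T N t) (X t)) \<longlonglongrightarrow> 0" if t: "t \<in> {0..T}" for t
  proof (rule tendsto_sandwich[of "\<lambda>_. 0" _ _ "\<lambda>N. ennreal (C * (T / real N))"])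
    have "(\<lambda>N. C * (T / real N)) \<longlonglongrightarrow> C * 0"
      by (intro tendsto_mult tendsto_const lim_const_over_n)
    then show "(\<lambda>N. ennreal (C * (T / real N))) \<longlonglongrightarrow> 0"
      using tendsto_ennrealI by fastforce
    \<comment> \<open>The comparison starts at N = 1, because the rate is available only there; for
      N = 0 the mesh \<open>T / real N\<close> is 0 by default.\<close>
    show "\<forall>\<^sub>F N in sequentially. mean_sq_dist M (jet_scheme \<gamma> W x\<^sub>0 T N t) (X t) \<le> ennreal (C * (T / real N))"
      using C[OF _ t] by (intro eventually_sequentiallyI[of 1])
  qed (auto intro: tendsto_const)
  moreover have "(SUP t\<in>{0..T}. mean_sq_dist M (jet_scheme \<gamma> W x\<^sub>0 T N t) (X t)) \<le> ennreal (C * (T / real N))"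
    if "N \<ge> 1" for N
    using C[OF that] by (intro SUP_least)
  ultimately show ?thesis by blast
qed

end
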